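(* Let $n\ge 2$, let $p<0$, let $U=\{u_1,\ldots,u_N\}\subset S^{n-1}$ consist of $N$ distinct points, and suppose that $\operatorname{pos} U=\mathbb{R}^n$. Let $\mathcal{D}_+(U)$ be the positive-spanning deletion complex of $U$. If $$\widetilde H_k\bigl(\mathcal{D}_+(U);\mathbb{Z}_2\bigr)\neq 0$$ for some integer $k\ge -1$, then for every $\alpha_1,\ldots,\alpha_N>0$ there exists a polytope $P\subset\mathbb{R}^n$ containing the origin in its interior such that $$S_p(P,\cdot)=\sum_{i=1}^N\alpha_i\delta_{u_i}.$$
   Context: $S^{n-1}$ is the unit sphere of $\mathbb{R}^n$ and $\delta_u$ is the Dirac measure at $u$. For a finite set $U=\{u_1,\ldots,u_N\}\subset S^{n-1}$, the positive hull is $\operatorname{pos}U=\{\sum_{i=1}^N\lambda_iu_i:\lambda_i\ge 0\}$. With $E=\{1,\ldots,N\}$, the positive-spanning deletion complex is the simplicial complex $$\mathcal{D}_+(U)=\{J\subset E:\operatorname{pos}\{u_i:i\in E\setminus J\}=\mathbb{R}^n\},$$ with the convention $\operatorname{pos}\varnothing=\{0\}$. It contains $\varnothing$ when $\operatorname{pos}U=\mathbb{R}^n$. $\widetilde H_k(\,\cdot\,;\mathbb{Z}_2)$ denotes $k$-th reduced (simplicial) homology, with the convention $\widetilde H_{-1}(\{\varnothing\};\mathbb{Z}_2)=\mathbb{Z}_2$ (the complex $\{\varnothing\}$ has empty realization and no homology in other degrees; for complexes with at least one vertex $\widetilde H_{-1}=0$). For a convex body (compact convex set with nonempty interior) $K\subset\mathbb{R}^n$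 containing the origin in its interior, $h_K(u)=\max_{x\in K}\langle x,u\rangle$ is the support function, $S_K$ is the surface area measure on $S^{n-1}$, i.e. $S_K(\omega)=\mathcal{H}^{n-1}(\nu_K^{-1}(\omega))$ with $\nu_K$ the $\mathcal{H}^{n-1}$-a.e. defined outer unit normal map on $\partial K$, and the $L_p$ surface area measure is $dS_p(K,\cdot)=h_K^{1-p}\,dS_K$. For a polytope $P$ with the origin in its interior and a facet with outer unit normal $u$ and area $a_P(u)$, $S_p(P,\{u\})=h_P(u)^{1-p}a_P(u)$. *)

theory Defs
  imports
    "HOL-Probability.Giry_Monad"
    "HOL-Algebra.Elementary_Groups"
    "HOL-Library.Z2"
begin

section \<open>Positive hulls and the positive-spanning deletion complex\<close>

text \<open>Meant for finite \<open>V\<close>; \<open>pos_hull {} = {0}\<close> because the empty sum is \<open>0\<close>.\<close>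

definition pos_hull :: "'a::real_vector set \<Rightarrow> 'a set" where
  "pos_hull V = {\<Sum>v\<in>V. c v *\<^sub>R v | c :: 'a \<Rightarrow> real. \<forall>v\<in>V. 0 \<le> c v}"

definition pos_deletion_complex :: "nat \<Rightarrow> (nat \<Rightarrow> 'a::real_vector) \<Rightarrow> nat set set" where
  "pos_deletion_complex N u = {J. J \<subseteq> {1..N} \<and> pos_hull (u ` ({1..N} - J)) = UNIV}"


section \<open>Reduced simplicial homology with coefficients in the two-element field\<close>

text \<open>
  A simplicial complex is a family of finite sets closed under subsets (the empty face included).
  The \<open>k\<close>-faces are the faces with \<open>k + 1\<close> vertices, so that the empty face, if present, is the only
  \<open>(-1)\<close>-face; the boundary map from degree \<open>0\<close> to degree \<open>-1\<close> is therefore the augmentation, and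
  the homology below is the reduced one.
\<close>

definition faces :: "'v set set \<Rightarrow> int \<Rightarrow> 'v set set" where
  "faces K k = {J \<in> K. finite J \<and> int (card J) = k + 1}"

definition chain_group_Z2 :: "'v set set \<Rightarrow> int \<Rightarrow> ('v set \<Rightarrow> bit) monoid" where
  "chain_group_Z2 K k =
     \<lparr>carrier = {c. \<forall>J. J \<notin> faces K k \<longrightarrow> c J = 0},
      monoid.mult = (\<lambda>c d J. c J + d J),
      one = (\<lambda>J. 0)\<rparr>"

text \<open>
  For finite \<open>K\<close>, this is the linear map sending a \<open>k\<close>-face \<open>J\<close> to the sum of the faces \<open>J - {j}\<close>,
  \<open>j \<in> J\<close>, described through the coefficient at each \<open>(k-1)\<close>-face \<open>I\<close>.
\<close>

definition boundary_Z2 :: "'v set set \<Rightarrow> int \<Rightarrow> ('v set \<Rightarrow> bit) \<Rightarrow> ('v set \<Rightarrow> bit)" where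
  "boundary_Z2 K k c =
     (\<lambda>I. if I \<in> faces K (k - 1) then \<Sum>J | J \<in> faces K k \<and> I \<subseteq> J. c J else 0)"

definition cycles_Z2 :: "'v set set \<Rightarrow> int \<Rightarrow> ('v set \<Rightarrow> bit) set" where
  "cycles_Z2 K k = kernel (chain_group_Z2 K k) (chain_group_Z2 K (k - 1)) (boundary_Z2 K k)"

definition boundaries_Z2 :: "'v set set \<Rightarrow> int \<Rightarrow> ('v set \<Rightarrow> bit) set" where
  "boundaries_Z2 K k = boundary_Z2 K (k + 1) ` carrier (chain_group_Z2 K (k + 1))"

definition reduced_homology_Z2 :: "'v set set \<Rightarrow> int \<Rightarrow> ('v set \<Rightarrow> bit) set monoid" where
  "reduced_homology_Z2 K k =
     (chain_group_Z2 K k)\<lparr>carrier := cycles_Z2 K k\<rparr> Mod boundaries_Z2 K k"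


section \<open>Hausdorff measure\<close>

text \<open>
  The empty set is treated separately so that the formula is also right for \<open>d = 0\<close>. The constant
  \<open>unit_ball_vol d / 2 ^ d\<close> is the normalization for which \<open>d\<close>-dimensional Hausdorff measure agrees
  with Lebesgue measure on \<open>d\<close>-dimensional affine subspaces.
\<close>

definition hausdorff_gauge :: "nat \<Rightarrow> 'a::metric_space set \<Rightarrow> ennreal" where
  "hausdorff_gauge d C =
     (if C = {} then 0 else ennreal (unit_ball_vol (real d) * (diameter C / 2) ^ d))"

text \<open>Boundedness is required explicitly since \<open>diameter\<close> is meaningless on unbounded sets.\<close>

definition hausdorff_premeasure :: "nat \<Rightarrow> real \<Rightarrow> 'a::metric_space set \<Rightarrow> ennreal" where
  "hausdorff_premeasure d \<delta> A =
     (INF C \<in> {C :: nat \<Rightarrow> 'a set. A \<subseteq> (\<Union>i. C i) \<and> (\<forall>i. bounded (C i) \<and> diameter (C i) \<le> \<delta>)}.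
        \<Sum>i. hausdorff_gauge d (C i))"

definition hausdorff_measure :: "nat \<Rightarrow> 'a::metric_space set \<Rightarrow> ennreal" where
  "hausdorff_measure d A = (SUP \<delta> \<in> {0<..}. hausdorff_premeasure d \<delta> A)"


section \<open>Surface area measures\<close>

definition support_function :: "'a::euclidean_space set \<Rightarrow> 'a \<Rightarrow> real" where
  "support_function K v = (SUP x\<in>K. x \<bullet> v)"

definition outer_unit_normals :: "'a::euclidean_space set \<Rightarrow> 'a \<Rightarrow> 'a set" where
  "outer_unit_normals K x = {v. norm v = 1 \<and> (\<forall>y\<in>K. (y - x) \<bullet> v \<le> 0)}"

text \<open>The domain of the outer unit normal map: boundary points with exactly one outer unit normal.\<close>

definition regular_boundary :: "'a::euclidean_space set \<Rightarrow> 'a set" where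
  "regular_boundary K = {x \<in> frontier K. \<exists>!v. v \<in> outer_unit_normals K x}"

definition gauss_map :: "'a::euclidean_space set \<Rightarrow> 'a \<Rightarrow> 'a" where
  "gauss_map K x = (THE v. v \<in> outer_unit_normals K x)"

definition sphere_borel :: "'a::euclidean_space measure" where
  "sphere_borel = restrict_space borel (sphere 0 1)"

text \<open>The measures below are intended for convex bodies \<open>K\<close>, the second one with \<open>0 \<in> interior K\<close>.\<close>

definition surface_area_measure :: "'a::euclidean_space set \<Rightarrow> 'a measure" where
  "surface_area_measure K =
     measure_of (sphere 0 1) (sets sphere_borel)
       (\<lambda>\<omega>. hausdorff_measure (DIM('a) - 1) {x \<in> regular_boundary K. gauss_map K x \<in> \<omega>})"

definition Lp_surface_area_measure :: "real \<Rightarrow> 'a::euclidean_space set \<Rightarrow> 'a measure" where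
  "Lp_surface_area_measure p K =
     density (surface_area_measure K) (\<lambda>v. ennreal (support_function K v powr (1 - p)))"

text \<open>The measure \<open>\<Sum>i\<in>I. \<alpha> i \<cdot> \<delta>(u i)\<close>; the Dirac measure at \<open>x\<close> is \<open>return sphere_borel x\<close>.\<close>

definition dirac_combination :: "'i set \<Rightarrow> ('i \<Rightarrow> real) \<Rightarrow> ('i \<Rightarrow> 'a::euclidean_space) \<Rightarrow> 'a measure" where
  "dirac_combination I \<alpha> u =
     measure_of (sphere 0 1) (sets sphere_borel)
       (\<lambda>\<omega>. \<Sum>i\<in>I. ennreal (\<alpha> i) * emeasure (return sphere_borel (u i)) \<omega>)"

end

theory Submission
  imports Defs "HOL-Library.Poly_Mapping"
begin

text \<open>
  Put \<open>q = - p\<close>. In the coordinates \<open>y i = h i powr p \<ge> 0\<close>, where \<open>h i\<close> are support numbers and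
  \<open>y i = 0\<close> means that the \<open>i\<close>-th inequality is dropped, the solutions are (up to the normalization of
  the volume) the critical points with all \<open>y i > 0\<close> of the energy
  \<open>q * volume + (\<Sum>i. \<alpha> i * y i)\<close>. The energy is finite exactly on the region
  where the zero set of \<open>y\<close> lies in the deletion complex \<open>D\<close>, and its sublevel sets in this region are
  compact. On the boundary, where some \<open>y i\<close> vanishes, the \<open>i\<close>-th partial derivative is \<open>\<alpha> i > 0\<close>, so
  descent never leaves a boundary face. Without a critical point, finitely many descent steps would
  therefore push every sublevel set into the boundary while preserving the boundary faces. The boundary is
  homotopy equivalent to \<open>D\<close>, being covered by contractible faces with nerve \<open>D\<close>, whereas the whole
  region is contractible; hence \<open>D\<close> would be acyclic. The last step is carried out with Vietoris
  chains: cycles of \<open>D\<close> are realized by small simplices, filled inside the region, pushed to the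
  boundary, and read off again by labelling each point with a vanishing coordinate.
\<close>

section \<open>Chains over the two-element field\<close>

text \<open>The factor \<open>q\<close> and the exponent come from the chain rule. The normalized
  volume has the facet area as its derivative in the support number \<open>h i\<close>, and
  \<open>h i = y i powr (- 1 / q)\<close> has derivative
  \<open>- (1 / q) * h i powr (1 + q)\<close>. So the partial derivative of the energy is
  \<open>\<alpha> i\<close> minus the facet area times \<open>h i powr (1 - p)\<close>, and a
  critical point solves the problem exactly, with no rescaling afterwards. When \<open>y i\<close>
  tends to 0, the i-th hyperplane moves to infinity while the bodies stay bounded, so the facet is
  already empty nearby; this gives the boundary value \<open>\<alpha> i\<close> and forces every
  critical point to have positive coordinates. Only continuity of the gradient is established, which
  does not yield a gradient flow. Euler steps of a fixed size replace it: on a compact sublevel set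
  uniform continuity gives a fixed energy loss for each step that ends off the boundary. These steps
  move boundary points too, but they never shrink the set of vanishing coordinates, and the
  labelling uses nothing else.\<close>

definition lin_ext :: "('a \<Rightarrow> 'b \<Rightarrow>\<^sub>0 bit) \<Rightarrow> ('a \<Rightarrow>\<^sub>0 bit) \<Rightarrow> ('b \<Rightarrow>\<^sub>0 bit)" where
  "lin_ext f c = (\<Sum>a\<in>Poly_Mapping.keys c. f a)"

abbreviation basic :: "'a \<Rightarrow> 'a \<Rightarrow>\<^sub>0 bit" where
  "basic a \<equiv> Poly_Mapping.single a 1"

lemma chain_double [simp]: "(c :: 'a \<Rightarrow>\<^sub>0 bit) + c = 0"
  by (rule poly_mapping_eqI) (simp add: lookup_add)

lemma chain_double_left [simp]: "(c :: 'a \<Rightarrow>\<^sub>0 bit) + (c + d) = d"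
  by (simp add: add.assoc [symmetric])

lemma keys_add_bit:
  "Poly_Mapping.keys ((c :: 'a \<Rightarrow>\<^sub>0 bit) + d) =
     (Poly_Mapping.keys c - Poly_Mapping.keys d) \<union> (Poly_Mapping.keys d - Poly_Mapping.keys c)"
  by (auto simp: in_keys_iff lookup_add)

lemma lin_ext_0 [simp]: "lin_ext f 0 = 0"
  by (simp add: lin_ext_def)

lemma lin_ext_simplex [simp]: "lin_ext f (basic a) = f a"
  by (simp add: lin_ext_def)

text \<open>Every nonzero coefficient is 1, so a chain is its set of keys and addition is symmetric
  difference. Keys common to \<open>c\<close> and \<open>d\<close> disappear from
  \<open>c + d\<close>, and on the right their images occur twice and cancel.\<close>

lemma lin_ext_add [simp]: "lin_ext f (c + d) = lin_ext f c + lin_ext f d"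
proof -
  let ?C = "Poly_Mapping.keys c" and ?D = "Poly_Mapping.keys d"
  have "lin_ext f (c + d) = sum f (?C - ?D) + sum f (?D - ?C)"
    unfolding lin_ext_def keys_add_bit by (rule sum.union_disjoint) auto
  moreover have "lin_ext f c = sum f (?C - ?D) + sum f (?C \<inter> ?D)"
    unfolding lin_ext_def by (metis add.commute finite_keys sum.Int_Diff)
  moreover have "lin_ext f d = sum f (?D - ?C) + sum f (?C \<inter> ?D)"
    unfolding lin_ext_def by (metis add.commute finite_keys sum.Int_Diff inf_commute)
  ultimately show ?thesis
    by (simp add: ac_simps)
qed

lemma chain_induct [case_names zero basic add]:
  assumes "P 0" "\<And>a. a \<in> Poly_Mapping.keys c \<Longrightarrow> P (basic a)" "\<And>c d. P c \<Longrightarrow> P d \<Longrightarrow> P (c + d)"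
  shows "P (c :: 'a \<Rightarrow>\<^sub>0 bit)"
proof -
  have "P (sum basic A)" if "finite A" "A \<subseteq> Poly_Mapping.keys c" for A
    using that by (induction A) (auto intro: assms)
  moreover have "c = sum basic (Poly_Mapping.keys c)"
    by (rule poly_mapping_eqI) (auto simp: lookup_sum lookup_single when_def in_keys_iff)
  ultimately show ?thesis
    by (metis finite_keys order_refl)
qed

lemma lin_ext_sum: "lin_ext f (sum g A) = (\<Sum>a\<in>A. lin_ext f (g a))"
  by (induction A rule: infinite_finite_induct) auto

lemma lin_ext_cong: "(\<And>a. a \<in> Poly_Mapping.keys c \<Longrightarrow> f a = g a) \<Longrightarrow> lin_ext f c = lin_ext g c"
  by (simp add: lin_ext_def)

lemma lin_ext_lin_ext: "lin_ext f (lin_ext g c) = lin_ext (\<lambda>a. lin_ext f (g a)) c"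
  by (induction c rule: chain_induct) auto

lemma lin_ext_fun_add: "lin_ext (\<lambda>a. f a + g a) c = lin_ext f c + lin_ext g c"
  by (simp add: lin_ext_def sum.distrib)

lemma lin_ext_id [simp]: "lin_ext basic c = c"
  by (induction c rule: chain_induct) auto

lemma keys_lin_ext: "Poly_Mapping.keys (lin_ext f c) \<subseteq> (\<Union>a\<in>Poly_Mapping.keys c. Poly_Mapping.keys (f a))"
  by (metis lin_ext_def keys_sum)

section \<open>Ordered simplices, their boundary and the prism operator\<close>

definition prepend :: "'a \<Rightarrow> ('a list \<Rightarrow>\<^sub>0 bit) \<Rightarrow> ('a list \<Rightarrow>\<^sub>0 bit)" where
  "prepend x = lin_ext (\<lambda>l. basic (x # l))"

text \<open>The cone formula for the boundary. The empty list is the simplex of degree -1, so a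
  single vertex has boundary \<open>basic []\<close> and the complex is augmented. Lists with
  repetitions are allowed.\<close>

primrec list_bd :: "'a list \<Rightarrow> 'a list \<Rightarrow>\<^sub>0 bit" where
  "list_bd [] = 0"
| "list_bd (x # l) = basic l + prepend x (list_bd l)"

abbreviation "bd \<equiv> lin_ext list_bd"
abbreviation "push f \<equiv> lin_ext (\<lambda>l. basic (map f l))"

lemma prepend_simps [simp]: "prepend x 0 = 0" "prepend x (basic l) = basic (x # l)"
  "prepend x (c + d) = prepend x c + prepend x d"
  by (auto simp: prepend_def)

lemma bd_prepend [simp]: "bd (prepend x c) = c + prepend x (bd c)"
  by (induction c rule: chain_induct) (auto simp: ac_simps)

lemma push_prepend [simp]: "push f (prepend x c) = prepend (f x) (push f c)"
  by (induction c rule: chain_induct) auto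

lemma list_bd_map: "list_bd (map f l) = push f (list_bd l)"
  by (induction l) auto

lemma bd_push: "bd (push f c) = push f (bd c)"
  by (induction c rule: chain_induct) (auto simp: list_bd_map)

text \<open>The usual prism operator: unfolded, it sums over all positions \<open>i\<close> the
  lists that follow \<open>f\<close> up to the i-th vertex and \<open>g\<close> from the i-th vertex
  on. It is the chain homotopy between \<open>push f\<close> and \<open>push g\<close>.\<close>

primrec prism :: "('a \<Rightarrow> 'b) \<Rightarrow> ('a \<Rightarrow> 'b) \<Rightarrow> 'a list \<Rightarrow> 'b list \<Rightarrow>\<^sub>0 bit" where
  "prism f g [] = 0"
| "prism f g (x # l) = basic (f x # map g (x # l)) + prepend (f x) (prism f g l)"

lemma prism_prepend:
  "lin_ext (prism f g) (prepend x c) = prepend (f x) (prepend (g x) (push g c)) + prepend (f x) (lin_ext (prism f g) c)"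
  by (induction c rule: chain_induct) (auto simp: ac_simps)

lemma bd_prism: "bd (prism f g l) + lin_ext (prism f g) (list_bd l) = basic (map f l) + basic (map g l)"
proof (induction l)
  case (Cons x l)
  have "bd (prism f g l) = lin_ext (prism f g) (list_bd l) + (basic (map f l) + basic (map g l))"
    using Cons.IH by (metis chain_double_left add.commute)
  then show ?case
    by (simp add: prism_prepend list_bd_map ac_simps)
qed simp

lemma bd_prism_cycle:
  assumes "bd c = 0"
  shows "bd (lin_ext (prism f g) c) = push f c + push g c"
proof -
  have "bd (lin_ext (prism f g) c) + lin_ext (prism f g) (bd c) = push f c + push g c"
  proof (induction c rule: chain_induct)
    case (add c d)
    then show ?case by (simp add: algebra_simps)
  qed (simp_all add: bd_prism)
  with assms show ?thesis by simp
qed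

section \<open>Unordered simplices and forgetting the order\<close>

definition set_bd :: "'a set \<Rightarrow> 'a set \<Rightarrow>\<^sub>0 bit" where
  "set_bd J = (\<Sum>j\<in>J. basic (J - {j}))"

definition cone_face :: "'a \<Rightarrow> 'a set \<Rightarrow> 'a set \<Rightarrow>\<^sub>0 bit" where
  "cone_face x J = (if x \<in> J then 0 else basic (insert x J))"

primrec unorder :: "'a list \<Rightarrow> 'a set \<Rightarrow>\<^sub>0 bit" where
  "unorder [] = basic {}"
| "unorder (x # l) = lin_ext (cone_face x) (unorder l)"

lemma unorder_eq: "unorder l = (if distinct l then basic (set l) else 0)"
  by (induction l) (auto simp: cone_face_def)

text \<open>If \<open>x\<close> lies in \<open>J\<close>, the cone is zero. On the right every facet
  except \<open>J - {x}\<close> still contains \<open>x\<close> and is sent to zero, while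
  \<open>J - {x}\<close> returns \<open>J\<close>, which cancels against the first summand.\<close>

lemma set_bd_cone_face:
  assumes "finite J"
  shows "lin_ext set_bd (cone_face x J) = basic J + lin_ext (cone_face x) (set_bd J)"
proof (cases "x \<in> J")
  case True
  have "lin_ext (cone_face x) (set_bd J) = (\<Sum>j\<in>J. if j = x then basic J else 0)"
    unfolding set_bd_def lin_ext_sum using True
    by (intro sum.cong) (auto simp: cone_face_def insert_absorb)
  also have "\<dots> = basic J"
    using True assms by simp
  finally show ?thesis using True by (simp add: cone_face_def)
next
  case False
  have "set_bd (insert x J) = basic J + (\<Sum>j\<in>J. basic (insert x J - {j}))"
    using False assms by (simp add: set_bd_def)
  also have "(\<Sum>j\<in>J. basic (insert x J - {j})) = (\<Sum>j\<in>J. lin_ext (cone_face x) (basic (J - {j})))"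
    using False by (intro sum.cong) (auto simp: cone_face_def intro!: arg_cong[where f = basic])
  finally show ?thesis using False
    by (simp add: cone_face_def lin_ext_sum set_bd_def)
qed

lemma set_bd_cone_face_chain:
  assumes "\<And>J. J \<in> Poly_Mapping.keys c \<Longrightarrow> finite J"
  shows "lin_ext set_bd (lin_ext (cone_face x) c) = c + lin_ext (cone_face x) (lin_ext set_bd c)"
proof -
  have "lin_ext set_bd (lin_ext (cone_face x) c) = lin_ext (\<lambda>J. basic J + lin_ext (cone_face x) (set_bd J)) c"
    unfolding lin_ext_lin_ext by (rule lin_ext_cong) (simp add: set_bd_cone_face assms)
  then show ?thesis
    by (simp add: lin_ext_fun_add lin_ext_lin_ext)
qed

lemma unorder_prepend: "lin_ext unorder (prepend x c) = lin_ext (cone_face x) (lin_ext unorder c)"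
  by (induction c rule: chain_induct) auto

text \<open>Forgetting the order, with degenerate lists sent to zero, is a chain map because both
  boundaries obey the same cone formula.\<close>

lemma set_bd_unorder: "lin_ext set_bd (unorder l) = lin_ext unorder (list_bd l)"
proof (induction l)
  case Nil
  then show ?case by (simp add: set_bd_def)
next
  case (Cons x l)
  have "\<And>J. J \<in> Poly_Mapping.keys (unorder l) \<Longrightarrow> finite J"
    by (auto simp: unorder_eq split: if_splits)
  then show ?case
    by (simp add: set_bd_cone_face_chain Cons unorder_prepend)
qed

lemma set_bd_unorder_chain: "lin_ext set_bd (lin_ext unorder c) = lin_ext unorder (bd c)"
  by (simp add: lin_ext_lin_ext set_bd_unorder)

lemma bd_bd: "bd (list_bd l) = 0"
  by (induction l) auto

lemma keys_prepend: "Poly_Mapping.keys (prepend x c) \<subseteq> (#) x ` Poly_Mapping.keys c"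
  unfolding prepend_def using keys_lin_ext[of "\<lambda>l. basic (x # l)" c] by auto

lemma keys_prism:
  "l' \<in> Poly_Mapping.keys (prism f g l) \<Longrightarrow> length l' = Suc (length l) \<and> set l' \<subseteq> f ` set l \<union> g ` set l"
proof (induction l arbitrary: l')
  case (Cons x l)
  have "Poly_Mapping.keys (prism f g (x # l)) \<subseteq>
      {f x # map g (x # l)} \<union> (#) (f x) ` Poly_Mapping.keys (prism f g l)"
    using Poly_Mapping.keys_add[of "basic (f x # map g (x # l))"] keys_prepend[of "f x" "prism f g l"] by auto
  then consider "l' = f x # map g (x # l)" | k where "l' = f x # k" "k \<in> Poly_Mapping.keys (prism f g l)"
    using Cons.prems by blast
  then show ?case
  proof cases
    case 1
    then show ?thesis by auto
  next
    case 2
    with Cons.IH[OF 2(2)] show ?thesis by auto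
  qed
qed simp

section \<open>Small chains and their fillings in star-shaped sets\<close>

definition l1_dist :: "'i set \<Rightarrow> ('i \<Rightarrow> real) \<Rightarrow> ('i \<Rightarrow> real) \<Rightarrow> real" where
  "l1_dist I x y = (\<Sum>i\<in>I. \<bar>x i - y i\<bar>)"

definition pull :: "('i \<Rightarrow> real) \<Rightarrow> real \<Rightarrow> ('i \<Rightarrow> real) \<Rightarrow> ('i \<Rightarrow> real)" where
  "pull b s x = (\<lambda>i. (1 - s) * x i + s * b i)"

lemma pull_0 [simp]: "pull b 0 x = x" and pull_1 [simp]: "pull b 1 x = b"
  by (auto simp: pull_def)

lemma l1_dist_commute: "l1_dist I x y = l1_dist I y x"
  by (simp add: l1_dist_def abs_minus_commute)

lemma l1_dist_nonneg: "0 \<le> l1_dist I x y"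
  by (simp add: l1_dist_def sum_nonneg)

lemma l1_dist_self [simp]: "l1_dist I x x = 0"
  by (simp add: l1_dist_def)

text \<open>The difference of the pulled points is \<open>(1 - s') * (x - y)\<close>, a contraction,
  plus \<open>(s' - s) * (x - b)\<close>, the error from pulling for different times.\<close>

lemma l1_dist_pull:
  assumes "0 \<le> s" "s \<le> s'" "s' \<le> 1"
  shows "l1_dist I (pull b s x) (pull b s' y) \<le> l1_dist I x y + (s' - s) * l1_dist I x b"
proof -
  have "\<bar>pull b s x i - pull b s' y i\<bar> \<le> \<bar>x i - y i\<bar> + (s' - s) * \<bar>x i - b i\<bar>" for i
  proof -
    have "pull b s x i - pull b s' y i = (1 - s') * (x i - y i) + (s' - s) * (x i - b i)"
      by (simp add: pull_def algebra_simps)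
    then have "\<bar>pull b s x i - pull b s' y i\<bar> \<le> \<bar>(1 - s') * (x i - y i)\<bar> + \<bar>(s' - s) * (x i - b i)\<bar>"
      by (simp add: abs_triangle_ineq)
    also have "\<bar>(1 - s') * (x i - y i)\<bar> \<le> \<bar>x i - y i\<bar>"
      using assms by (simp add: abs_mult mult_left_le_one_le)
    finally show ?thesis using assms by (simp add: abs_mult)
  qed
  then show ?thesis
    unfolding l1_dist_def sum_distrib_left sum.distrib[symmetric] by (intro sum_mono) auto
qed

text \<open>The small chains form the Vietoris complex of \<open>S\<close> at scale \<open>\<epsilon>\<close>, with ordered simplices.\<close>

definition small_chain ::
  "'i set \<Rightarrow> real \<Rightarrow> ('i \<Rightarrow> real) set \<Rightarrow> nat \<Rightarrow> (('i \<Rightarrow> real) list \<Rightarrow>\<^sub>0 bit) \<Rightarrow> bool" where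
  "small_chain I \<epsilon> S m c \<longleftrightarrow> (\<forall>l\<in>Poly_Mapping.keys c. length l = m \<and> set l \<subseteq> S \<and>
     (\<forall>x\<in>set l. \<forall>y\<in>set l. l1_dist I x y < \<epsilon>))"

lemma small_chain_add: "small_chain I \<epsilon> S m c \<Longrightarrow> small_chain I \<epsilon> S m d \<Longrightarrow> small_chain I \<epsilon> S m (c + d)"
  unfolding small_chain_def using Poly_Mapping.keys_add[of c d] by blast

lemma small_chain_0 [simp]: "small_chain I \<epsilon> S m 0"
  by (simp add: small_chain_def)

lemma small_chain_sum: "(\<And>a. a \<in> A \<Longrightarrow> small_chain I \<epsilon> S m (f a)) \<Longrightarrow> small_chain I \<epsilon> S m (sum f A)"
  by (induction A rule: infinite_finite_induct) (auto intro: small_chain_add)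

lemma small_chain_lin_ext:
  "(\<And>a. a \<in> Poly_Mapping.keys c \<Longrightarrow> small_chain I \<epsilon> S m (f a)) \<Longrightarrow> small_chain I \<epsilon> S m (lin_ext f c)"
  unfolding lin_ext_def by (rule small_chain_sum)

lemma small_chain_mono: "small_chain I \<epsilon> S m c \<Longrightarrow> S \<subseteq> T \<Longrightarrow> small_chain I \<epsilon> T m c"
  unfolding small_chain_def by blast

text \<open>A small cycle is pulled to \<open>b\<close> in steps so short that the connecting prisms stay small.\<close>

lemma small_cycle_bounds:
  fixes c :: "('i \<Rightarrow> real) list \<Rightarrow>\<^sub>0 bit"
  assumes "0 < \<epsilon>" "b \<in> S" and star: "\<And>x s. x \<in> S \<Longrightarrow> 0 \<le> s \<Longrightarrow> s \<le> 1 \<Longrightarrow> pull b s x \<in> S"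
    and small: "small_chain I \<epsilon> S m c" and cycle: "bd c = 0"
  shows "\<exists>e. bd e = c \<and> small_chain I \<epsilon> S (Suc m) e"
proof -
  \<comment> \<open>The chain has finitely many vertices, and those of one simplex are at distance
    strictly less than \<open>\<epsilon>\<close>. This leaves room for the displacement of one step
    once the number \<open>M\<close> of steps is large.\<close>
  define X where "X = (\<Union>l\<in>Poly_Mapping.keys c. set l)"
  have "finite X" by (auto simp: X_def)
  have "\<forall>\<^sub>F M in sequentially. l1_dist I x y < \<epsilon> \<longrightarrow> l1_dist I x y + 1 / real M * l1_dist I x b < \<epsilon>"
    for x y
  proof (cases "l1_dist I x y < \<epsilon>")
    case True
    have "(\<lambda>M. l1_dist I x y + 1 / real M * l1_dist I x b) \<longlonglongrightarrow> l1_dist I x y + 0 * l1_dist I x b"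
      by (intro tendsto_intros lim_1_over_n)
    from order_tendstoD(2)[OF this, of \<epsilon>] True show ?thesis
      by (auto elim: eventually_mono)
  qed auto
  then have "\<forall>\<^sub>F M in sequentially. \<forall>x\<in>X. \<forall>y\<in>X.
      l1_dist I x y < \<epsilon> \<longrightarrow> l1_dist I x y + 1 / real M * l1_dist I x b < \<epsilon>"
    using \<open>finite X\<close> by (intro eventually_ball_finite ballI) auto
  from eventually_happens'[OF sequentially_bot eventually_conj[OF this eventually_gt_at_top[of 0]]]
  obtain M where "M > 0" and M: "\<And>x y. x \<in> X \<Longrightarrow> y \<in> X \<Longrightarrow> l1_dist I x y < \<epsilon> \<Longrightarrow>
      l1_dist I x y + 1 / real M * l1_dist I x b < \<epsilon>"
    by blast
  define h where "h j = pull b (real j / real M)" for j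
  \<comment> \<open>The prisms connect \<open>c\<close> to its image at time 1, where every vertex
    equals \<open>b\<close>. That last cycle is the boundary of its cone from \<open>b\<close>, and
    the cone has diameter 0.\<close>
  define e where "e = (\<Sum>j<M. lin_ext (prism (h j) (h (Suc j))) c) + prepend b (push (h M) c)"
  have tele: "(\<Sum>j<k. push (h j) c + push (h (Suc j)) c) = push (h 0) c + push (h k) c" for k
    by (induction k) (auto simp: ac_simps)
  have h0: "push (h 0) c = c"
  proof -
    have "h 0 = (\<lambda>x. x)" by (auto simp: h_def)
    then show ?thesis by simp
  qed
  have "bd e = c"
    unfolding e_def using \<open>M > 0\<close>
    by (simp add: lin_ext_sum bd_prism_cycle cycle tele h0 bd_push ac_simps)
  moreover have "small_chain I \<epsilon> S (Suc m) e"
    unfolding e_def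
  proof (intro small_chain_add small_chain_sum small_chain_lin_ext)
    fix j l assume "j \<in> {..<M}" and l: "l \<in> Poly_Mapping.keys c"
    then have j: "j < M" by simp
    have fine: "l1_dist I (h i x) (h i' y) < \<epsilon>" if "x \<in> set l" "y \<in> set l" "i \<le> i'" "i' \<le> Suc i" "i' \<le> M" for x y i i'
    proof -
      have "l1_dist I (h i x) (h i' y) \<le> l1_dist I x y + (real i' / M - real i / M) * l1_dist I x b"
        unfolding h_def using that \<open>M > 0\<close> by (intro l1_dist_pull) (auto simp: field_simps)
      also have "(real i' / M - real i / M) \<le> 1 / real M"
        using that \<open>M > 0\<close> by (simp add: diff_divide_distrib [symmetric] divide_right_mono)
      also have "l1_dist I x y + 1 / real M * l1_dist I x b < \<epsilon>"
        using that l small by (intro M) (auto simp: X_def small_chain_def)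
      finally show ?thesis by (simp add: mult_right_mono l1_dist_nonneg)
    qed
    show "small_chain I \<epsilon> S (Suc m) (prism (h j) (h (Suc j)) l)"
      unfolding small_chain_def
    proof (intro ballI conjI)
      fix l' assume l': "l' \<in> Poly_Mapping.keys (prism (h j) (h (Suc j)) l)"
      note k = keys_prism[OF l']
      show "length l' = Suc m"
        using k l small by (auto simp: small_chain_def)
      have "h i x \<in> S" if "x \<in> set l" "i \<le> M" for x i
        unfolding h_def using that l small \<open>M > 0\<close> by (intro star) (auto simp: small_chain_def)
      then show "set l' \<subseteq> S"
        using k j by fastforce
      fix x y assume "x \<in> set l'" "y \<in> set l'"
      with k obtain x0 y0 where "x0 \<in> set l" "y0 \<in> set l" "x = h j x0 \<or> x = h (Suc j) x0" "y = h j y0 \<or> y = h (Suc j) y0"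
        by blast
      then show "l1_dist I x y < \<epsilon>"
        using fine[of x0 y0] fine[of y0 x0] j by (auto simp: l1_dist_commute[of I "h (Suc j) _" "h j _"])
    qed
  next
    show "small_chain I \<epsilon> S (Suc m) (prepend b (push (h M) c))"
      unfolding small_chain_def
    proof (intro ballI)
      fix l' assume "l' \<in> Poly_Mapping.keys (prepend b (push (h M) c))"
      then obtain l where l: "l \<in> Poly_Mapping.keys c" "l' = b # map (h M) l"
        using keys_prepend[of b "push (h M) c"] keys_lin_ext[of "\<lambda>l. basic (map (h M) l)" c] by fastforce
      then have "\<forall>x\<in>set l'. x = b"
        using \<open>M > 0\<close> by (auto simp: h_def)
      moreover have "length l' = Suc m"
        using l small by (simp add: small_chain_def)
      moreover have "l1_dist I x y < \<epsilon>" if "x \<in> set l'" "y \<in> set l'" for x y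
      proof -
        have "x = b" "y = b" using that \<open>\<forall>x\<in>set l'. x = b\<close> by blast+
        then show ?thesis using \<open>0 < \<epsilon>\<close> by simp
      qed
      ultimately show "length l' = Suc m \<and> set l' \<subseteq> S \<and> (\<forall>x\<in>set l'. \<forall>y\<in>set l'. l1_dist I x y < \<epsilon>)"
        using \<open>b \<in> S\<close> \<open>0 < \<epsilon>\<close> by auto
    qed
  qed
  ultimately show ?thesis by blast
qed

text \<open>Any ordering of \<open>J\<close> lifts \<open>set_bd J\<close> to a list boundary, whose
  boundary vanishes by the cone formula.\<close>

lemma set_bd_set_bd:
  assumes "finite J"
  shows "lin_ext set_bd (set_bd J) = 0"
proof -
  obtain l where "set l = J" "distinct l"
    using finite_distinct_list[OF assms] by blast
  then have "set_bd J = lin_ext unorder (list_bd l)"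
    by (metis lin_ext_simplex set_bd_unorder unorder_eq)
  then show ?thesis
    by (simp add: set_bd_unorder_chain bd_bd)
qed

section \<open>Simplicial complexes and coordinate faces of an orthant\<close>

locale deletion_family =
  fixes I :: "'i set" and D :: "'i set set"
  assumes finite_I: "finite I" and D_subset: "J \<in> D \<Longrightarrow> J \<subseteq> I"
    and D_down: "J \<in> D \<Longrightarrow> K \<subseteq> J \<Longrightarrow> K \<in> D" and D_empty: "{} \<in> D"
begin

definition zero_set :: "('i \<Rightarrow> real) \<Rightarrow> 'i set" where
  "zero_set y = {i \<in> I. y i = 0}"

definition corner :: "'i set \<Rightarrow> 'i \<Rightarrow> real" where
  "corner J i = (if i \<in> J then 0 else 1)"

text \<open>A convex set, spanned by one point for each face, in which all chains for
  \<open>D\<close> are realized. It lies in the admissible region (\<open>hull_nonneg\<close>,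
  \<open>hull_zero_set\<close>), and compactness of its weights bounds the energy on it.\<close>

definition corner_hull :: "('i \<Rightarrow> real) set" where
  "corner_hull = {\<lambda>i. \<Sum>J\<in>D. a J * corner J i | a. (\<forall>J\<in>D. 0 \<le> a J) \<and> sum a D = 1}"

lemma finite_D: "finite D"
  by (meson D_subset finite_I finite_Pow_iff PowI finite_subset subsetI)

lemma finite_face: "J \<in> D \<Longrightarrow> finite J"
  using D_subset finite_I finite_subset by blast

lemma corner_in_hull: "J \<in> D \<Longrightarrow> corner J \<in> corner_hull"
  unfolding corner_hull_def
  by (rule CollectI, rule exI[of _ "\<lambda>K. if K = J then 1 else 0"])
     (auto simp: finite_D if_distrib[of "\<lambda>x. x * _"] cong: if_cong)

lemma pull_in_hull:
  assumes "J \<in> D" "x \<in> corner_hull" "0 \<le> s" "s \<le> 1"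
  shows "pull (corner J) s x \<in> corner_hull"
proof -
  obtain a where a: "\<forall>J\<in>D. 0 \<le> a J" "sum a D = 1" "x = (\<lambda>i. \<Sum>J\<in>D. a J * corner J i)"
    using assms by (auto simp: corner_hull_def)
  let ?e = "\<lambda>K. if K = J then s else 0"
  have "pull (corner J) s x = (\<lambda>i. \<Sum>K\<in>D. ((1 - s) * a K + ?e K) * corner K i)"
  proof
    fix i
    have "(\<Sum>K\<in>D. ?e K * corner K i) = s * corner J i"
      using assms(1) finite_D by (simp add: if_distrib[of "\<lambda>x. x * _"] cong: if_cong)
    then show "pull (corner J) s x i = (\<Sum>K\<in>D. ((1 - s) * a K + ?e K) * corner K i)"
      by (simp add: a(3) pull_def distrib_right sum.distrib sum_distrib_left mult.assoc)
  qed
  moreover have "(\<Sum>K\<in>D. (1 - s) * a K + ?e K) = 1"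
    using assms(1) finite_D a(2) by (simp add: sum.distrib flip: sum_distrib_left)
  ultimately show ?thesis
    unfolding corner_hull_def using a(1) assms
    by (intro CollectI exI[of _ "\<lambda>K. (1 - s) * a K + ?e K"]) auto
qed

lemma hull_nonneg: "x \<in> corner_hull \<Longrightarrow> 0 \<le> x i"
  unfolding corner_hull_def by (auto intro!: sum_nonneg simp: corner_def)

text \<open>Some corner \<open>J\<close> has positive weight, and each coordinate outside
  \<open>J\<close> is at least that weight. So only coordinates in \<open>J\<close> can
  vanish.\<close>

lemma hull_zero_set:
  assumes "x \<in> corner_hull"
  shows "zero_set x \<in> D"
proof -
  obtain a where a: "\<forall>J\<in>D. 0 \<le> a J" "sum a D = 1" "x = (\<lambda>i. \<Sum>J\<in>D. a J * corner J i)"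
    using assms by (auto simp: corner_hull_def)
  then obtain J where J: "J \<in> D" "a J > 0"
    by (metis less_eq_real_def sum.neutral zero_neq_one)
  have "i \<in> J" if "i \<in> zero_set x" for i
  proof (rule ccontr)
    assume "i \<notin> J"
    then have "a J \<le> x i"
      using member_le_sum[of J D "\<lambda>J. a J * corner J i"] a J finite_D by (auto simp: corner_def)
    with J that show False by (simp add: zero_set_def)
  qed
  then show ?thesis using J D_down by blast
qed

text \<open>The carrier of the face \<open>J\<close> on the boundary of the region. It grows with
  \<open>J\<close> and is star-shaped about \<open>corner J\<close>, which is what an acyclic
  carrier argument requires.\<close>

definition star_set :: "'i set \<Rightarrow> ('i \<Rightarrow> real) set" where
  "star_set J = {y \<in> corner_hull. zero_set y \<noteq> {} \<and> zero_set y \<subseteq> J}"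

text \<open>Coordinates in \<open>J\<close> vanish at \<open>corner J\<close>, so those that vanish
  at \<open>x\<close> stay zero. A coordinate outside \<open>J\<close> is positive at both
  \<open>x\<close> and \<open>corner J\<close>, so it stays positive.\<close>

lemma pull_star_set:
  assumes "J \<in> D" "x \<in> star_set J" "0 \<le> s" "s \<le> 1"
  shows "pull (corner J) s x \<in> star_set J"
proof -
  have *: "x \<in> corner_hull" "zero_set x \<noteq> {}" "zero_set x \<subseteq> J" using assms by (auto simp: star_set_def)
  have "zero_set x \<subseteq> zero_set (pull (corner J) s x)"
    using *(3) by (auto simp: zero_set_def pull_def corner_def)
  moreover have "zero_set (pull (corner J) s x) \<subseteq> J"
  proof
    fix i assume i: "i \<in> zero_set (pull (corner J) s x)"
    show "i \<in> J"
    proof (rule ccontr)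
      assume "i \<notin> J"
      then have "(1 - s) * x i + s = 0" using i by (auto simp: zero_set_def pull_def corner_def)
      moreover have "0 \<le> (1 - s) * x i" using hull_nonneg[OF *(1)] assms by simp
      ultimately have "s = 0" using assms by linarith
      with \<open>(1 - s) * x i + s = 0\<close> have "x i = 0" by simp
      then have "i \<in> zero_set x" using i by (simp add: zero_set_def)
      then show False using *(3) \<open>i \<notin> J\<close> by blast
    qed
  qed
  ultimately show ?thesis
    using pull_in_hull[OF assms(1) *(1) assms(3,4)] *(2) by (auto simp: star_set_def)
qed

lemma corner_star_set: "J \<in> D \<Longrightarrow> J \<noteq> {} \<Longrightarrow> corner J \<in> star_set J"
  using D_subset corner_in_hull by (auto simp: star_set_def zero_set_def corner_def)

text \<open>Acyclic carriers, by induction on the number of vertices: the chains already chosen on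
  the facets of \<open>J\<close> add up to a small cycle in \<open>star_set J\<close>, which bounds
  there.\<close>

lemma ex_small_subdivision:
  assumes "0 < \<epsilon>"
  shows "\<exists>\<Phi>. \<Phi> {} = basic [] \<and>
    (\<forall>J\<in>D. small_chain I \<epsilon> (star_set J) (card J) (\<Phi> J) \<and> bd (\<Phi> J) = lin_ext \<Phi> (set_bd J))"
proof -
  have "\<exists>\<Phi>. \<Phi> {} = basic [] \<and> (\<forall>J\<in>D. card J \<le> n \<longrightarrow>
      small_chain I \<epsilon> (star_set J) (card J) (\<Phi> J) \<and> bd (\<Phi> J) = lin_ext \<Phi> (set_bd J))" for n
  proof (induction n)
    case 0
    show ?case
      \<comment> \<open>The start is degree -1: the only face without vertices is the empty one,
        represented by the empty list, which fits into the empty set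
        \<open>star_set {}\<close>.\<close>
      by (rule exI[of _ "\<lambda>_. basic []"]) (auto simp: small_chain_def finite_face set_bd_def)
  next
    case (Suc n)
    then obtain \<Phi> where \<Phi>0: "\<Phi> {} = basic []" and
      \<Phi>: "\<And>J. J \<in> D \<Longrightarrow> card J \<le> n \<Longrightarrow> small_chain I \<epsilon> (star_set J) (card J) (\<Phi> J)"
         "\<And>J. J \<in> D \<Longrightarrow> card J \<le> n \<Longrightarrow> bd (\<Phi> J) = lin_ext \<Phi> (set_bd J)"
      by blast
    have face: "J - {j} \<in> D" "card (J - {j}) = n" if "J \<in> D" "card J = Suc n" "j \<in> J" for J j
      using that D_down[of J "J - {j}"] finite_face by auto
    have "\<exists>e. bd e = lin_ext \<Phi> (set_bd J) \<and> small_chain I \<epsilon> (star_set J) (Suc n) e"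
      if J: "J \<in> D" "card J = Suc n" for J
    proof (rule small_cycle_bounds[OF assms])
      have "J \<noteq> {}" using J by auto
      with J show "corner J \<in> star_set J" using corner_star_set by blast
      show "pull (corner J) s x \<in> star_set J" if "x \<in> star_set J" "0 \<le> s" "s \<le> 1" for x s
        using pull_star_set J that by blast
      show "small_chain I \<epsilon> (star_set J) n (lin_ext \<Phi> (set_bd J))"
        unfolding set_bd_def lin_ext_sum lin_ext_simplex
      proof (rule small_chain_sum)
        fix j assume "j \<in> J"
        with \<Phi>(1)[OF face(1)[OF J]] face(2)[OF J]
        have "small_chain I \<epsilon> (star_set (J - {j})) n (\<Phi> (J - {j}))" by auto
        then show "small_chain I \<epsilon> (star_set J) n (\<Phi> (J - {j}))"
          by (rule small_chain_mono) (auto simp: star_set_def)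
      qed
      have "bd (lin_ext \<Phi> (set_bd J)) = lin_ext (\<lambda>K. lin_ext \<Phi> (set_bd K)) (set_bd J)"
        unfolding lin_ext_lin_ext
      proof (rule lin_ext_cong)
        fix K assume "K \<in> Poly_Mapping.keys (set_bd J)"
        then obtain j where "j \<in> J" "K = J - {j}"
          unfolding set_bd_def using keys_sum[of "\<lambda>j. basic (J - {j})" J] by auto
        then show "bd (\<Phi> K) = lin_ext \<Phi> (set_bd K)"
          using \<Phi>(2) face[OF J] by auto
      qed
      also have "\<dots> = lin_ext \<Phi> (lin_ext set_bd (set_bd J))"
        by (simp add: lin_ext_lin_ext)
      finally show "bd (lin_ext \<Phi> (set_bd J)) = 0"
        by (simp add: set_bd_set_bd finite_face J)
    qed
    then obtain e where e: "\<And>J. J \<in> D \<Longrightarrow> card J = Suc n \<Longrightarrow>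
        bd (e J) = lin_ext \<Phi> (set_bd J) \<and> small_chain I \<epsilon> (star_set J) (Suc n) (e J)"
      by metis
    \<comment> \<open>Boundaries of faces with at most \<open>Suc n\<close> vertices involve only
      smaller faces, so the new values do not disturb the equations already satisfied.\<close>
    define \<Psi> where "\<Psi> J = (if card J = Suc n then e J else \<Phi> J)" for J
    have "lin_ext \<Psi> (set_bd J) = lin_ext \<Phi> (set_bd J)" if "J \<in> D" "card J \<le> Suc n" for J
    proof (rule lin_ext_cong)
      fix K assume "K \<in> Poly_Mapping.keys (set_bd J)"
      then obtain j where "j \<in> J" "K = J - {j}"
        unfolding set_bd_def using keys_sum[of "\<lambda>j. basic (J - {j})" J] by auto
      then have "card K < Suc n"
        using that finite_face by (metis card_Diff1_less order_less_le_trans)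
      then show "\<Psi> K = \<Phi> K" by (simp add: \<Psi>_def)
    qed
    moreover have "\<Psi> {} = basic []" by (simp add: \<Psi>_def \<Phi>0)
    moreover have "small_chain I \<epsilon> (star_set J) (card J) (\<Psi> J)" "bd (\<Psi> J) = lin_ext \<Phi> (set_bd J)"
      if "J \<in> D" "card J \<le> Suc n" for J
      using \<Phi>[of J] e[of J] that by (auto simp: \<Psi>_def le_Suc_eq)
    ultimately show ?case
      by (intro exI[of _ \<Psi>]) simp
  qed
  from this[of "card I"] show ?thesis
    using D_subset by (meson card_mono finite_I)
qed

text \<open>
  The labelling turns the small subdivision \<open>\<Phi> J\<close> of a face \<open>J\<close> back into \<open>J\<close>, because it can only
  produce faces of \<open>J\<close>. A filling of the subdivided cycle is thus relabelled to a filling in \<open>D\<close>.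
\<close>

lemma acyclic_if_labelling:
  assumes "0 < \<epsilon>"
    and lab: "\<And>y. y \<in> corner_hull \<Longrightarrow> zero_set y \<noteq> {} \<Longrightarrow> lab y \<in> zero_set y"
    and lab_small: "\<And>l. set l \<subseteq> corner_hull \<Longrightarrow> (\<forall>x\<in>set l. \<forall>y\<in>set l. l1_dist I x y < \<epsilon>) \<Longrightarrow> lab ` set l \<in> D"
    and z: "Poly_Mapping.keys z \<subseteq> {J \<in> D. card J = m}" "lin_ext set_bd z = 0"
  shows "\<exists>w. Poly_Mapping.keys w \<subseteq> {J \<in> D. card J = Suc m} \<and> lin_ext set_bd w = z"
proof -
  obtain \<Phi> where \<Phi>0: "\<Phi> {} = basic []"
    and \<Phi>: "\<And>J. J \<in> D \<Longrightarrow> small_chain I \<epsilon> (star_set J) (card J) (\<Phi> J)"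
           "\<And>J. J \<in> D \<Longrightarrow> bd (\<Phi> J) = lin_ext \<Phi> (set_bd J)"
    using ex_small_subdivision[OF assms(1)] by blast
  define L where "L c = lin_ext unorder (push lab c)" for c
  have L_bd: "lin_ext set_bd (L c) = L (bd c)" for c
    by (simp add: L_def set_bd_unorder_chain bd_push)
  have L_keys: "\<exists>l\<in>Poly_Mapping.keys c. K = set (map lab l) \<and> distinct (map lab l)"
    if "K \<in> Poly_Mapping.keys (L c)" for K c
  proof -
    have "L c = lin_ext (\<lambda>l. unorder (map lab l)) c" by (simp add: L_def lin_ext_lin_ext)
    then obtain l where "l \<in> Poly_Mapping.keys c" "K \<in> Poly_Mapping.keys (unorder (map lab l))"
      using keys_lin_ext[of "\<lambda>l. unorder (map lab l)" c] \<open>K \<in> _\<close> by auto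
    then show ?thesis
      by (intro bexI[of _ l]) (auto simp: unorder_eq split: if_splits)
  qed
  have L_\<Phi>: "L (\<Phi> J) = basic J" if "J \<in> D" for J
    using that
  proof (induction "card J" arbitrary: J)
    case 0
    then show ?case by (simp add: \<Phi>0 L_def finite_face)
  next
    case (Suc n)
    have J: "finite J" "J \<noteq> {}" using Suc finite_face by auto
    \<comment> \<open>Points of \<open>star_set J\<close> get labels in \<open>J\<close>, and a
      simplex surviving in \<open>L\<close> has \<open>card J\<close> distinct labels. Only
      \<open>J\<close> itself is left, with coefficient 0 or 1.\<close>
    have "Poly_Mapping.keys (L (\<Phi> J)) \<subseteq> {J}"
    proof
      fix K assume "K \<in> Poly_Mapping.keys (L (\<Phi> J))"
      then obtain l where l: "l \<in> Poly_Mapping.keys (\<Phi> J)" "K = set (map lab l)" "distinct (map lab l)"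
        using L_keys by blast
      with \<Phi>(1)[OF Suc.prems] have *: "length l = card J" "set l \<subseteq> star_set J"
        by (auto simp: small_chain_def)
      then have "K \<subseteq> J" using l lab by (fastforce simp: star_set_def)
      moreover have "card K = card J" using l * by (metis distinct_card length_map)
      ultimately show "K \<in> {J}" using J by (simp add: card_subset_eq)
    qed
    then consider "L (\<Phi> J) = 0" | "Poly_Mapping.keys (L (\<Phi> J)) = {J}"
      by (meson keys_eq_empty subset_singletonD)
    then show ?case
    proof cases
      \<comment> \<open>Coefficient 0 is impossible: by the induction hypothesis the boundary of
        \<open>L (\<Phi> J)\<close> is the sum of all facets of \<open>J\<close>, and its
        coefficient at any one facet is 1.\<close>
      case 1
      have "0 = L (bd (\<Phi> J))" using L_bd[of "\<Phi> J"] 1 by simp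
      also have "\<dots> = (\<Sum>j\<in>J. L (\<Phi> (J - {j})))"
        unfolding \<Phi>(2)[OF Suc.prems] L_def by (simp add: set_bd_def lin_ext_sum)
      also have "\<dots> = (\<Sum>j\<in>J. basic (J - {j}))"
        using Suc.hyps Suc.prems J D_down by (intro sum.cong refl Suc.hyps(1)) auto
      finally have "(\<Sum>j\<in>J. basic (J - {j})) = (0 :: _ \<Rightarrow>\<^sub>0 bit)" by simp
      moreover obtain i where "i \<in> J" using J by blast
      ultimately have "Poly_Mapping.lookup (\<Sum>j\<in>J. basic (J - {j})) (J - {i}) = (0 :: bit)"
        by simp
      then have "(\<Sum>j\<in>J. if J - {j} = J - {i} then 1 else 0) = (0 :: bit)"
        by (simp add: lookup_sum lookup_single when_def)
      also have "(\<Sum>j\<in>J. if J - {j} = J - {i} then 1 else 0) = (\<Sum>j\<in>J. if j = i then 1 else 0 :: bit)"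
        using \<open>i \<in> J\<close> by (intro sum.cong) auto
      finally show ?thesis using \<open>i \<in> J\<close> J by simp
    next
      case 2
      have "lin_ext basic (L (\<Phi> J)) = basic J" unfolding lin_ext_def 2 by simp
      then show ?thesis by simp
    qed
  qed
  have zD: "J \<in> D" if "J \<in> Poly_Mapping.keys z" for J using that z by blast
  define c where "c = lin_ext \<Phi> z"
  have "bd c = lin_ext (\<lambda>J. lin_ext \<Phi> (set_bd J)) z"
    unfolding c_def lin_ext_lin_ext by (rule lin_ext_cong) (simp add: \<Phi> zD)
  then have "bd c = lin_ext \<Phi> (lin_ext set_bd z)" by (simp add: lin_ext_lin_ext)
  then have "bd c = 0" by (simp add: z)
  moreover have "small_chain I \<epsilon> corner_hull m c"
    unfolding c_def
  proof (rule small_chain_lin_ext)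
    fix J assume "J \<in> Poly_Mapping.keys z"
    then have "small_chain I \<epsilon> (star_set J) m (\<Phi> J)" using \<Phi>(1)[of J] z by auto
    then show "small_chain I \<epsilon> corner_hull m (\<Phi> J)"
      by (rule small_chain_mono) (auto simp: star_set_def)
  qed
  \<comment> \<open>The hull is star-shaped about the all-ones point \<open>corner {}\<close>, so
    the realized cycle bounds inside the region even where \<open>D\<close> has homology. The
    labelling carries this filling back.\<close>
  ultimately obtain e where e: "bd e = c" "small_chain I \<epsilon> corner_hull (Suc m) e"
    using small_cycle_bounds[OF assms(1), of "corner {}" corner_hull I m c] corner_in_hull[OF D_empty]
      pull_in_hull[OF D_empty] by blast
  have "lin_ext set_bd (L e) = lin_ext (\<lambda>J. L (\<Phi> J)) z"
    unfolding L_bd e(1) c_def by (simp only: L_def lin_ext_lin_ext)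
  also have "\<dots> = lin_ext basic z"
    by (rule lin_ext_cong) (simp add: L_\<Phi> zD)
  finally have "lin_ext set_bd (L e) = z" by simp
  moreover have "Poly_Mapping.keys (L e) \<subseteq> {J \<in> D. card J = Suc m}"
  proof
    fix K assume "K \<in> Poly_Mapping.keys (L e)"
    then obtain l where l: "l \<in> Poly_Mapping.keys e" "K = set (map lab l)" "distinct (map lab l)"
      using L_keys by blast
    with e(2) have *: "length l = Suc m" "set l \<subseteq> corner_hull" "\<forall>x\<in>set l. \<forall>y\<in>set l. l1_dist I x y < \<epsilon>"
      by (auto simp: small_chain_def)
    have "card K = Suc m" using l * by (metis distinct_card length_map)
    moreover have "K \<in> D" using lab_small[OF *(2,3)] l by simp
    ultimately show "K \<in> {J \<in> D. card J = Suc m}" by simp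
  qed
  ultimately show ?thesis by blast
qed

end

section \<open>Comparison with reduced homology\<close>

lemma lookup_set_bd:
  assumes "finite J"
  shows "Poly_Mapping.lookup (set_bd J) K = (if K \<subseteq> J \<and> card J = Suc (card K) then 1 else 0)"
proof -
  have *: "Poly_Mapping.lookup (set_bd J) K = (\<Sum>j\<in>J. if J - {j} = K then 1 else 0)"
    by (simp add: set_bd_def lookup_sum lookup_single when_def)
  show ?thesis
  proof (cases "K \<subseteq> J \<and> card J = Suc (card K)")
    case True
    then have "card (J - K) = card J - card K"
      using assms by (intro card_Diff_subset finite_subset[of K J]) auto
    then have "card (J - K) = 1" using True by simp
    then obtain x where "J - K = {x}" by (auto simp: card_1_singleton_iff)
    then have "J - {j} = K \<longleftrightarrow> j = x" if "j \<in> J" for j using that True by auto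
    then have "(\<Sum>j\<in>J. if J - {j} = K then 1 else 0 :: bit) = (\<Sum>j\<in>J. if j = x then 1 else 0)"
      by (intro sum.cong) auto
    also have "\<dots> = 1" using assms \<open>J - K = {x}\<close> by auto
    finally show ?thesis using True * by simp
  next
    case False
    have "J - {j} \<noteq> K" if "j \<in> J" for j
      using False card_Suc_Diff1[OF assms that] by force
    then have "(\<Sum>j\<in>J. if J - {j} = K then 1 else 0 :: bit) = 0" by (intro sum.neutral) auto
    then show ?thesis using False * by simp
  qed
qed

context deletion_family
begin

lemma faces_eq: "faces D k = {J \<in> D. int (card J) = k + 1}"
  by (auto simp: faces_def finite_face)

lemma lookup_lin_ext: "Poly_Mapping.lookup (lin_ext f z) K = (\<Sum>J\<in>Poly_Mapping.keys z. Poly_Mapping.lookup (f J) K)"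
  by (simp add: lin_ext_def lookup_sum)

lemma keys_set_bd_chain:
  assumes "Poly_Mapping.keys z \<subseteq> faces D k"
  shows "Poly_Mapping.keys (lin_ext set_bd z) \<subseteq> faces D (k - 1)"
proof
  fix K assume "K \<in> Poly_Mapping.keys (lin_ext set_bd z)"
  then obtain J where J: "J \<in> Poly_Mapping.keys z" "K \<in> Poly_Mapping.keys (set_bd J)"
    using keys_lin_ext[of set_bd z] by blast
  then have "J \<in> faces D k" using assms by blast
  then show "K \<in> faces D (k - 1)"
    using J(2) D_down finite_face by (auto simp: faces_eq in_keys_iff lookup_set_bd split: if_splits)
qed

text \<open>On chains of \<open>k\<close>-faces the dimension condition in
  \<open>lookup_set_bd\<close> is automatic, so both boundaries read off the coefficient at
  \<open>K\<close> by summing over the faces that contain \<open>K\<close>.\<close>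

lemma boundary_Z2_lookup:
  assumes "Poly_Mapping.keys z \<subseteq> faces D k"
  shows "boundary_Z2 D k (Poly_Mapping.lookup z) = Poly_Mapping.lookup (lin_ext set_bd z)"
proof
  fix K
  show "boundary_Z2 D k (Poly_Mapping.lookup z) K = Poly_Mapping.lookup (lin_ext set_bd z) K"
  proof (cases "K \<in> faces D (k - 1)")
    case True
    have fin: "finite (faces D k)" using finite_D by (simp add: faces_eq)
    have "boundary_Z2 D k (Poly_Mapping.lookup z) K =
        (\<Sum>J\<in>faces D k. if K \<subseteq> J then Poly_Mapping.lookup z J else 0)"
      unfolding boundary_Z2_def using True by (simp only: if_True sum.inter_filter[OF fin])
    also have "\<dots> = (\<Sum>J\<in>Poly_Mapping.keys z. if K \<subseteq> J then Poly_Mapping.lookup z J else 0)"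
      using assms fin by (intro sum.mono_neutral_right) (auto simp: in_keys_iff)
    also have "\<dots> = (\<Sum>J\<in>Poly_Mapping.keys z. Poly_Mapping.lookup (set_bd J) K)"
    proof (rule sum.cong)
      fix J assume J: "J \<in> Poly_Mapping.keys z"
      then have "J \<in> faces D k" using assms by blast
      then have "finite J" "card J = Suc (card K)" using True by (auto simp: faces_eq finite_face)
      moreover have "Poly_Mapping.lookup z J = 1" using J by (simp add: in_keys_iff)
      ultimately show "(if K \<subseteq> J then Poly_Mapping.lookup z J else 0) = Poly_Mapping.lookup (set_bd J) K"
        by (simp add: lookup_set_bd)
    qed simp
    finally show ?thesis by (simp add: lookup_lin_ext)
  next
    case False
    then have "K \<notin> Poly_Mapping.keys (lin_ext set_bd z)"
      using keys_set_bd_chain[OF assms] by blast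
    with False show ?thesis by (simp add: boundary_Z2_def in_keys_iff)
  qed
qed

lemma chain_lookup:
  assumes "c \<in> carrier (chain_group_Z2 D k)"
  obtains z where "Poly_Mapping.keys z \<subseteq> faces D k" "c = Poly_Mapping.lookup z"
proof -
  have sub: "{J. c J \<noteq> 0} \<subseteq> faces D k" using assms by (auto simp: chain_group_Z2_def)
  then have "finite {J. c J \<noteq> 0}"
    by (rule finite_subset) (simp add: faces_eq finite_D)
  then have "c = Poly_Mapping.lookup (Abs_poly_mapping c)"
    by (simp add: Abs_poly_mapping_inverse)
  with sub show thesis
    by (intro that[of "Abs_poly_mapping c"]) (auto simp: in_keys_iff)
qed

lemma lookup_in_chain_group:
  "Poly_Mapping.keys z \<subseteq> faces D k \<Longrightarrow> Poly_Mapping.lookup z \<in> carrier (chain_group_Z2 D k)"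
  by (auto simp: chain_group_Z2_def in_keys_iff)

lemma group_cycles: "group ((chain_group_Z2 D k)\<lparr>carrier := cycles_Z2 D k\<rparr>)"
proof -
  have "boundary_Z2 D k (\<lambda>J. c J + d J) = (\<lambda>J. boundary_Z2 D k c J + boundary_Z2 D k d J)" for c d
  proof
    fix K
    show "boundary_Z2 D k (\<lambda>J. c J + d J) K = boundary_Z2 D k c K + boundary_Z2 D k d K"
      by (cases "K \<in> faces D (k - 1)") (simp_all only: boundary_Z2_def sum.distrib if_True if_False add_0)
  qed
  moreover have "boundary_Z2 D k (\<lambda>J. 0) = (\<lambda>J. 0)"
    by (auto simp: boundary_Z2_def)
  ultimately show ?thesis
    by (intro groupI) (auto simp: cycles_Z2_def kernel_def chain_group_Z2_def fun_eq_iff ac_simps)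
qed

text \<open>The assumption counts vertices where homology counts dimension: degree \<open>k\<close>
  means \<open>nat (k + 1)\<close> vertices, and \<open>k \<ge> -1\<close> makes this conversion
  faithful, with the empty face in degree -1.\<close>

lemma trivial_homology_if_acyclic:
  assumes acyclic: "\<And>m z. Poly_Mapping.keys z \<subseteq> {J \<in> D. card J = m} \<Longrightarrow> lin_ext set_bd z = 0 \<Longrightarrow>
      \<exists>w. Poly_Mapping.keys w \<subseteq> {J \<in> D. card J = Suc m} \<and> lin_ext set_bd w = z"
    and "k \<ge> -1"
  shows "trivial_group (reduced_homology_Z2 D k)"
proof -
  let ?G = "(chain_group_Z2 D k)\<lparr>carrier := cycles_Z2 D k\<rparr>"
  have "boundaries_Z2 D k \<subseteq> cycles_Z2 D k"
  proof
    fix c assume "c \<in> boundaries_Z2 D k"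
    then obtain d where "d \<in> carrier (chain_group_Z2 D (k + 1))" and d: "c = boundary_Z2 D (k + 1) d"
      by (auto simp: boundaries_Z2_def)
    then obtain w where w: "Poly_Mapping.keys w \<subseteq> faces D (k + 1)" "d = Poly_Mapping.lookup w"
      using chain_lookup by blast
    have keys: "Poly_Mapping.keys (lin_ext set_bd w) \<subseteq> faces D k"
      using keys_set_bd_chain[OF w(1)] by simp
    have "lin_ext set_bd (lin_ext set_bd w) = lin_ext (\<lambda>J. 0) w"
      unfolding lin_ext_lin_ext
      by (rule lin_ext_cong) (use w(1) finite_face in \<open>auto simp: faces_eq intro!: set_bd_set_bd\<close>)
    then have "lin_ext set_bd (lin_ext set_bd w) = 0" by (simp add: lin_ext_def)
    then show "c \<in> cycles_Z2 D k"
      using d w keys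
      by (simp add: cycles_Z2_def kernel_def boundary_Z2_lookup lookup_in_chain_group)
         (simp add: chain_group_Z2_def fun_eq_iff)
  qed
  moreover have "cycles_Z2 D k \<subseteq> boundaries_Z2 D k"
  proof
    fix c assume c: "c \<in> cycles_Z2 D k"
    then obtain z where z: "Poly_Mapping.keys z \<subseteq> faces D k" "c = Poly_Mapping.lookup z"
      using chain_lookup unfolding cycles_Z2_def kernel_def by blast
    have "Poly_Mapping.lookup (lin_ext set_bd z) = (\<lambda>J. 0)"
      using c z by (simp add: cycles_Z2_def kernel_def boundary_Z2_lookup) (simp add: chain_group_Z2_def)
    then have "lin_ext set_bd z = 0" by (intro poly_mapping_eqI) simp
    moreover have "faces D k = {J \<in> D. card J = nat (k + 1)}" using \<open>k \<ge> -1\<close> by (auto simp: faces_eq)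
    moreover have "faces D (k + 1) = {J \<in> D. card J = Suc (nat (k + 1))}" using \<open>k \<ge> -1\<close> by (auto simp: faces_eq)
    ultimately obtain w where w: "Poly_Mapping.keys w \<subseteq> faces D (k + 1)" "lin_ext set_bd w = z"
      using acyclic[of z "nat (k + 1)"] z(1) by auto
    then have "c = boundary_Z2 D (k + 1) (Poly_Mapping.lookup w)"
      using z by (simp add: boundary_Z2_lookup)
    then show "c \<in> boundaries_Z2 D k"
      unfolding boundaries_Z2_def using lookup_in_chain_group[OF w(1)] by blast
  qed
  \<comment> \<open>Homology becomes the quotient of the cycle group by its whole carrier, which has
    a single coset.\<close>
  ultimately have eq: "boundaries_Z2 D k = carrier ?G" by auto
  interpret group ?G by (rule group_cycles)
  interpret normal "carrier ?G" ?G by (rule normal_self)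
  have "group (?G Mod carrier ?G)" by (rule factorgroup_is_group)
  moreover have "carrier (?G Mod carrier ?G) = {carrier ?G}"
    unfolding carrier_FactGroup using coset_join2[OF _ subgroup_self] one_closed
    by (auto simp del: partial_object.update_convs)
  ultimately show ?thesis
    unfolding reduced_homology_Z2_def eq trivial_group_def by (metis one_FactGroup)
qed

end

section \<open>Descent on the orthant\<close>

text \<open>Bolzano-Weierstrass for points given as functions: subsequences are refined one
  coordinate at a time.\<close>

lemma finite_bounded_convergent_subsequence:
  fixes x :: "nat \<Rightarrow> 'i \<Rightarrow> real"
  assumes "finite A" "\<And>n j. j \<in> A \<Longrightarrow> \<bar>x n j\<bar> \<le> B j"
  shows "\<exists>r l. strict_mono (r :: nat \<Rightarrow> nat) \<and> (\<forall>j\<in>A. (\<lambda>n. x (r n) j) \<longlonglongrightarrow> l j)"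
  using assms
proof (induction A)
  case empty
  show ?case by (rule exI[of _ id]) (auto simp: strict_mono_def)
next
  case (insert a A)
  then obtain r l where r: "strict_mono (r :: nat \<Rightarrow> nat)" "\<forall>j\<in>A. (\<lambda>n. x (r n) j) \<longlonglongrightarrow> l j"
    by (metis insertCI)
  have "bounded (range (\<lambda>n. x (r n) a))"
    by (rule boundedI[of _ "B a"]) (use insert.prems in auto)
  then obtain r' c where r': "strict_mono (r' :: nat \<Rightarrow> nat)" "((\<lambda>n. x (r n) a) \<circ> r') \<longlonglongrightarrow> c"
    using bounded_imp_convergent_subsequence by blast
  have "(\<lambda>n. x ((r \<circ> r') n) j) \<longlonglongrightarrow> (l(a := c)) j" if "j \<in> insert a A" for j
  proof (cases "j = a")
    case True
    then show ?thesis using r' by (simp add: o_def)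
  next
    case False
    then have "(\<lambda>n. x (r n) j) \<longlonglongrightarrow> l j" using r that by blast
    from LIMSEQ_subseq_LIMSEQ[OF this r'(1)] False show ?thesis by (simp add: o_def)
  qed
  then show ?case using strict_mono_o[OF r(1) r'(1)] by blast
qed

text \<open>Points are functions on the whole index type, so continuity is stated by sequences
  converging in the coordinates of \<open>I\<close>. The functions \<open>w k\<close> serve as
  partial derivatives only through the one-variable mean value property
  \<open>E_mvt\<close>.\<close>

locale energy_landscape = deletion_family I D for I :: "'i set" and D +
  fixes E :: "('i \<Rightarrow> real) \<Rightarrow> real" and w :: "'i \<Rightarrow> ('i \<Rightarrow> real) \<Rightarrow> real" and \<alpha> :: "'i \<Rightarrow> real"
    and dom :: "('i \<Rightarrow> real) set"
  assumes dom_def: "dom = {y. (\<forall>i\<in>I. 0 \<le> y i) \<and> zero_set y \<in> D}"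
    and w_cont: "\<And>ys y j. (\<And>n. ys n \<in> dom) \<Longrightarrow> y \<in> dom \<Longrightarrow> (\<And>i. i \<in> I \<Longrightarrow> (\<lambda>n. ys n i) \<longlonglongrightarrow> y i) \<Longrightarrow>
        j \<in> I \<Longrightarrow> (\<lambda>n. w j (ys n)) \<longlonglongrightarrow> w j y"
    and E_cont: "\<And>ys y. (\<And>n. ys n \<in> dom) \<Longrightarrow> y \<in> dom \<Longrightarrow> (\<And>i. i \<in> I \<Longrightarrow> (\<lambda>n. ys n i) \<longlonglongrightarrow> y i) \<Longrightarrow>
        (\<lambda>n. E (ys n)) \<longlonglongrightarrow> E y"
    and E_mvt: "\<And>y k s. y \<in> dom \<Longrightarrow> k \<in> I \<Longrightarrow> y(k := s) \<in> dom \<Longrightarrow>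
        \<exists>\<xi>. min (y k) s \<le> \<xi> \<and> \<xi> \<le> max (y k) s \<and> E (y(k := s)) - E y = w k (y(k := \<xi>)) * (s - y k)"
    and E_nonneg: "\<And>y. y \<in> dom \<Longrightarrow> 0 \<le> E y"
    and E_proper: "\<And>ys C. (\<And>n. ys n \<in> dom) \<Longrightarrow> (\<And>n. E (ys n) \<le> C) \<Longrightarrow>
        \<exists>r y. strict_mono (r :: nat \<Rightarrow> nat) \<and> y \<in> dom \<and> (\<forall>i\<in>I. (\<lambda>n. ys (r n) i) \<longlonglongrightarrow> y i)"
    and \<alpha>_pos: "\<And>i. i \<in> I \<Longrightarrow> 0 < \<alpha> i"
    and w_zero: "\<And>y i. y \<in> dom \<Longrightarrow> i \<in> I \<Longrightarrow> y i = 0 \<Longrightarrow> w i y = \<alpha> i"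
begin

lemma dom_iff: "y \<in> dom \<longleftrightarrow> (\<forall>i\<in>I. 0 \<le> y i) \<and> zero_set y \<in> D"
  by (simp add: dom_def)

section \<open>Compactness of sublevel sets and uniform estimates\<close>

definition sub :: "real \<Rightarrow> ('i \<Rightarrow> real) set" where
  "sub C = {y \<in> dom. E y \<le> C}"

lemma sub_compact:
  assumes "\<And>n. ys n \<in> sub C"
  obtains r y where "strict_mono (r :: nat \<Rightarrow> nat)" "y \<in> sub C" "\<And>i. i \<in> I \<Longrightarrow> (\<lambda>n. ys (r n) i) \<longlonglongrightarrow> y i"
proof -
  obtain r y where r: "strict_mono (r :: nat \<Rightarrow> nat)" "y \<in> dom" "\<forall>i\<in>I. (\<lambda>n. ys (r n) i) \<longlonglongrightarrow> y i"
    using E_proper[of ys C] assms by (auto simp: sub_def)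
  have "(\<lambda>n. E (ys (r n))) \<longlonglongrightarrow> E y"
    using assms r by (intro E_cont) (auto simp: sub_def)
  then have "E y \<le> C"
    by (rule LIMSEQ_le_const2) (use assms in \<open>auto simp: sub_def\<close>)
  with r that show thesis by (auto simp: sub_def)
qed

lemma sub_bounded_below:
  assumes cont: "\<And>ys y. (\<And>n. ys n \<in> sub C) \<Longrightarrow> y \<in> sub C \<Longrightarrow> (\<And>i. i \<in> I \<Longrightarrow> (\<lambda>n. ys n i) \<longlonglongrightarrow> y i) \<Longrightarrow>
      (\<lambda>n. f (ys n)) \<longlonglongrightarrow> (f y :: real)"
    and pos: "\<And>y. y \<in> sub C \<Longrightarrow> 0 < f y"
  shows "\<exists>\<epsilon>>0. \<forall>y\<in>sub C. \<epsilon> \<le> f y"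
proof (rule ccontr)
  assume "\<not> ?thesis"
  then have "\<exists>y\<in>sub C. f y < 1 / real (Suc n)" for n
    by (meson not_le of_nat_0_less_iff zero_less_Suc zero_less_divide_1_iff)
  then obtain ys where ys: "\<And>n. ys n \<in> sub C" "\<And>n. f (ys n) < 1 / real (Suc n)"
    by metis
  obtain r y where r: "strict_mono (r :: nat \<Rightarrow> nat)" "y \<in> sub C" "\<And>i. i \<in> I \<Longrightarrow> (\<lambda>n. ys (r n) i) \<longlonglongrightarrow> y i"
    using sub_compact[of ys, OF ys(1)] by metis
  have "(\<lambda>n. f (ys (r n))) \<longlonglongrightarrow> f y" using ys r by (intro cont) auto
  moreover have "(\<lambda>n. 1 / real (Suc (r n))) \<longlonglongrightarrow> 0"
    using LIMSEQ_subseq_LIMSEQ[OF LIMSEQ_Suc[OF lim_1_over_n] r(1)] by (simp add: o_def)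
  ultimately have "f y \<le> 0"
    using ys(2) by (intro LIMSEQ_le[of "\<lambda>n. f (ys (r n))"]) (auto intro: less_imp_le)
  with pos r show False by fastforce
qed

text \<open>An upper bound for \<open>f\<close> is a positive lower bound for
  \<open>inverse (1 + f y)\<close>.\<close>

lemma sub_bounded_above:
  assumes cont: "\<And>ys y. (\<And>n. ys n \<in> sub C) \<Longrightarrow> y \<in> sub C \<Longrightarrow> (\<And>i. i \<in> I \<Longrightarrow> (\<lambda>n. ys n i) \<longlonglongrightarrow> y i) \<Longrightarrow>
      (\<lambda>n. f (ys n)) \<longlonglongrightarrow> (f y :: real)"
    and pos: "\<And>y. y \<in> sub C \<Longrightarrow> 0 \<le> f y"
  shows "\<exists>W>0. \<forall>y\<in>sub C. f y \<le> W"
proof -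
  have nz: "1 + f y > 0" if "y \<in> sub C" for y using pos[OF that] by simp
  have "\<exists>\<epsilon>>0. \<forall>y\<in>sub C. \<epsilon> \<le> inverse (1 + f y)"
    by (rule sub_bounded_below) (use nz in \<open>auto intro!: tendsto_intros cont simp: less_imp_neq[symmetric]\<close>)
  then obtain \<epsilon> where \<epsilon>: "\<epsilon> > 0" "\<And>y. y \<in> sub C \<Longrightarrow> \<epsilon> \<le> inverse (1 + f y)" by blast
  have "f y \<le> 1 / \<epsilon>" if "y \<in> sub C" for y
  proof -
    have "\<epsilon> * (1 + f y) \<le> 1"
      using mult_right_mono[OF \<epsilon>(2)[OF that], of "1 + f y"] nz[OF that] by simp
    then show ?thesis using \<epsilon>(1) nz[OF that] by (simp add: field_simps)
  qed
  then show ?thesis using \<epsilon>(1) by (intro exI[of _ "1 / \<epsilon>"]) auto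
qed

text \<open>Otherwise two sequences, ever closer to each other, converge to a common point
  \<open>y\<close> of the sublevel set. Coordinates that are nonzero at \<open>y\<close> stay
  nonzero nearby, so nearby zero sets lie in that of \<open>y\<close> and belong to
  \<open>D\<close>; then continuity of \<open>w\<close> at \<open>y\<close> gives a
  contradiction.\<close>

lemma w_uniform:
  assumes "0 < \<epsilon>"
  shows "\<exists>\<delta>>0. \<forall>y\<in>sub C. \<forall>y'. (\<forall>i\<in>I. 0 \<le> y' i \<and> \<bar>y' i - y i\<bar> \<le> \<delta>) \<longrightarrow>
     y' \<in> dom \<and> (\<forall>k\<in>I. \<bar>w k y' - w k y\<bar> \<le> \<epsilon>)"
proof (rule ccontr)
  assume neg: "\<not> ?thesis"
  have "\<exists>y y'. y \<in> sub C \<and> (\<forall>i\<in>I. 0 \<le> y' i \<and> \<bar>y' i - y i\<bar> \<le> 1 / real (Suc n)) \<and>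
     \<not> (y' \<in> dom \<and> (\<forall>k\<in>I. \<bar>w k y' - w k y\<bar> \<le> \<epsilon>))" for n
  proof -
    have "1 / real (Suc n) > 0" by simp
    with neg show ?thesis by blast
  qed
  then obtain ys zs where ys: "\<And>n. ys n \<in> sub C" and
    zs: "\<And>n i. i \<in> I \<Longrightarrow> 0 \<le> zs n i \<and> \<bar>zs n i - ys n i\<bar> \<le> 1 / real (Suc n)" and
    bad: "\<And>n. \<not> (zs n \<in> dom \<and> (\<forall>k\<in>I. \<bar>w k (zs n) - w k (ys n)\<bar> \<le> \<epsilon>))"
    by metis
  obtain r y where r: "strict_mono (r :: nat \<Rightarrow> nat)" "y \<in> sub C" "\<And>i. i \<in> I \<Longrightarrow> (\<lambda>n. ys (r n) i) \<longlonglongrightarrow> y i"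
    using sub_compact[of ys, OF ys] by metis
  have "(\<lambda>n. 1 / real (Suc (r n))) \<longlonglongrightarrow> 0"
    using LIMSEQ_subseq_LIMSEQ[OF LIMSEQ_Suc[OF lim_1_over_n] r(1)] by (simp add: o_def)
  then have "(\<lambda>n. zs (r n) i - ys (r n) i) \<longlonglongrightarrow> 0" if "i \<in> I" for i
    by (rule Lim_null_comparison[rotated]) (use zs that in auto)
  then have lim: "(\<lambda>n. zs (r n) i) \<longlonglongrightarrow> y i" if "i \<in> I" for i
    using tendsto_add[OF _ r(3)[OF that]] that by fastforce
  have y: "\<forall>i\<in>I. 0 \<le> y i" "zero_set y \<in> D" "y \<in> dom" using r(2) by (auto simp: sub_def dom_iff)
  have "\<forall>\<^sub>F n in sequentially. y i \<noteq> 0 \<longrightarrow> zs (r n) i \<noteq> 0" if "i \<in> I" for i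
  proof (cases "y i = 0")
    case False
    then show ?thesis using lim[OF that] by (auto dest: tendsto_imp_eventually_ne)
  qed auto
  then have "\<forall>\<^sub>F n in sequentially. \<forall>i\<in>I. y i \<noteq> 0 \<longrightarrow> zs (r n) i \<noteq> 0"
    using finite_I by (simp add: eventually_ball_finite)
  then have "\<forall>\<^sub>F n in sequentially. zs (r n) \<in> dom"
  proof (rule eventually_mono)
    fix n assume "\<forall>i\<in>I. y i \<noteq> 0 \<longrightarrow> zs (r n) i \<noteq> 0"
    then have "zero_set (zs (r n)) \<subseteq> zero_set y" by (auto simp: zero_set_def)
    then show "zs (r n) \<in> dom" using D_down[OF y(2)] zs by (auto simp: dom_iff)
  qed
  \<comment> \<open>\<open>w_cont\<close> wants an entire sequence in \<open>dom\<close>, so the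
    first \<open>m\<close> terms are dropped.\<close>
  then obtain m where m: "\<And>n. n \<ge> m \<Longrightarrow> zs (r n) \<in> dom" by (auto simp: eventually_sequentially)
  have "\<forall>\<^sub>F n in sequentially. \<bar>w k (zs (r (n + m))) - w k (ys (r (n + m)))\<bar> < \<epsilon>" if "k \<in> I" for k
  proof -
    have "(\<lambda>n. w k (zs (r (n + m)))) \<longlonglongrightarrow> w k y"
      using m y lim that by (intro w_cont) (auto intro: LIMSEQ_ignore_initial_segment)
    moreover have "(\<lambda>n. w k (ys (r (n + m)))) \<longlonglongrightarrow> w k y"
      using ys y r that by (intro w_cont) (auto simp: sub_def intro: LIMSEQ_ignore_initial_segment)
    ultimately have "(\<lambda>n. w k (zs (r (n + m))) - w k (ys (r (n + m)))) \<longlonglongrightarrow> w k y - w k y"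
      by (rule tendsto_diff)
    then have "(\<lambda>n. \<bar>w k (zs (r (n + m))) - w k (ys (r (n + m)))\<bar>) \<longlonglongrightarrow> 0"
      by (simp add: tendsto_rabs_zero_iff)
    then show ?thesis using assms by (rule order_tendstoD)
  qed
  then have "\<forall>\<^sub>F n in sequentially. \<forall>k\<in>I. \<bar>w k (zs (r (n + m))) - w k (ys (r (n + m)))\<bar> < \<epsilon>"
    using finite_I by (simp add: eventually_ball_finite)
  then obtain n where "\<forall>k\<in>I. \<bar>w k (zs (r (n + m))) - w k (ys (r (n + m)))\<bar> < \<epsilon>"
    using eventually_happens' sequentially_bot by blast
  with bad[of "r (n + m)"] m[of "n + m"] show False by (auto intro: less_imp_le)
qed

text \<open>
  One explicit Euler step of the gradient flow, cut off at the coordinate hyperplanes. Gradient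
  components of size at most \<open>\<epsilon>\<close> are suppressed, so that the error of the linearization never
  makes the energy grow.
\<close>

definition shrink :: "real \<Rightarrow> real \<Rightarrow> real" where
  "shrink \<epsilon> x = x - max (- \<epsilon>) (min \<epsilon> x)"

definition euler :: "real \<Rightarrow> real \<Rightarrow> ('i \<Rightarrow> real) \<Rightarrow> ('i \<Rightarrow> real)" where
  "euler \<epsilon> \<eta> y = (\<lambda>i. max 0 (y i - \<eta> * shrink \<epsilon> (w i y)))"

lemma euler_cont:
  assumes "\<And>n. ys n \<in> dom" "y \<in> dom" "\<And>i. i \<in> I \<Longrightarrow> (\<lambda>n. ys n i) \<longlonglongrightarrow> y i" "j \<in> I"
  shows "(\<lambda>n. euler \<epsilon> \<eta> (ys n) j) \<longlonglongrightarrow> euler \<epsilon> \<eta> y j"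
  unfolding euler_def shrink_def by (intro tendsto_intros assms w_cont)

text \<open>The map iterates one truncated Euler step. A step that ends with no vanishing coordinate
  costs at least a fixed energy \<open>\<kappa>\<close>, and the energy starts at most at
  \<open>C\<close> and is never negative, so more than \<open>C / \<kappa>\<close> steps must reach
  the boundary. Boundary points may move, but their vanishing coordinates stay zero.\<close>

lemma retraction_to_boundary:
  assumes nocrit: "\<And>y. y \<in> dom \<Longrightarrow> \<exists>i\<in>I. w i y \<noteq> 0"
  obtains \<rho> where "\<And>y. y \<in> sub C \<Longrightarrow> \<rho> y \<in> sub C"
    "\<And>y. y \<in> sub C \<Longrightarrow> zero_set y \<subseteq> zero_set (\<rho> y)" "\<And>y. y \<in> sub C \<Longrightarrow> zero_set (\<rho> y) \<noteq> {}"
    "\<And>ys y j. (\<And>n. ys n \<in> sub C) \<Longrightarrow> y \<in> sub C \<Longrightarrow> (\<And>i. i \<in> I \<Longrightarrow> (\<lambda>n. ys n i) \<longlonglongrightarrow> y i) \<Longrightarrow> j \<in> I \<Longrightarrow>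
       (\<lambda>n. \<rho> (ys n) j) \<longlonglongrightarrow> \<rho> y j"
proof -
  have sub_dom: "y \<in> sub C \<Longrightarrow> y \<in> dom" for y by (simp add: sub_def)
  have "corner {} \<in> dom" using D_empty by (auto simp: dom_iff corner_def zero_set_def)
  then have "I \<noteq> {}" using nocrit by blast
  define f where "f y = (\<Sum>i\<in>I. \<bar>w i y\<bar>)" for y
  have f_cont: "(\<lambda>n. f (ys n)) \<longlonglongrightarrow> f y" if "\<And>n. ys n \<in> sub C" "y \<in> sub C" "\<And>i. i \<in> I \<Longrightarrow> (\<lambda>n. ys n i) \<longlonglongrightarrow> y i" for ys y
    unfolding f_def using that by (intro tendsto_intros w_cont) (auto simp: sub_def)
  have f_pos: "0 < f y" if y: "y \<in> sub C" for y
  proof -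
    obtain i where "i \<in> I" "w i y \<noteq> 0" using nocrit[OF sub_dom[OF y]] by blast
    then show ?thesis unfolding f_def using finite_I by (intro sum_pos2[of I i]) auto
  qed
  obtain \<epsilon>0 where \<epsilon>0: "\<epsilon>0 > 0" "\<And>y. y \<in> sub C \<Longrightarrow> \<epsilon>0 \<le> f y"
    using sub_bounded_below[of C f] f_cont f_pos by blast
  obtain W where W: "W > 0" "\<And>y. y \<in> sub C \<Longrightarrow> f y \<le> W"
    using sub_bounded_above[of C f] f_cont f_pos less_imp_le by metis
  have w_le: "\<bar>w i y\<bar> \<le> W" if "y \<in> sub C" "i \<in> I" for i y
    using member_le_sum[of i I "\<lambda>i. \<bar>w i y\<bar>"] finite_I that W(2)[OF that(1)] by (force simp: f_def)
  have card: "real (card I) > 0" using \<open>I \<noteq> {}\<close> finite_I by (simp add: card_gt_0_iff)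
  \<comment> \<open>On the sublevel set some slope is at least \<open>\<epsilon>0 / card I\<close>,
    hence at least \<open>3 * \<epsilon>\<close>, in absolute value. Of such a slope, and of each
    \<open>\<alpha> i\<close>, at least \<open>2 * \<epsilon>\<close> survives the
    suppression.\<close>
  define \<epsilon> where "\<epsilon> = min (\<epsilon>0 / card I) (Min (\<alpha> ` I)) / 3"
  have \<epsilon>: "\<epsilon> > 0" unfolding \<epsilon>_def using \<epsilon>0(1) card \<alpha>_pos finite_I \<open>I \<noteq> {}\<close> by simp
  have \<epsilon>_\<alpha>: "3 * \<epsilon> \<le> \<alpha> i" if "i \<in> I" for i
  proof -
    have "3 * \<epsilon> \<le> Min (\<alpha> ` I)" by (simp add: \<epsilon>_def)
    also have "\<dots> \<le> \<alpha> i" using that finite_I by simp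
    finally show ?thesis .
  qed
  have \<epsilon>_w: "\<exists>i\<in>I. 3 * \<epsilon> \<le> \<bar>w i y\<bar>" if "y \<in> sub C" for y
  proof (rule ccontr)
    assume "\<not> ?thesis"
    then have "f y < (\<Sum>i\<in>I. 3 * \<epsilon>)"
      unfolding f_def using finite_I \<open>I \<noteq> {}\<close> by (intro sum_strict_mono) auto
    also have "\<dots> = card I * min (\<epsilon>0 / card I) (Min (\<alpha> ` I))"
      by (simp add: \<epsilon>_def)
    also have "\<dots> \<le> card I * (\<epsilon>0 / card I)"
      using card by (intro mult_left_mono) auto
    finally show False using \<epsilon>0(2)[OF that] card by simp
  qed
  obtain \<delta> where \<delta>: "\<delta> > 0" "\<And>y y'. y \<in> sub C \<Longrightarrow> (\<forall>i\<in>I. 0 \<le> y' i \<and> \<bar>y' i - y i\<bar> \<le> \<delta>) \<Longrightarrow> y' \<in> dom"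
    "\<And>y y' k. y \<in> sub C \<Longrightarrow> (\<forall>i\<in>I. 0 \<le> y' i \<and> \<bar>y' i - y i\<bar> \<le> \<delta>) \<Longrightarrow> k \<in> I \<Longrightarrow> \<bar>w k y' - w k y\<bar> \<le> \<epsilon>"
    using w_uniform[OF \<epsilon>, of C] by metis
  \<comment> \<open>Slopes are at most \<open>W\<close> in size, so a step of this length moves each
    coordinate by at most \<open>\<delta>\<close>, within the range where slopes change by at most
    \<open>\<epsilon>\<close>.\<close>
  define \<eta> where "\<eta> = \<delta> / W"
  have \<eta>: "\<eta> > 0" "\<eta> * W = \<delta>" using \<delta>(1) W(1) by (auto simp: \<eta>_def)
  define T where "T = euler \<epsilon> \<eta>"
  have T_nonneg: "0 \<le> T y i" for y i by (simp add: T_def euler_def)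
  have shr: "\<bar>shrink \<epsilon> x\<bar> \<le> \<bar>x\<bar>" for x using \<epsilon> by (auto simp: shrink_def)
  have T_near: "\<bar>T y i - y i\<bar> \<le> \<delta>" if "y \<in> sub C" "i \<in> I" for y i
  proof -
    have "\<bar>T y i - y i\<bar> \<le> \<bar>\<eta> * shrink \<epsilon> (w i y)\<bar>"
      using sub_dom[OF that(1)] that(2) by (auto simp: T_def euler_def dom_iff)
    also have "\<dots> \<le> \<eta> * W"
      using \<eta>(1) order_trans[OF shr w_le[OF that]] by (simp add: abs_mult)
    finally show ?thesis using \<eta> by simp
  qed
  \<comment> \<open>The guaranteed decrease along coordinate \<open>i\<close>: the displacement is
    opposite in sign to \<open>w i y\<close>, and the true slope may differ from it by
    \<open>\<epsilon>\<close>. Coordinates with slope at most \<open>\<epsilon>\<close> do not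
    move.\<close>
  define gain where "gain y i = (\<bar>w i y\<bar> - \<epsilon>) * \<bar>T y i - y i\<bar>" for y i
  have T_step: "0 \<le> gain y i \<and> (\<forall>v. \<bar>v - w i y\<bar> \<le> \<epsilon> \<longrightarrow> v * (T y i - y i) \<le> - gain y i)"
    if y: "y \<in> sub C" and i: "i \<in> I" for y i
  proof -
    have "0 \<le> y i" using sub_dom[OF y] i by (auto simp: dom_iff)
    consider "\<bar>w i y\<bar> \<le> \<epsilon>" | "w i y > \<epsilon>" | "w i y < - \<epsilon>" by linarith
    then show ?thesis
    proof cases
      case 1
      then have "T y i = y i" using \<open>0 \<le> y i\<close> by (auto simp: T_def euler_def shrink_def min_def max_def)
      then show ?thesis by (simp add: gain_def)
    next
      case 2
      then have "shrink \<epsilon> (w i y) > 0" using \<epsilon> by (auto simp: shrink_def)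
      then have le: "T y i \<le> y i" using \<open>0 \<le> y i\<close> \<eta> by (auto simp: T_def euler_def)
      have "v * (T y i - y i) \<le> (w i y - \<epsilon>) * (T y i - y i)" if "\<bar>v - w i y\<bar> \<le> \<epsilon>" for v
        using that le by (intro mult_right_mono_neg) auto
      moreover have g: "gain y i = (w i y - \<epsilon>) * (y i - T y i)"
        using 2 \<epsilon> le by (simp add: gain_def)
      moreover have "- ((w i y - \<epsilon>) * (y i - T y i)) = (w i y - \<epsilon>) * (T y i - y i)"
        by (simp add: algebra_simps)
      moreover have "0 \<le> (w i y - \<epsilon>) * (y i - T y i)" using 2 le by simp
      ultimately show ?thesis by simp
    next
      case 3
      then have "shrink \<epsilon> (w i y) < 0" using \<epsilon> by (auto simp: shrink_def)
      then have "\<eta> * shrink \<epsilon> (w i y) < 0" using \<eta> by (simp add: mult_pos_neg)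
      then have le: "T y i \<ge> y i" using \<open>0 \<le> y i\<close> by (auto simp: T_def euler_def)
      have "v * (T y i - y i) \<le> (w i y + \<epsilon>) * (T y i - y i)" if "\<bar>v - w i y\<bar> \<le> \<epsilon>" for v
        using that le by (intro mult_right_mono) auto
      moreover have g: "gain y i = (- w i y - \<epsilon>) * (T y i - y i)"
        using 3 \<epsilon> le by (simp add: gain_def)
      moreover have "- ((- w i y - \<epsilon>) * (T y i - y i)) = (w i y + \<epsilon>) * (T y i - y i)"
        by (simp add: algebra_simps)
      moreover have "0 \<le> (- w i y - \<epsilon>) * (T y i - y i)" using 3 le by simp
      ultimately show ?thesis by simp
    qed
  qed
  \<comment> \<open>The coordinates are moved one after another. Every intermediate point is within
    \<open>\<delta>\<close> of \<open>y\<close>, so the one-variable mean value property applies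
    with a slope known up to \<open>\<epsilon>\<close>.\<close>
  have T_path: "E (\<lambda>i. if i \<in> A then T y i else y i) - E y \<le> - (\<Sum>i\<in>A. gain y i)"
    if y: "y \<in> sub C" and "A \<subseteq> I" for y A
    using finite_subset[OF \<open>A \<subseteq> I\<close> finite_I] \<open>A \<subseteq> I\<close>
  proof (induction A)
    case empty
    then show ?case by simp
  next
    case (insert k A)
    define z where "z = (\<lambda>i. if i \<in> A then T y i else y i)"
    have k: "k \<in> I" "k \<notin> A" using insert by auto
    have y0: "0 \<le> y i" if "i \<in> I" for i using sub_dom[OF y] that by (auto simp: dom_iff)
    have near: "\<forall>i\<in>I. 0 \<le> (z(k := s)) i \<and> \<bar>(z(k := s)) i - y i\<bar> \<le> \<delta>"
      if "min (y k) (T y k) \<le> s" "s \<le> max (y k) (T y k)" for s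
    proof -
      have "0 \<le> s" "\<bar>s - y k\<bar> \<le> \<delta>"
        using that T_near[OF y k(1)] T_nonneg[of y k] y0[OF k(1)] by linarith+
      then show ?thesis using T_near[OF y] T_nonneg y0 \<delta>(1) by (simp add: z_def)
    qed
    have zk: "z k = y k" using k by (simp add: z_def)
    have "z(k := T y k) \<in> dom" by (rule \<delta>(2)[OF y near]) auto
    moreover have "z(k := y k) \<in> dom" by (rule \<delta>(2)[OF y near]) auto
    then have "z \<in> dom" using zk by (metis fun_upd_triv)
    ultimately obtain \<xi> where \<xi>: "min (y k) (T y k) \<le> \<xi>" "\<xi> \<le> max (y k) (T y k)"
      "E (z(k := T y k)) - E z = w k (z(k := \<xi>)) * (T y k - y k)"
      using E_mvt[of z k "T y k"] k zk by auto
    have "\<bar>w k (z(k := \<xi>)) - w k y\<bar> \<le> \<epsilon>" by (rule \<delta>(3)[OF y near[OF \<xi>(1,2)] k(1)])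
    then have "E (z(k := T y k)) - E z \<le> - gain y k"
      unfolding \<xi>(3) using T_step[OF y k(1)] by blast
    moreover have "E z - E y \<le> - (\<Sum>i\<in>A. gain y i)" using insert by (simp add: z_def)
    moreover have "(\<lambda>i. if i \<in> insert k A then T y i else y i) = z(k := T y k)"
      by (auto simp: z_def)
    ultimately show ?case using insert by simp
  qed
  have T_dom: "T y \<in> dom" if "y \<in> sub C" for y
    using \<delta>(2)[OF that] T_nonneg T_near[OF that] by auto
  have T_I: "(\<lambda>i. if i \<in> I then T y i else y i) \<in> dom" if "y \<in> sub C" for y
    using \<delta>(2)[OF that] T_nonneg T_near[OF that] by auto
  \<comment> \<open>A constant sequence converges to every point that agrees with it on
    \<open>I\<close>, so continuity forces equal values. This is needed because \<open>T\<close>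
    also alters coordinates outside \<open>I\<close>.\<close>
  have E_cong: "E y = E y'" if "y \<in> dom" "y' \<in> dom" "\<And>i. i \<in> I \<Longrightarrow> y i = y' i" for y y'
  proof -
    have "(\<lambda>n. E y) \<longlonglongrightarrow> E y'" by (rule E_cont) (use that in auto)
    then show ?thesis by (simp add: LIMSEQ_const_iff)
  qed
  have T_desc: "E (T y) \<le> E y - (\<Sum>i\<in>I. gain y i)" if "y \<in> sub C" for y
    using T_path[OF that order_refl] E_cong[OF T_dom[OF that] T_I[OF that]] by simp
  have gain_nonneg: "0 \<le> (\<Sum>i\<in>I. gain y i)" if "y \<in> sub C" for y
    using T_step[OF that] by (intro sum_nonneg) blast
  have T_sub: "T y \<in> sub C" if "y \<in> sub C" for y
    using T_desc[OF that] gain_nonneg[OF that] T_dom[OF that] that by (simp add: sub_def)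
  have T_zero: "zero_set y \<subseteq> zero_set (T y)" if "y \<in> sub C" for y
  proof
    fix i assume i: "i \<in> zero_set y"
    then have "w i y = \<alpha> i" "i \<in> I" using w_zero[OF sub_dom[OF that]] by (auto simp: zero_set_def)
    then have "shrink \<epsilon> (w i y) > 0" using \<epsilon>_\<alpha>[of i] \<epsilon> by (auto simp: shrink_def)
    then show "i \<in> zero_set (T y)" using i \<eta> by (auto simp: zero_set_def T_def euler_def)
  qed
  \<comment> \<open>If no coordinate was cut off at 0, the one with slope at least
    \<open>3 * \<epsilon>\<close> moved by at least \<open>\<eta> * (2 * \<epsilon>)\<close>, and
    \<open>2 * \<epsilon>\<close> of its slope remains after the error.\<close>
  define \<kappa> where "\<kappa> = 2 * \<epsilon> * (\<eta> * (2 * \<epsilon>))"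
  have \<kappa>: "\<kappa> > 0" using \<epsilon> \<eta> by (simp add: \<kappa>_def)
  have T_gain: "E (T y) \<le> E y - \<kappa>" if y: "y \<in> sub C" and "zero_set (T y) = {}" for y
  proof -
    obtain i where i: "i \<in> I" "3 * \<epsilon> \<le> \<bar>w i y\<bar>" using \<epsilon>_w[OF y] by blast
    have "T y i \<noteq> 0" using that i by (auto simp: zero_set_def)
    then have "T y i - y i = - (\<eta> * shrink \<epsilon> (w i y))" by (auto simp: T_def euler_def max_def split: if_splits)
    then have "\<bar>T y i - y i\<bar> = \<eta> * \<bar>shrink \<epsilon> (w i y)\<bar>" using \<eta> by (simp add: abs_mult)
    moreover have "\<bar>shrink \<epsilon> (w i y)\<bar> \<ge> 2 * \<epsilon>" using i(2) \<epsilon> by (auto simp: shrink_def)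
    ultimately have "\<eta> * (2 * \<epsilon>) \<le> \<bar>T y i - y i\<bar>" using \<eta> by simp
    then have "\<kappa> \<le> gain y i" unfolding \<kappa>_def gain_def using i \<epsilon> \<eta> by (intro mult_mono) auto
    also have "\<dots> \<le> (\<Sum>i\<in>I. gain y i)"
      using T_step[OF y] i(1) finite_I by (intro member_le_sum) auto
    finally show ?thesis using T_desc[OF y] by simp
  qed
  obtain m where m: "C < real m * \<kappa>" using reals_Archimedean3[OF \<kappa>] by blast
  define \<rho> where "\<rho> = T ^^ m"
  \<comment> \<open>Zero sets only grow, so an empty zero set after \<open>j\<close> steps was empty
    after each earlier step, and every one of them lost \<open>\<kappa>\<close>.\<close>
  have iter: "(T ^^ j) y \<in> sub C \<and> zero_set y \<subseteq> zero_set ((T ^^ j) y) \<and>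
      (zero_set ((T ^^ j) y) = {} \<longrightarrow> E ((T ^^ j) y) \<le> E y - real j * \<kappa>)" if "y \<in> sub C" for y j
  proof (induction j)
    case 0
    then show ?case using that by simp
  next
    case (Suc j)
    let ?z = "(T ^^ j) y"
    have "zero_set ?z \<subseteq> zero_set (T ?z)" using T_zero Suc by blast
    moreover have "E (T ?z) \<le> E y - real (Suc j) * \<kappa>" if "zero_set (T ?z) = {}"
      using T_gain[of ?z] Suc that calculation by (auto simp: algebra_simps)
    ultimately show ?case using T_sub Suc by auto
  qed
  show thesis
  proof (rule that[of \<rho>])
    fix y assume y: "y \<in> sub C"
    show "\<rho> y \<in> sub C" "zero_set y \<subseteq> zero_set (\<rho> y)" using iter[OF y] by (auto simp: \<rho>_def)
    show "zero_set (\<rho> y) \<noteq> {}"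
    proof
      assume "zero_set (\<rho> y) = {}"
      then have "E (\<rho> y) \<le> C - real m * \<kappa>" using iter[OF y, of m] y by (auto simp: \<rho>_def sub_def)
      then show False using m E_nonneg[of "\<rho> y"] iter[OF y, of m] by (auto simp: \<rho>_def sub_def)
    qed
  next
    fix ys y j assume ys: "\<And>n. ys n \<in> sub C" and y: "y \<in> sub C" and lim: "\<And>i. i \<in> I \<Longrightarrow> (\<lambda>n. ys n i) \<longlonglongrightarrow> y i" and "j \<in> I"
    have "(\<lambda>n. (T ^^ m) (ys n) j) \<longlonglongrightarrow> (T ^^ m) y j" if "j \<in> I" for m j
      using that
    proof (induction m arbitrary: j)
      case 0
      then show ?case using lim by simp
    next
      case (Suc m)
      have "(\<lambda>n. T ((T ^^ m) (ys n)) j) \<longlonglongrightarrow> T ((T ^^ m) y) j"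
        using iter[OF ys] iter[OF y] sub_dom Suc by (auto simp: T_def intro!: euler_cont)
      then show ?case by simp
    qed
    then show "(\<lambda>n. \<rho> (ys n) j) \<longlonglongrightarrow> \<rho> y j" using \<open>j \<in> I\<close> by (simp add: \<rho>_def)
  qed
qed

text \<open>Weights of points with unbounded energy would have a convergent subsequence; its limit
  is again a point of the hull, where the energy is finite and continuous.\<close>

lemma hull_in_sub: "\<exists>C. corner_hull \<subseteq> sub C"
proof (rule ccontr)
  assume "\<not> ?thesis"
  then have "\<exists>y\<in>corner_hull. y \<notin> sub (real n)" for n by blast
  then obtain ys where ys: "\<And>n. ys n \<in> corner_hull" "\<And>n. ys n \<notin> sub (real n)" by metis
  have hull_dom: "y \<in> dom" if "y \<in> corner_hull" for y
    using hull_nonneg[OF that] hull_zero_set[OF that] by (simp add: dom_iff)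
  have "\<exists>a. (\<forall>J\<in>D. 0 \<le> a J) \<and> sum a D = 1 \<and> ys n = (\<lambda>i. \<Sum>J\<in>D. a J * corner J i)" for n
    using ys(1)[of n] by (auto simp: corner_hull_def)
  then obtain a where a: "\<And>n J. J \<in> D \<Longrightarrow> 0 \<le> a n J" "\<And>n. sum (a n) D = (1 :: real)"
    "\<And>n. ys n = (\<lambda>i. \<Sum>J\<in>D. a n J * corner J i)" by metis
  have "\<bar>a n J\<bar> \<le> 1" if "J \<in> D" for n J
    using member_le_sum[of J D "a n"] a(1)[of _ n] a(2)[of n] that finite_D by auto
  then obtain r l where r: "strict_mono (r :: nat \<Rightarrow> nat)" "\<And>J. J \<in> D \<Longrightarrow> (\<lambda>n. a (r n) J) \<longlonglongrightarrow> l J"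
    using finite_bounded_convergent_subsequence[OF finite_D, of a "\<lambda>_. 1"] by blast
  define y where "y = (\<lambda>i. \<Sum>J\<in>D. l J * corner J i)"
  have lim: "(\<lambda>n. ys (r n) i) \<longlonglongrightarrow> y i" for i
    unfolding a(3) y_def by (intro tendsto_intros r)
  have "0 \<le> l J" if "J \<in> D" for J
    using r(2)[OF that] by (rule LIMSEQ_le_const) (use a that in auto)
  moreover have "(\<lambda>n. sum (a (r n)) D) \<longlonglongrightarrow> sum l D" by (intro tendsto_sum r)
  then have "sum l D = 1" using a(2) by (simp add: LIMSEQ_const_iff)
  ultimately have "y \<in> corner_hull" unfolding corner_hull_def y_def by blast
  then have "(\<lambda>n. E (ys (r n))) \<longlonglongrightarrow> E y" using ys hull_dom lim by (intro E_cont) auto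
  then have "\<forall>\<^sub>F n in sequentially. E (ys (r n)) < E y + 1" by (rule order_tendstoD) simp
  moreover have "\<forall>\<^sub>F n in sequentially. real n > E y + 1"
    using filterlim_real_sequentially unfolding filterlim_at_top_dense by blast
  ultimately obtain n where "E (ys (r n)) < E y + 1" "real n > E y + 1"
    using eventually_happens'[OF sequentially_bot eventually_conj] by blast
  moreover have "real n \<le> real (r n)" using seq_suble[OF r(1)] by simp
  ultimately show False using ys(2)[of "r n"] hull_dom[OF ys(1)] by (auto simp: sub_def)
qed

theorem critical_point_if_nontrivial_homology:
  assumes "k \<ge> -1" and nontriv: "\<not> trivial_group (reduced_homology_Z2 D k)"
  shows "\<exists>y\<in>dom. \<forall>i\<in>I. w i y = 0"
proof (rule ccontr)
  assume "\<not> ?thesis"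
  then have nocrit: "\<And>y. y \<in> dom \<Longrightarrow> \<exists>i\<in>I. w i y \<noteq> 0" by blast
  obtain C where C: "corner_hull \<subseteq> sub C" using hull_in_sub by blast
  obtain \<rho> where \<rho>: "\<And>y. y \<in> sub C \<Longrightarrow> \<rho> y \<in> sub C"
    "\<And>y. y \<in> sub C \<Longrightarrow> zero_set y \<subseteq> zero_set (\<rho> y)" "\<And>y. y \<in> sub C \<Longrightarrow> zero_set (\<rho> y) \<noteq> {}"
    "\<And>ys y j. (\<And>n. ys n \<in> sub C) \<Longrightarrow> y \<in> sub C \<Longrightarrow> (\<And>i. i \<in> I \<Longrightarrow> (\<lambda>n. ys n i) \<longlonglongrightarrow> y i) \<Longrightarrow> j \<in> I \<Longrightarrow>
       (\<lambda>n. \<rho> (ys n) j) \<longlonglongrightarrow> \<rho> y j"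
    using retraction_to_boundary[OF nocrit, of C] by blast
  \<comment> \<open>A boundary point is labelled by one of its own vanishing coordinates, so that
    labels return the faces of \<open>D\<close>; any other point takes a label from its image
    \<open>\<rho> y\<close>. In both cases the label vanishes at \<open>\<rho> y\<close>.\<close>
  define lab where "lab y = (SOME i. i \<in> (if zero_set y \<noteq> {} then zero_set y else zero_set (\<rho> y)))" for y
  have lab1: "lab y \<in> zero_set y" if "zero_set y \<noteq> {}" for y
    using that unfolding lab_def by (simp add: some_in_eq)
  have lab2: "lab y \<in> zero_set (\<rho> y)" if "y \<in> sub C" for y
  proof (cases "zero_set y = {}")
    case True
    then show ?thesis using \<rho>(3)[OF that] unfolding lab_def by (simp add: some_in_eq)
  next
    case False
    then show ?thesis using \<rho>(2)[OF that] lab1[of y] by blast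
  qed
  \<comment> \<open>If a label set \<open>L\<close> outside \<open>D\<close> occurred on arbitrarily
    small simplices, these would cluster at some \<open>y\<close>, and continuity of
    \<open>\<rho>\<close> would make all of \<open>L\<close> vanish at \<open>\<rho> y\<close>,
    putting \<open>L\<close> into \<open>D\<close>. So each such \<open>L\<close> has a safe
    scale.\<close>
  define bad where "bad \<epsilon> L \<longleftrightarrow> (\<exists>l. set l \<subseteq> sub C \<and> (\<forall>x\<in>set l. \<forall>y\<in>set l. l1_dist I x y < \<epsilon>) \<and> lab ` set l = L)" for \<epsilon> L
  have "\<exists>\<epsilon>>0. \<not> bad \<epsilon> L" if "L \<in> Pow I - D" for L
  proof (rule ccontr)
    assume "\<not> ?thesis"
    then have "bad (1 / real (Suc n)) L" for n by (simp del: of_nat_Suc)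
    then obtain l where l: "\<And>n. set (l n) \<subseteq> sub C" "\<And>n x y. x \<in> set (l n) \<Longrightarrow> y \<in> set (l n) \<Longrightarrow> l1_dist I x y < 1 / real (Suc n)"
      "\<And>n. lab ` set (l n) = L" unfolding bad_def by metis
    have "L \<noteq> {}" using that D_empty by blast
    then have "\<exists>y. y \<in> set (l n)" for n using l(3)[of n] by auto
    then obtain ys where ys: "\<And>n. ys n \<in> set (l n)" by metis
    have "ys n \<in> sub C" for n using ys l(1) by blast
    then obtain r y where r: "strict_mono (r :: nat \<Rightarrow> nat)" "y \<in> sub C" "\<And>i. i \<in> I \<Longrightarrow> (\<lambda>n. ys (r n) i) \<longlonglongrightarrow> y i"
      using sub_compact[of ys C] by blast
    have "j \<in> zero_set (\<rho> y)" if "j \<in> L" for j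
    proof -
      have "\<exists>x. x \<in> set (l n) \<and> lab x = j" for n using l(3)[of n] \<open>j \<in> L\<close> by auto
      then obtain xs where xs: "\<And>n. xs n \<in> set (l n)" "\<And>n. lab (xs n) = j" by metis
      have j: "\<rho> (xs n) j = 0" "j \<in> I" for n using lab2[of "xs n"] xs l(1) by (auto simp: zero_set_def)
      have close: "\<bar>xs n i - ys n i\<bar> \<le> 1 / real (Suc n)" if "i \<in> I" for i n
        using l(2)[OF xs(1) ys, of n] member_le_sum[of i I "\<lambda>i. \<bar>xs n i - ys n i\<bar>"] finite_I that
        by (auto simp: l1_dist_def)
      have "(\<lambda>n. 1 / real (Suc (r n))) \<longlonglongrightarrow> 0"
        using LIMSEQ_subseq_LIMSEQ[OF LIMSEQ_Suc[OF lim_1_over_n] r(1)] by (simp add: o_def)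
      then have "(\<lambda>n. xs (r n) i - ys (r n) i) \<longlonglongrightarrow> 0" if "i \<in> I" for i
        by (rule Lim_null_comparison[rotated]) (use close that in auto)
      then have "(\<lambda>n. xs (r n) i) \<longlonglongrightarrow> y i" if "i \<in> I" for i
        using tendsto_add[OF _ r(3)[OF that]] that by fastforce
      moreover have "xs n \<in> sub C" for n using xs(1) l(1) by blast
      ultimately have "(\<lambda>n. \<rho> (xs (r n)) j) \<longlonglongrightarrow> \<rho> y j"
        using xs l(1) r j by (intro \<rho>(4)) auto
      then have "\<rho> y j = 0" using j by (simp add: LIMSEQ_const_iff)
      then show ?thesis using j by (simp add: zero_set_def)
    qed
    then have "L \<subseteq> zero_set (\<rho> y)" by blast
    moreover have "zero_set (\<rho> y) \<in> D" using \<rho>(1)[OF r(2)] by (auto simp: sub_def dom_iff)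
    ultimately show False using D_down that by blast
  qed
  then obtain e where e: "\<And>L. L \<in> Pow I - D \<Longrightarrow> e L > 0 \<and> \<not> bad (e L) L" by metis
  \<comment> \<open>There are finitely many label sets; the entry 1 covers the case that all subsets
    of \<open>I\<close> are in \<open>D\<close>.\<close>
  define \<epsilon> where "\<epsilon> = Min (insert 1 (e ` (Pow I - D)))"
  have fin: "finite (insert 1 (e ` (Pow I - D)))" using finite_I by simp
  have "\<epsilon> > 0" unfolding \<epsilon>_def using e fin by (subst Min_gr_iff) auto
  have small: "lab ` set l \<in> D"
    if l: "set l \<subseteq> corner_hull" "\<forall>x\<in>set l. \<forall>y\<in>set l. l1_dist I x y < \<epsilon>" for l
  proof (rule ccontr)
    assume nD: "lab ` set l \<notin> D"
    have "set l \<subseteq> sub C" using l C by blast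
    then have L: "lab ` set l \<in> Pow I - D" using lab2 nD by (auto simp: zero_set_def)
    then have "\<epsilon> \<le> e (lab ` set l)" unfolding \<epsilon>_def using fin by (intro Min_le) auto
    then have "bad (e (lab ` set l)) (lab ` set l)"
      unfolding bad_def using l(2) \<open>set l \<subseteq> sub C\<close> by (intro exI[of _ l]) force
    then show False using e[OF L] by blast
  qed
  have "trivial_group (reduced_homology_Z2 D k)"
    by (rule trivial_homology_if_acyclic[OF acyclic_if_labelling[OF \<open>\<epsilon> > 0\<close> lab1 small] \<open>k \<ge> -1\<close>])
  with nontriv show False by blast
qed

end

section \<open>Hausdorff measure as a Borel measure\<close>

lemma countably_subadditive_UN:
  fixes f :: "'a set \<Rightarrow> ennreal"
  assumes "countably_subadditive (Pow UNIV) f" "increasing (Pow UNIV) f"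
  shows "f (\<Union>i. A i) \<le> suminf (\<lambda>i. f (A i))"
proof -
  have "f (\<Union>i. disjointed A i) \<le> suminf (\<lambda>i. f (disjointed A i))"
    using assms(1) disjoint_family_disjointed[of A] by (auto simp: countably_subadditive_def)
  also have "\<dots> \<le> suminf (\<lambda>i. f (A i))"
    using assms(2) disjointed_subset[of A] by (intro suminf_le) (auto simp: increasing_def)
  finally show ?thesis by (simp add: UN_disjointed_eq)
qed

lemma hausdorff_gauge_mono:
  fixes C C' :: "'a::metric_space set"
  assumes "bounded C" "bounded C'" "C = {} \<or> C' \<noteq> {} \<and> diameter C \<le> diameter C'"
  shows "hausdorff_gauge d C \<le> hausdorff_gauge d C'"
  using assms diameter_ge_0[of C]
  by (auto simp: hausdorff_gauge_def intro!: ennreal_leI mult_left_mono power_mono)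

lemma hausdorff_premeasure_mono: "A \<subseteq> B \<Longrightarrow> hausdorff_premeasure d \<delta> A \<le> hausdorff_premeasure d \<delta> B"
  unfolding hausdorff_premeasure_def by (intro INF_superset_mono) auto

lemma hausdorff_premeasure_antimono:
  "\<delta> \<le> \<delta>' \<Longrightarrow> hausdorff_premeasure d \<delta>' A \<le> hausdorff_premeasure d \<delta> A"
  unfolding hausdorff_premeasure_def by (intro INF_superset_mono) (auto intro: order_trans)

lemma hausdorff_premeasure_le:
  assumes "A \<subseteq> (\<Union>i. C i)" "\<And>i. bounded (C i)" "\<And>i. diameter (C i) \<le> \<delta>"
  shows "hausdorff_premeasure d \<delta> A \<le> suminf (\<lambda>i. hausdorff_gauge d (C i))"
  unfolding hausdorff_premeasure_def by (rule INF_lower) (use assms in auto)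

text \<open>Giving the value infinity to sets that are too large moves the restriction on covers
  into the gauge, so the premeasure becomes a standard outer measure and inherits countable
  subadditivity.\<close>

lemma hausdorff_premeasure_eq_outer_measure:
  fixes d :: nat and A :: "'a::metric_space set"
  assumes "0 \<le> \<delta>"
  defines "g \<equiv> \<lambda>C. if bounded C \<and> diameter C \<le> \<delta> then hausdorff_gauge d (C :: 'a set) else \<infinity>"
  shows "hausdorff_premeasure d \<delta> A = outer_measure (Pow UNIV) g A"
    and "positive (Pow UNIV) g" and "increasing (Pow UNIV) g"
proof -
  interpret sigma_algebra UNIV "Pow UNIV :: 'a set set" by (rule sigma_algebra_Pow)
  show pos: "positive (Pow UNIV) g"
    using assms by (auto simp: positive_def hausdorff_gauge_def)
  show inc: "increasing (Pow UNIV) g"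
    unfolding increasing_def g_def
    by (auto intro!: hausdorff_gauge_mono diameter_subset intro: bounded_subset order_trans[OF diameter_subset])
  show "hausdorff_premeasure d \<delta> A = outer_measure (Pow UNIV) g A"
  proof (rule antisym)
    show "hausdorff_premeasure d \<delta> A \<le> outer_measure (Pow UNIV) g A"
      unfolding outer_measure_def
    proof (rule INF_greatest, clarify)
      fix C :: "nat \<Rightarrow> 'a set" assume C: "A \<subseteq> (\<Union>i. C i)"
      show "hausdorff_premeasure d \<delta> A \<le> suminf (\<lambda>i. g (C i))"
      proof (cases "\<forall>i. bounded (C i) \<and> diameter (C i) \<le> \<delta>")
        case True
        then show ?thesis using hausdorff_premeasure_le[OF C, of \<delta> d] by (simp add: g_def)
      next
        case False
        then obtain i where "\<not> (bounded (C i) \<and> diameter (C i) \<le> \<delta>)" by blast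
        then have "g (C i) = \<infinity>" by (simp only: g_def if_False)
        then have "suminf (\<lambda>i. g (C i)) = \<infinity>"
          using sum_le_suminf[of "\<lambda>i. g (C i)" "{i}"] by (simp add: top_unique)
        then show ?thesis by simp
      qed
    qed
    show "outer_measure (Pow UNIV) g A \<le> hausdorff_premeasure d \<delta> A"
      unfolding hausdorff_premeasure_def
    proof (rule INF_greatest, clarify)
      fix C :: "nat \<Rightarrow> 'a set"
      assume C: "A \<subseteq> (\<Union>i. C i)" "\<forall>i. bounded (C i) \<and> diameter (C i) \<le> \<delta>"
      have "outer_measure (Pow UNIV) g A \<le> suminf (\<lambda>i. g (C i))"
        by (rule outer_measure_le[OF pos inc _ C(1)]) auto
      then show "outer_measure (Pow UNIV) g A \<le> suminf (\<lambda>i. hausdorff_gauge d (C i))"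
        using C(2) by (simp add: g_def)
    qed
  qed
qed

lemma hausdorff_premeasure_subadditive:
  assumes "0 \<le> \<delta>"
  shows "hausdorff_premeasure d \<delta> (\<Union>i. A i :: 'a::metric_space set) \<le> suminf (\<lambda>i. hausdorff_premeasure d \<delta> (A i))"
proof -
  interpret sigma_algebra UNIV "Pow UNIV :: 'a set set" by (rule sigma_algebra_Pow)
  note eq = hausdorff_premeasure_eq_outer_measure[OF assms, of d]
  show ?thesis
    unfolding eq(1)
    by (rule countably_subadditive_UN[OF countably_subadditive_outer_measure[OF eq(2,3)] increasing_outer_measure])
qed

lemma hausdorff_premeasure_le_measure: "0 < \<delta> \<Longrightarrow> hausdorff_premeasure d \<delta> A \<le> hausdorff_measure d A"
  unfolding hausdorff_measure_def by (rule SUP_upper) auto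

lemma hausdorff_measure_mono: "A \<subseteq> B \<Longrightarrow> hausdorff_measure d A \<le> hausdorff_measure d B"
  unfolding hausdorff_measure_def by (intro SUP_mono) (auto intro: hausdorff_premeasure_mono)

lemma outer_measure_space_hausdorff:
  "outer_measure_space (Pow UNIV) (hausdorff_measure d :: 'a::metric_space set \<Rightarrow> ennreal)"
  unfolding outer_measure_space_def
proof (intro conjI)
  have "hausdorff_premeasure d \<delta> ({} :: 'a set) = 0" if "0 < \<delta>" for \<delta>
    using hausdorff_premeasure_le[of "{}" "\<lambda>_. {} :: 'a set" \<delta> d] that by (simp add: hausdorff_gauge_def)
  then show "positive (Pow UNIV) (hausdorff_measure d :: 'a set \<Rightarrow> ennreal)"
    by (simp add: positive_def hausdorff_measure_def)
  show "increasing (Pow UNIV) (hausdorff_measure d :: 'a set \<Rightarrow> ennreal)"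
    by (simp add: increasing_def hausdorff_measure_mono)
  show "countably_subadditive (Pow UNIV) (hausdorff_measure d :: 'a set \<Rightarrow> ennreal)"
    unfolding countably_subadditive_def
  proof (intro allI impI)
    fix A :: "nat \<Rightarrow> 'a set"
    show "hausdorff_measure d (\<Union>i. A i) \<le> suminf (\<lambda>i. hausdorff_measure d (A i))"
      unfolding hausdorff_measure_def[of d "\<Union>i. A i"]
    proof (rule SUP_least)
      fix \<delta> :: real assume "\<delta> \<in> {0<..}"
      then have "hausdorff_premeasure d \<delta> (\<Union>i. A i) \<le> suminf (\<lambda>i. hausdorff_premeasure d \<delta> (A i))"
        by (intro hausdorff_premeasure_subadditive) auto
      also have "\<dots> \<le> suminf (\<lambda>i. hausdorff_measure d (A i))"
        using \<open>\<delta> \<in> _\<close> by (intro suminf_le hausdorff_premeasure_le_measure) auto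
      finally show "hausdorff_premeasure d \<delta> (\<Union>i. A i) \<le> suminf (\<lambda>i. hausdorff_measure d (A i))" .
    qed
  qed
qed

lemma hausdorff_measure_empty [simp]: "hausdorff_measure d ({} :: 'a::metric_space set) = 0"
  using outer_measure_space_hausdorff[where 'a = 'a, of d] by (simp add: outer_measure_space_def positive_def)

lemma hausdorff_measure_subadditive:
  "hausdorff_measure d (\<Union>i. A i :: 'a::metric_space set) \<le> suminf (\<lambda>i. hausdorff_measure d (A i))"
  using outer_measure_space_hausdorff[where 'a = 'a, of d]
  unfolding outer_measure_space_def by (intro countably_subadditive_UN) auto

lemma hausdorff_measure_Un: "hausdorff_measure d (A \<union> B) \<le> hausdorff_measure d A + hausdorff_measure d B"
proof -
  have "hausdorff_measure d (A \<union> B) \<le> suminf (\<lambda>i. hausdorff_measure d (binaryset A B i))"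
    using hausdorff_measure_subadditive[of d "binaryset A B"] by (simp add: UN_binaryset_eq)
  also have "\<dots> = hausdorff_measure d A + hausdorff_measure d B"
    by (rule suminf_binaryset_eq) simp
  finally show ?thesis .
qed

text \<open>A set of diameter less than \<open>r\<close> cannot meet both parts, so that covers split.\<close>

lemma hausdorff_measure_separated:
  fixes A B :: "'a::metric_space set"
  assumes "0 < r" and sep: "\<And>x y. x \<in> A \<Longrightarrow> y \<in> B \<Longrightarrow> r \<le> dist x y"
  shows "hausdorff_measure d A + hausdorff_measure d B \<le> hausdorff_measure d (A \<union> B)"
proof -
  have split: "hausdorff_premeasure d \<delta> A + hausdorff_premeasure d \<delta> B \<le> hausdorff_premeasure d \<delta> (A \<union> B)"
    if "0 < \<delta>" "\<delta> < r" for \<delta>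
    unfolding hausdorff_premeasure_def[of d \<delta> "A \<union> B"]
  proof (rule INF_greatest, clarify)
    fix C :: "nat \<Rightarrow> 'a set"
    assume C: "A \<union> B \<subseteq> (\<Union>i. C i)" "\<forall>i. bounded (C i) \<and> diameter (C i) \<le> \<delta>"
    let ?P = "\<lambda>S i. if C i \<inter> S = {} then {} else C i"
    have "hausdorff_premeasure d \<delta> S \<le> suminf (\<lambda>i. hausdorff_gauge d (?P S i))" if S: "S \<subseteq> A \<union> B" for S
    proof (rule hausdorff_premeasure_le)
      show "S \<subseteq> (\<Union>i. ?P S i)"
      proof
        fix x assume "x \<in> S"
        then obtain i where "x \<in> C i" using C(1) S by blast
        then have "x \<in> ?P S i" using \<open>x \<in> S\<close> by auto
        then show "x \<in> (\<Union>i. ?P S i)" by blast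
      qed
    qed (use C(2) \<open>0 < \<delta>\<close> in auto)
    then have "hausdorff_premeasure d \<delta> A + hausdorff_premeasure d \<delta> B
        \<le> suminf (\<lambda>i. hausdorff_gauge d (?P A i)) + suminf (\<lambda>i. hausdorff_gauge d (?P B i))"
      by (intro add_mono) auto
    also have "\<dots> = suminf (\<lambda>i. hausdorff_gauge d (?P A i) + hausdorff_gauge d (?P B i))"
      by (rule suminf_add) auto
    also have "\<dots> \<le> suminf (\<lambda>i. hausdorff_gauge d (C i))"
    proof (intro suminf_le summableI)
      fix i
      have "C i \<inter> A = {} \<or> C i \<inter> B = {}"
      proof (rule ccontr)
        assume "\<not> ?thesis"
        then obtain x y where "x \<in> C i" "x \<in> A" "y \<in> C i" "y \<in> B" by blast
        then have "r \<le> diameter (C i)"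
          using sep[of x y] diameter_bounded_bound[of "C i" x y] C(2) by fastforce
        with C(2) \<open>\<delta> < r\<close> show False by (meson not_less order_trans)
      qed
      then show "hausdorff_gauge d (?P A i) + hausdorff_gauge d (?P B i) \<le> hausdorff_gauge d (C i)"
        by (auto simp: hausdorff_gauge_def)
    qed
    finally show "hausdorff_premeasure d \<delta> A + hausdorff_premeasure d \<delta> B \<le> suminf (\<lambda>i. hausdorff_gauge d (C i))" .
  qed
  have "hausdorff_premeasure d \<delta> A + hausdorff_premeasure d \<delta>' B \<le> hausdorff_measure d (A \<union> B)"
    if "0 < \<delta>" "0 < \<delta>'" for \<delta> \<delta>'
  proof -
    define \<epsilon> where "\<epsilon> = min (min \<delta> \<delta>') (r / 2)"
    have \<epsilon>: "0 < \<epsilon>" "\<epsilon> < r" "\<epsilon> \<le> \<delta>" "\<epsilon> \<le> \<delta>'" using that \<open>0 < r\<close> by (auto simp: \<epsilon>_def)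
    have "hausdorff_premeasure d \<delta> A + hausdorff_premeasure d \<delta>' B \<le> hausdorff_premeasure d \<epsilon> A + hausdorff_premeasure d \<epsilon> B"
      by (intro add_mono hausdorff_premeasure_antimono \<epsilon>)
    also note split[OF \<epsilon>(1,2)]
    also note hausdorff_premeasure_le_measure[OF \<epsilon>(1)]
    finally show ?thesis .
  qed
  then have "hausdorff_premeasure d \<delta> A + hausdorff_measure d B \<le> hausdorff_measure d (A \<union> B)" if "0 < \<delta>" for \<delta>
    using that unfolding hausdorff_measure_def[of d B]
    by (subst add.commute, subst ennreal_SUP_add_left[symmetric]) (auto intro!: SUP_least simp: add.commute[of _ "hausdorff_premeasure d \<delta> A"])
  then show ?thesis
    unfolding hausdorff_measure_def[of d A]
    by (subst ennreal_SUP_add_left[symmetric]) (auto intro!: SUP_least)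
qed

lemma hausdorff_measure_infdist_separated:
  fixes A B F :: "'a::metric_space set"
  assumes "\<And>x. x \<in> A \<Longrightarrow> a \<le> infdist x F" "\<And>y. y \<in> B \<Longrightarrow> infdist y F \<le> b" "b < a"
  shows "hausdorff_measure d A + hausdorff_measure d B \<le> hausdorff_measure d (A \<union> B)"
proof (rule hausdorff_measure_separated)
  show "0 < a - b" using assms by simp
  show "a - b \<le> dist x y" if "x \<in> A" "y \<in> B" for x y
    using assms(1)[OF that(1)] assms(2)[OF that(2)] infdist_triangle[of x F y] by simp
qed

text \<open>
  The shells \<open>R k\<close> around \<open>F\<close> with indices of equal parity are pairwise separated, so that the sum of
  their measures is finite; this controls the part of \<open>A - F\<close> close to \<open>F\<close>.
\<close>

lemma hausdorff_measure_caratheodory: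
  fixes F :: "'a::metric_space set"
  assumes "closed F"
  shows "hausdorff_measure d (A \<inter> F) + hausdorff_measure d (A - F) \<le> hausdorff_measure d A"
proof (cases "F = {} \<or> hausdorff_measure d A = \<infinity>")
  case True
  then show ?thesis by auto
next
  case False
  then have fin: "hausdorff_measure d A \<noteq> \<infinity>" and "F \<noteq> {}" by auto
  let ?H = "hausdorff_measure d :: 'a set \<Rightarrow> ennreal"
  define s where "s k = 1 / real (Suc k)" for k
  have s: "s k > 0" "k < l \<Longrightarrow> s l < s k" "k \<le> l \<Longrightarrow> s l \<le> s k" for k l by (auto simp: s_def frac_le frac_less2)
  define R where "R k = {x \<in> A. s (Suc k) \<le> infdist x F \<and> infdist x F < s k}" for k
  define S where "S k = {x \<in> A. s k \<le> infdist x F}" for k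
  have R_sum: "(\<Sum>k<2*m. ?H (R k)) \<le> ?H (\<Union>j<m. R (2*j)) + ?H (\<Union>j<m. R (2*j+1))" for m
  proof (induction m)
    case (Suc m)
    have step: "?H (\<Union>j<m. R (2*j+c)) + ?H (R (2*m+c)) \<le> ?H (\<Union>j<Suc m. R (2*j+c))" for c
    proof (cases "m = 0")
      case False
      have "?H (\<Union>j<m. R (2*j+c)) + ?H (R (2*m+c)) \<le> ?H ((\<Union>j<m. R (2*j+c)) \<union> R (2*m+c))"
      proof (rule hausdorff_measure_infdist_separated)
        \<comment> \<open>The shell of index \<open>2*m+c-1\<close>, of the other parity, lies in
          between and supplies the positive gap.\<close>
        show "s (2*m+c-1) \<le> infdist x F" if x: "x \<in> (\<Union>j<m. R (2*j+c))" for x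
        proof -
          obtain j where "j < m" "x \<in> R (2*j+c)" using x by blast
          then have "s (2*j+c+1) \<le> infdist x F" "2*j+c+1 \<le> 2*m+c-1" by (auto simp: R_def)
          then show ?thesis using s(3) order_trans by blast
        qed
        show "infdist y F \<le> s (2*m+c)" if "y \<in> R (2*m+c)" for y using that by (auto simp: R_def)
        show "s (2*m+c) < s (2*m+c-1)" using False by (intro s) auto
      qed
      then show ?thesis by (simp add: lessThan_Suc Un_commute)
    qed (simp add: lessThan_Suc)
    have "(\<Sum>k<2 * Suc m. ?H (R k)) = (\<Sum>k<2*m. ?H (R k)) + ?H (R (2*m)) + ?H (R (2*m+1))"
      by simp
    also have "\<dots> \<le> (?H (\<Union>j<m. R (2*j)) + ?H (\<Union>j<m. R (2*j+1))) + ?H (R (2*m)) + ?H (R (2*m+1))"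
      using Suc by (intro add_right_mono)
    also have "\<dots> = (?H (\<Union>j<m. R (2*j+0)) + ?H (R (2*m+0))) + (?H (\<Union>j<m. R (2*j+1)) + ?H (R (2*m+1)))"
      by (simp add: ac_simps)
    also have "\<dots> \<le> ?H (\<Union>j<Suc m. R (2*j+0)) + ?H (\<Union>j<Suc m. R (2*j+1))"
      by (intro add_mono step)
    finally show ?case by simp
  qed simp
  have "(\<Sum>k<m. ?H (R k)) \<le> ?H A + ?H A" for m
  proof -
    have "(\<Sum>k<m. ?H (R k)) \<le> (\<Sum>k<2*m. ?H (R k))" by (intro sum_mono2) auto
    also note R_sum
    also have "?H (\<Union>j<m. R (2*j)) + ?H (\<Union>j<m. R (2*j+1)) \<le> ?H A + ?H A"
      by (intro add_mono hausdorff_measure_mono) (auto simp: R_def)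
    finally show ?thesis .
  qed
  then have "suminf (\<lambda>k. ?H (R k)) \<le> ?H A + ?H A"
    unfolding suminf_eq_SUP by (rule SUP_least)
  then have T_fin: "suminf (\<lambda>k. ?H (R k)) \<noteq> \<infinity>"
    using fin by (auto simp: top_unique)
  \<comment> \<open>The partial sum of the shells is kept on the left so that nothing is subtracted
    in \<open>ennreal\<close>; the total over all shells is finite and is cancelled at the
    end.\<close>
  have "?H (A \<inter> F) + ?H (A - F) + (\<Sum>j<k. ?H (R j)) \<le> ?H A + suminf (\<lambda>j. ?H (R j))" for k
  proof -
    have "A - F \<subseteq> S k \<union> (\<Union>j. R (j + k))"
    proof
      fix x assume "x \<in> A - F"
      then have pos: "infdist x F > 0" using assms \<open>F \<noteq> {}\<close> in_closed_iff_infdist_zero infdist_nonneg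
        by (metis DiffD2 less_eq_real_def)
      show "x \<in> S k \<union> (\<Union>j. R (j + k))"
      proof (cases "s k \<le> infdist x F")
        case True
        then show ?thesis using \<open>x \<in> A - F\<close> by (auto simp: S_def)
      next
        case False
        obtain n where n: "s n < infdist x F" using pos reals_Archimedean by (auto simp: s_def inverse_eq_divide)
        \<comment> \<open>The first level not above the distance: the point lies in the shell just
          before it, of index \<open>l - 1\<close>.\<close>
        define l where "l = (LEAST l. s l \<le> infdist x F)"
        have l: "s l \<le> infdist x F" unfolding l_def by (rule LeastI[of _ n]) (use n in simp)
        have "k < l" using l False s(3)[of l k] by force
        then have "\<not> s (l - 1) \<le> infdist x F" using not_less_Least[of "l - 1" "\<lambda>l. s l \<le> infdist x F"] by (auto simp: l_def)
        then have "x \<in> R (l - 1)" using l \<open>x \<in> A - F\<close> \<open>k < l\<close> by (auto simp: R_def)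
        moreover have "l - 1 = (l - 1 - k) + k" using \<open>k < l\<close> by simp
        ultimately show ?thesis by (metis UN_I UNIV_I UnI2)
      qed
    qed
    then have "?H (A - F) \<le> ?H (S k \<union> (\<Union>j. R (j + k)))" by (rule hausdorff_measure_mono)
    also have "\<dots> \<le> ?H (S k) + ?H (\<Union>j. R (j + k))" by (rule hausdorff_measure_Un)
    also have "\<dots> \<le> ?H (S k) + suminf (\<lambda>j. ?H (R (j + k)))"
      by (intro add_left_mono hausdorff_measure_subadditive)
    finally have "?H (A \<inter> F) + ?H (A - F) + (\<Sum>j<k. ?H (R j))
        \<le> ?H (A \<inter> F) + (?H (S k) + suminf (\<lambda>j. ?H (R (j + k)))) + (\<Sum>j<k. ?H (R j))"
      by (intro add_mono order_refl)
    also have "\<dots> = (?H (S k) + ?H (A \<inter> F)) + (suminf (\<lambda>j. ?H (R (j + k))) + (\<Sum>j<k. ?H (R j)))"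
      by (simp add: ac_simps)
    also have "suminf (\<lambda>j. ?H (R (j + k))) + (\<Sum>j<k. ?H (R j)) = suminf (\<lambda>j. ?H (R j))"
      using suminf_offset[of "\<lambda>j. ?H (R j)" k] by (simp add: add.commute)
    also have "?H (S k) + ?H (A \<inter> F) \<le> ?H (S k \<union> (A \<inter> F))"
      by (rule hausdorff_measure_infdist_separated[of _ "s k" F _ 0]) (auto simp: S_def s)
    also have "\<dots> \<le> ?H A" by (rule hausdorff_measure_mono) (auto simp: S_def)
    finally show ?thesis by simp
  qed
  moreover have "(\<lambda>k. ?H (A \<inter> F) + ?H (A - F) + (\<Sum>j<k. ?H (R j))) \<longlonglongrightarrow> ?H (A \<inter> F) + ?H (A - F) + suminf (\<lambda>j. ?H (R j))"
    by (intro tendsto_intros summable_LIMSEQ) auto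
  ultimately have "?H (A \<inter> F) + ?H (A - F) + suminf (\<lambda>j. ?H (R j)) \<le> ?H A + suminf (\<lambda>j. ?H (R j))"
    by (intro LIMSEQ_le_const2) auto
  then show ?thesis
    using T_fin by (simp add: add.commute[of _ "suminf (\<lambda>j. ?H (R j))"] ennreal_add_left_cancel_le)
qed

text \<open>Closed sets satisfy the Caratheodory condition, and the sets satisfying it form a
  sigma-algebra on which the outer measure is countably additive. This sigma-algebra contains all
  Borel sets.\<close>

lemma measure_space_hausdorff:
  "measure_space UNIV (sets (borel :: 'a::metric_space measure)) (hausdorff_measure d)"
proof -
  interpret sigma_algebra UNIV "Pow UNIV :: 'a set set" by (rule sigma_algebra_Pow)
  let ?L = "lambda_system UNIV (Pow UNIV) (hausdorff_measure d :: 'a set \<Rightarrow> ennreal)"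
  have L: "measure_space UNIV ?L (hausdorff_measure d)"
    by (rule caratheodory_lemma[OF outer_measure_space_hausdorff])
  have "closed F \<Longrightarrow> F \<in> ?L" for F
    unfolding lambda_system_eq
    using hausdorff_measure_caratheodory[of F d] hausdorff_measure_Un[of d "x \<inter> F" "x - F" for x]
    by (auto intro!: antisym simp: Int_Diff_Un)
  then have "{S. closed S} \<subseteq> ?L" by blast
  moreover have sets_borel: "sets (borel :: 'a measure) = sigma_sets UNIV {S. closed S}"
    unfolding borel_eq_closed by (rule sets_measure_of) simp
  moreover have "sigma_algebra UNIV ?L" using L by (simp add: measure_space_def)
  ultimately have sub: "sets borel \<subseteq> ?L"
    by (simp add: sigma_algebra.sigma_sets_subset)
  have "countably_additive (sets (borel :: 'a measure)) (hausdorff_measure d)"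
    unfolding countably_additive_def
  proof (intro allI impI)
    fix A :: "nat \<Rightarrow> 'a set" assume A: "range A \<subseteq> sets borel" "disjoint_family A" "(\<Union>i. A i) \<in> sets borel"
    show "suminf (\<lambda>i. hausdorff_measure d (A i)) = hausdorff_measure d (\<Union>i. A i)"
      using L A sub unfolding measure_space_def countably_additive_def by (meson order_trans subsetD)
  qed
  moreover have "sigma_algebra UNIV (sets (borel :: 'a measure))"
    using sets.sigma_algebra_axioms[of "borel :: 'a measure"] by simp
  ultimately show ?thesis
    by (simp add: measure_space_def positive_def)
qed

section \<open>The Borel measure and its invariance under isometries\<close>

definition hausdorff :: "nat \<Rightarrow> 'a::metric_space measure" where
  "hausdorff d = measure_of UNIV (sets borel) (hausdorff_measure d)"

lemma sets_hausdorff [simp, measurable_cong]: "sets (hausdorff d) = sets borel"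
  unfolding hausdorff_def using sets.sets_measure_of_eq[of borel] by simp

lemma space_hausdorff [simp]: "space (hausdorff d) = UNIV"
  by (simp add: hausdorff_def)

lemma emeasure_hausdorff: "A \<in> sets borel \<Longrightarrow> emeasure (hausdorff d) A = hausdorff_measure d A"
  using measure_space_hausdorff[of d] unfolding hausdorff_def measure_space_def
  by (intro emeasure_measure_of_sigma) (auto)

lemma hausdorff_measure_isometry_le:
  fixes f :: "'a::real_normed_vector \<Rightarrow> 'b::real_normed_vector"
  assumes f: "\<And>x y. dist (f x) (f y) = dist x y"
  shows "hausdorff_measure d (f ` A) \<le> hausdorff_measure d A"
  unfolding hausdorff_measure_def
proof (intro SUP_mono bexI)
  fix \<delta> :: real assume "\<delta> \<in> {0<..}"
  show "hausdorff_premeasure d \<delta> (f ` A) \<le> hausdorff_premeasure d \<delta> A"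
    unfolding hausdorff_premeasure_def[of d \<delta> A]
  proof (rule INF_greatest, clarify)
    fix C :: "nat \<Rightarrow> 'a set" assume C: "A \<subseteq> (\<Union>i. C i)" "\<forall>i. bounded (C i) \<and> diameter (C i) \<le> \<delta>"
    have bdd: "bounded (f ` C i)" for i
    proof -
      obtain x e where "\<forall>y\<in>C i. dist x y \<le> e" using C(2) unfolding bounded_def by blast
      then show ?thesis unfolding bounded_def using f by (intro exI[of _ "f x"] exI[of _ e]) auto
    qed
    have diam: "diameter (f ` C i) \<le> diameter (C i)" for i
      using C(2) diameter_ge_0[of "C i"] diameter_bounded_bound[of "C i"] f
      by (intro diameter_le) (auto simp flip: dist_norm)
    have "hausdorff_premeasure d \<delta> (f ` A) \<le> suminf (\<lambda>i. hausdorff_gauge d (f ` C i))"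
      using C bdd order_trans[OF diam] by (intro hausdorff_premeasure_le) (auto simp flip: image_UN)
    also have "\<dots> \<le> suminf (\<lambda>i. hausdorff_gauge d (C i))"
      using diam diameter_ge_0[OF bdd] unfolding hausdorff_gauge_def
      by (intro suminf_le summableI) (auto intro!: ennreal_leI mult_left_mono power_mono)
    finally show "hausdorff_premeasure d \<delta> (f ` A) \<le> suminf (\<lambda>i. hausdorff_gauge d (C i))" .
  qed
qed

lemma hausdorff_measure_isometry:
  fixes f :: "'a::real_normed_vector \<Rightarrow> 'a"
  assumes f: "\<And>x y. dist (f x) (f y) = dist x y" and inv: "\<And>x. g (f x) = x" "\<And>x. f (g x) = x"
  shows "hausdorff_measure d (f ` A) = hausdorff_measure d A"
proof (rule antisym[OF hausdorff_measure_isometry_le[OF f]])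
  have "dist (g x) (g y) = dist x y" for x y using f[of "g x" "g y"] by (simp add: inv)
  then have "hausdorff_measure d (g ` f ` A) \<le> hausdorff_measure d (f ` A)" by (rule hausdorff_measure_isometry_le)
  moreover have "g ` f ` A = A" by (simp add: image_image inv)
  ultimately show "hausdorff_measure d A \<le> hausdorff_measure d (f ` A)" by simp
qed

lemma hausdorff_measure_translation:
  "hausdorff_measure d ((+) v ` A) = hausdorff_measure d (A :: 'a::real_normed_vector set)"
  by (rule hausdorff_measure_isometry[of _ "\<lambda>x. x - v"]) auto

section \<open>Areas of hyperplane slices\<close>

abbreviation area :: "(real ^ 'n) set \<Rightarrow> ennreal" where
  "area \<equiv> hausdorff_measure (CARD('n) - 1)"

text \<open>The finite cover is padded with empty sets, whose gauge is 0 even in dimension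
  0.\<close>

lemma hausdorff_premeasure_finite_cover:
  assumes "finite G" "A \<subseteq> (\<Union>g\<in>G. C g)" "\<And>g. g \<in> G \<Longrightarrow> bounded (C g)" "\<And>g. g \<in> G \<Longrightarrow> diameter (C g) \<le> \<delta>" "0 \<le> \<delta>"
  shows "hausdorff_premeasure d \<delta> A \<le> (\<Sum>g\<in>G. hausdorff_gauge d (C g))"
proof -
  obtain h where h: "bij_betw h {0..<card G} G"
    using ex_bij_betw_nat_finite[OF assms(1)] by blast
  define C' where "C' i = (if i < card G then C (h i) else {})" for i
  have hG: "h i \<in> G" if "i < card G" for i using h that by (auto simp: bij_betw_def)
  have "hausdorff_premeasure d \<delta> A \<le> suminf (\<lambda>i. hausdorff_gauge d (C' i))"
  proof (rule hausdorff_premeasure_le)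
    show "A \<subseteq> (\<Union>i. C' i)"
    proof
      fix x assume "x \<in> A"
      then obtain g where "g \<in> G" "x \<in> C g" using assms(2) by blast
      moreover obtain i where "i < card G" "h i = g" using h \<open>g \<in> G\<close>
        by (metis atLeastLessThan_iff bij_betw_imp_surj_on imageE)
      ultimately show "x \<in> (\<Union>i. C' i)" by (auto simp: C'_def intro!: exI[of _ i])
    qed
  qed (use assms hG in \<open>auto simp: C'_def\<close>)
  also have "\<dots> = (\<Sum>i<card G. hausdorff_gauge d (C' i))"
    by (rule suminf_finite) (auto simp: C'_def hausdorff_gauge_def)
  also have "\<dots> = (\<Sum>i\<in>{0..<card G}. hausdorff_gauge d (C (h i)))"
    by (auto simp: C'_def lessThan_atLeast0 intro!: sum.cong)
  also have "\<dots> = (\<Sum>g\<in>G. hausdorff_gauge d (C g))"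
    by (rule sum.reindex_bij_betw[OF h])
  finally show ?thesis .
qed

section \<open>Finiteness and positivity of the area of a flat cube\<close>

definition flat_cube :: "'n \<Rightarrow> real \<Rightarrow> (real ^ 'n) set" where
  "flat_cube k R = {x. x $ k = 0 \<and> (\<forall>i. \<bar>x $ i\<bar> \<le> R)}"

lemma area_flat_cube_finite:
  assumes "0 < R"
  shows "area (flat_cube (k :: 'n::finite) R) < \<infinity>"
proof -
  let ?n = "real CARD('n)" and ?d = "CARD('n) - 1"
  \<comment> \<open>A grid of \<open>(m + 1) ^ ?d\<close> cells with half diameter at most
    \<open>?n * R / m\<close> has total gauge at most this, for every \<open>m\<close>, since
    \<open>(m + 1) / m \<le> 2\<close>.\<close>
  define K where "K = unit_ball_vol (real ?d) * (2 * ?n * R) ^ ?d"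
  have pre: "hausdorff_premeasure ?d \<delta> (flat_cube k R) \<le> ennreal K" if "0 < \<delta>" for \<delta>
  proof -
    obtain m :: nat where m: "?n * (2 * R) / \<delta> < real m" using reals_Archimedean2 by blast
    have "0 < ?n * (2 * R) / \<delta>" using assms that by simp
    then have "real m > 0" using m by linarith
    have small: "?n * (2 * R / m) \<le> \<delta>" using m that \<open>real m > 0\<close> by (simp add: field_simps)
    \<comment> \<open>Cell indices run from 0 to \<open>m\<close> inclusive, because the upper end
      \<open>x $ i = R\<close> gives index \<open>m\<close>. The coordinate \<open>k\<close> is
      constant on the flat cube and needs one index.\<close>
    define G where "G = PiE (UNIV :: 'n set) (\<lambda>i. if i = k then {0} else {..m})"
    have "finite G" unfolding G_def by (rule finite_PiE) auto
    have cardG: "card G = (m + 1) ^ ?d"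
    proof -
      have "card G = (\<Prod>i\<in>UNIV. if i = k then 1 else m + 1)"
        unfolding G_def by (simp add: card_PiE if_distrib cong: if_cong)
      also have "\<dots> = (\<Prod>i\<in>UNIV - {k}. m + 1)"
        by (subst prod.remove[of UNIV k]) auto
      finally show ?thesis by simp
    qed
    define C where "C g = {x \<in> flat_cube k R. \<forall>i. i \<noteq> k \<longrightarrow> - R + 2 * R * real (g i) / m \<le> x $ i \<and> x $ i \<le> - R + 2 * R * (real (g i) + 1) / m}" for g
    have bdd: "bounded (flat_cube k R)"
      unfolding bounded_iff
      by (rule exI[of _ "\<Sum>i\<in>(UNIV :: 'n set). R"]) (auto simp: flat_cube_def intro!: order_trans[OF norm_le_l1_cart] sum_mono simp del: sum_constant)
    have diam: "diameter (C g) \<le> ?n * (2 * R / m)" for g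
    proof (rule diameter_le)
      show "C g \<noteq> {} \<or> 0 \<le> ?n * (2 * R / m)" using assms by simp
      fix x y assume xy: "x \<in> C g" "y \<in> C g"
      have "\<bar>(x - y) $ i\<bar> \<le> 2 * R / m" for i
      proof (cases "i = k")
        case True
        then show ?thesis using xy assms by (simp add: C_def flat_cube_def)
      next
        case False
        have "2 * R * (real (g i) + 1) / m = 2 * R * real (g i) / m + 2 * R / m"
          by (simp add: distrib_left add_divide_distrib)
        moreover have "- R + 2 * R * real (g i) / m \<le> x $ i" "x $ i \<le> - R + 2 * R * (real (g i) + 1) / m"
          "- R + 2 * R * real (g i) / m \<le> y $ i" "y $ i \<le> - R + 2 * R * (real (g i) + 1) / m"
          using xy False by (auto simp: C_def)
        ultimately show ?thesis by (simp add: abs_le_iff)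
      qed
      then have "(\<Sum>i\<in>UNIV. \<bar>(x - y) $ i\<bar>) \<le> (\<Sum>i\<in>(UNIV :: 'n set). 2 * R / m)" by (intro sum_mono)
      then show "norm (x - y) \<le> ?n * (2 * R / m)"
        using norm_le_l1_cart[of "x - y"] by simp
    qed
    have "hausdorff_premeasure ?d \<delta> (flat_cube k R) \<le> (\<Sum>g\<in>G. hausdorff_gauge ?d (C g))"
    proof (rule hausdorff_premeasure_finite_cover[OF \<open>finite G\<close>])
      show "flat_cube k R \<subseteq> (\<Union>g\<in>G. C g)"
      proof
        fix x assume x: "x \<in> flat_cube k R"
        define t where "t i = (x $ i + R) * m / (2 * R)" for i
        define g where "g i = (if i = k then 0 else nat \<lfloor>t i\<rfloor>)" for i
        have xi: "\<bar>x $ i\<bar> \<le> R" for i using x by (auto simp: flat_cube_def)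
        have t0: "0 \<le> t i" for i using xi[of i] assms \<open>real m > 0\<close> by (auto simp: t_def)
        have "(x $ i + R) / (2 * R) \<le> 1" for i using xi[of i] assms by simp
        then have tm: "t i \<le> m" for i
          using mult_right_mono[of "(x $ i + R) / (2 * R)" 1 "real m"] by (simp add: t_def)
        have "nat \<lfloor>t i\<rfloor> \<le> m" for i using tm[of i] by (simp add: floor_le_iff nat_le_iff)
        then have "g \<in> G" by (auto simp: G_def g_def)
        have xt: "x $ i = - R + 2 * R * t i / m" for i using assms \<open>real m > 0\<close> by (simp add: t_def field_simps)
        have "- R + 2 * R * real (g i) / m \<le> x $ i \<and> x $ i \<le> - R + 2 * R * (real (g i) + 1) / m" if "i \<noteq> k" for i
        proof -
          have "real (g i) = of_int \<lfloor>t i\<rfloor>" using t0[of i] that by (simp add: g_def)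
          then have "real (g i) \<le> t i" "t i \<le> real (g i) + 1" by linarith+
          then show ?thesis unfolding xt using assms \<open>real m > 0\<close> by (auto intro!: divide_right_mono mult_left_mono)
        qed
        then have "x \<in> C g" using x by (simp add: C_def)
        with \<open>g \<in> G\<close> show "x \<in> (\<Union>g\<in>G. C g)" by blast
      qed
      show "bounded (C g)" for g by (rule bounded_subset[OF bdd]) (auto simp: C_def)
      show "diameter (C g) \<le> \<delta>" for g using diam[of g] small by simp
    qed (use that in auto)
    also have "\<dots> \<le> (\<Sum>g\<in>G. ennreal (unit_ball_vol (real ?d) * (?n * R / m) ^ ?d))"
    proof (rule sum_mono)
      fix g
      have "0 \<le> diameter (C g)" by (rule diameter_ge_0, rule bounded_subset[OF bdd]) (auto simp: C_def)
      moreover have "?n * (2 * R / m) = 2 * (?n * R / m)" by simp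
      then have "diameter (C g) / 2 \<le> ?n * R / m" using diam[of g] by linarith
      ultimately show "hausdorff_gauge ?d (C g) \<le> ennreal (unit_ball_vol (real ?d) * (?n * R / m) ^ ?d)"
        by (auto simp: hausdorff_gauge_def intro!: ennreal_leI mult_left_mono power_mono)
    qed
    also have "\<dots> = ennreal ((m + 1) ^ ?d * (unit_ball_vol (real ?d) * (?n * R / m) ^ ?d))"
      using assms by (simp add: cardG ennreal_of_nat_eq_real_of_nat ennreal_mult[symmetric])
    also have "\<dots> \<le> ennreal K"
    proof (rule ennreal_leI)
      have "(real m + 1) * (?n * R / m) \<le> 2 * ?n * R"
        using assms \<open>real m > 0\<close> by (simp add: field_simps)
      then have "((real m + 1) * (?n * R / m)) ^ ?d \<le> (2 * ?n * R) ^ ?d"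
        using assms by (intro power_mono) auto
      then have "unit_ball_vol (real ?d) * ((real m + 1) * (?n * R / m)) ^ ?d \<le> K"
        unfolding K_def by (intro mult_left_mono) auto
      moreover have "real ((m + 1) ^ ?d) * (unit_ball_vol (real ?d) * (?n * R / m) ^ ?d)
          = unit_ball_vol (real ?d) * ((real m + 1) * (?n * R / m)) ^ ?d"
        by (simp only: power_mult_distrib of_nat_power of_nat_add of_nat_1 mult_ac)
      ultimately show "real ((m + 1) ^ ?d) * (unit_ball_vol (real ?d) * (?n * R / m) ^ ?d) \<le> K"
        by (simp only:)
    qed
    finally show ?thesis .
  qed
  have "area (flat_cube k R) \<le> ennreal K"
    unfolding hausdorff_measure_def by (intro SUP_least pre) auto
  then show ?thesis by (simp add: le_less_trans ennreal_less_top)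
qed

text \<open>
  A set of diameter \<open>r\<close> lies in a cylinder of volume \<open>2 * (2 * r) ^ (n - 1)\<close>, so a cover of the
  flat cube by sets of small gauge would give a cover of the solid cube of small volume.
\<close>

lemma area_flat_cube_pos: "0 < area (flat_cube (k :: 'n::finite) 1)"
proof (rule ccontr)
  assume "\<not> ?thesis"
  let ?d = "CARD('n) - 1"
  \<comment> \<open>The ratio between the box volume \<open>2 * (2 * r) ^ ?d\<close> and the gauge
    of a set of diameter \<open>r\<close>. Total gauge below \<open>1 / (2 * K)\<close> would cover
    the solid cube by boxes of total volume at most \<open>1 / 2\<close>.\<close>
  define K where "K = 2 * 4 ^ ?d / unit_ball_vol (real ?d)"
  have ubv: "unit_ball_vol (real ?d) > 0" by simp
  have "K > 0" by (simp add: K_def)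
  have "hausdorff_premeasure ?d 1 (flat_cube k 1) \<le> area (flat_cube k 1)"
    by (rule hausdorff_premeasure_le_measure) simp
  with \<open>\<not> _\<close> have "hausdorff_premeasure ?d 1 (flat_cube k 1) < ennreal (1 / (2 * K))"
    using \<open>K > 0\<close> by (simp add: less_le_trans)
  then obtain C where C: "flat_cube k 1 \<subseteq> (\<Union>i. C i)" "\<And>i. bounded (C i)"
    and sum: "suminf (\<lambda>i. hausdorff_gauge ?d (C i)) < ennreal (1 / (2 * K))"
    unfolding hausdorff_premeasure_def INF_less_iff by blast
  define y where "y i = (SOME y. y \<in> C i)" for i
  define lo :: "nat \<Rightarrow> real ^ 'n" where "lo i = (\<chi> j. if j = k then - 1 else y i $ j - diameter (C i))" for i
  define hi :: "nat \<Rightarrow> real ^ 'n" where "hi i = (\<chi> j. if j = k then 1 else y i $ j + diameter (C i))" for i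
  define B where "B i = (if C i = {} then {} else cbox (lo i) (hi i))" for i
  have B_gauge: "emeasure lborel (B i) \<le> ennreal K * hausdorff_gauge ?d (C i)" for i
  proof (cases "C i = {}")
    case False
    have r: "0 \<le> diameter (C i)" by (rule diameter_ge_0[OF C(2)])
    have "lo i \<in> cbox (lo i) (hi i)" using r by (auto simp: mem_box_cart lo_def hi_def)
    then have "measure lborel (cbox (lo i) (hi i)) = (\<Prod>j\<in>UNIV. hi i $ j - lo i $ j)"
      by (intro content_cbox_cart) auto
    also have "\<dots> = (\<Prod>j\<in>UNIV. if j = k then 2 else 2 * diameter (C i))"
      by (intro prod.cong) (auto simp: lo_def hi_def)
    also have "\<dots> = 2 * (2 * diameter (C i)) ^ ?d"
      by (subst prod.remove[of UNIV k]) auto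
    also have "\<dots> = K * (unit_ball_vol (real ?d) * (diameter (C i) / 2) ^ ?d)"
    proof -
      have "(2 * diameter (C i)) ^ ?d = (4 * (diameter (C i) / 2)) ^ ?d" by simp
      also have "\<dots> = 4 ^ ?d * (diameter (C i) / 2) ^ ?d" by (rule power_mult_distrib)
      finally have "2 * (2 * diameter (C i)) ^ ?d = 2 * 4 ^ ?d * (diameter (C i) / 2) ^ ?d" by (simp only: mult.assoc)
      moreover have "K * unit_ball_vol (real ?d) = 2 * 4 ^ ?d"
        by (rule nonzero_eq_divide_eq[OF less_imp_neq[OF ubv, symmetric], THEN iffD1, OF K_def])
      ultimately show ?thesis by (simp only: mult.assoc[symmetric])
    qed
    finally have m: "measure lborel (cbox (lo i) (hi i)) = K * (unit_ball_vol (real ?d) * (diameter (C i) / 2) ^ ?d)" .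
    have "emeasure lborel (cbox (lo i) (hi i)) = ennreal (measure lborel (cbox (lo i) (hi i)))"
      by (rule emeasure_eq_ennreal_measure) (use emeasure_lborel_cbox_finite[of "lo i" "hi i"] in auto)
    also have "\<dots> = ennreal K * ennreal (unit_ball_vol (real ?d) * (diameter (C i) / 2) ^ ?d)"
      unfolding m using \<open>K > 0\<close> r by (intro ennreal_mult) auto
    finally show ?thesis
      using False by (simp add: B_def hausdorff_gauge_def)
  qed (simp add: B_def)
  have "cbox (\<chi> j. - 1) (\<chi> j. 1) \<subseteq> (\<Union>i. B i)"
  proof
    fix x :: "real ^ 'n" assume x: "x \<in> cbox (\<chi> j. - 1) (\<chi> j. 1)"
    define z where "z = (\<chi> j. if j = k then 0 else x $ j)"
    have x1: "- 1 \<le> x $ j" "x $ j \<le> 1" for j using x by (auto simp: mem_box_cart)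
    have "\<bar>x $ j\<bar> \<le> 1" for j using x1[of j] by linarith
    then have "z \<in> flat_cube k 1" by (simp add: z_def flat_cube_def)
    then obtain i where i: "z \<in> C i" using C(1) by blast
    then have "y i \<in> C i" unfolding y_def by (rule someI)
    then have "dist z (y i) \<le> diameter (C i)" using i by (intro diameter_bounded_bound C(2))
    then have *: "\<bar>z $ j - y i $ j\<bar> \<le> diameter (C i)" for j
      using component_le_norm_cart[of "z - y i" j] by (simp add: dist_norm)
    have "lo i $ j \<le> x $ j \<and> x $ j \<le> hi i $ j" for j
    proof (cases "j = k")
      case True
      then show ?thesis using x1 by (simp add: lo_def hi_def)
    next
      case False
      then have "\<bar>x $ j - y i $ j\<bar> \<le> diameter (C i)" using *[of j] by (simp add: z_def)
      then show ?thesis using False by (simp add: lo_def hi_def abs_le_iff)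
    qed
    then have "x \<in> B i" using i by (auto simp: B_def mem_box_cart)
    then show "x \<in> (\<Union>i. B i)" by blast
  qed
  then have "emeasure lborel (cbox (\<chi> j. (- 1 :: real)) (\<chi> j. 1) :: (real ^ 'n) set) \<le> emeasure lborel (\<Union>i. B i)"
    by (rule emeasure_mono) (auto simp: B_def)
  also have "\<dots> \<le> suminf (\<lambda>i. emeasure lborel (B i))"
    by (rule emeasure_subadditive_countably) (auto simp: B_def)
  also have "\<dots> \<le> suminf (\<lambda>i. ennreal K * hausdorff_gauge ?d (C i))"
    by (intro suminf_le summableI B_gauge)
  also have "\<dots> = ennreal K * suminf (\<lambda>i. hausdorff_gauge ?d (C i))"
    by simp
  also have "\<dots> \<le> ennreal K * ennreal (1 / (2 * K))"
    using sum by (intro mult_left_mono) auto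
  also have "\<dots> = ennreal (1 / 2)"
    using \<open>K > 0\<close> by (simp add: ennreal_mult[symmetric])
  finally have "emeasure lborel (cbox (\<chi> j. (- 1 :: real)) (\<chi> j. 1) :: (real ^ 'n) set) \<le> ennreal (1 / 2)" .
  then have le: "measure lborel (cbox (\<chi> j. (- 1 :: real)) (\<chi> j. 1) :: (real ^ 'n) set) \<le> 1 / 2"
    unfolding measure_def by (intro enn2real_leI) simp_all
  have "(0 :: real ^ 'n) \<in> cbox (\<chi> j. - 1) (\<chi> j. 1)" by (simp add: mem_box_cart)
  then have "measure lborel (cbox (\<chi> j. (- 1 :: real)) (\<chi> j. 1) :: (real ^ 'n) set) = (\<Prod>j\<in>(UNIV :: 'n set). 2)"
    by (subst content_cbox_cart) auto
  moreover have "(1 :: real) \<le> 2 ^ CARD('n)" by simp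
  ultimately show False using le by simp
qed

section \<open>Areas in hyperplanes and the stacked measure\<close>

lemma orthogonal_image_plane:
  assumes f: "orthogonal_transformation (f :: real ^ 'n \<Rightarrow> real ^ 'n)"
  shows "area (f ` A) = area A" and "f ` {x \<in> A. x \<bullet> u = \<tau>} = {x \<in> f ` A. x \<bullet> f u = \<tau>}"
proof -
  have "bij f" using f by (rule orthogonal_transformation_bij)
  show "area (f ` A) = area A"
  proof (rule hausdorff_measure_isometry)
    show "dist (f x) (f y) = dist x y" for x y using f unfolding orthogonal_transformation_isometry by blast
    show "inv_into UNIV f (f x) = x" for x using \<open>bij f\<close> by (simp add: bij_is_inj)
    show "f (inv_into UNIV f x) = x" for x using \<open>bij f\<close> by (simp add: bij_is_surj surj_f_inv_f)
  qed
  have "f x \<bullet> f u = x \<bullet> u" for x using f by (simp add: orthogonal_transformation_def)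
  then show "f ` {x \<in> A. x \<bullet> u = \<tau>} = {x \<in> f ` A. x \<bullet> f u = \<tau>}" by auto
qed

text \<open>A rotation taking \<open>u\<close> to a coordinate axis and a translation along that
  axis put the set into a flat cube.\<close>

lemma area_bounded_plane_finite:
  assumes "norm u = 1" "bounded A" "A \<subseteq> {x :: real ^ 'n. x \<bullet> u = \<tau>}"
  shows "area A < \<infinity>"
proof -
  fix k :: 'n
  have "norm u = norm (axis k 1 :: real ^ 'n)" using assms by simp
  then obtain f :: "real ^ 'n \<Rightarrow> real ^ 'n" where f: "orthogonal_transformation f" "f u = axis k 1"
    using orthogonal_transformation_exists by metis
  let ?A = "f ` A"
  have "bounded ?A"
    using assms(2) f(1) by (intro bounded_linear_image linear_conv_bounded_linear[THEN iffD1] orthogonal_transformation_linear)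
  then obtain R where R: "R > 0" "\<And>x. x \<in> ?A \<Longrightarrow> norm x \<le> R" using bounded_pos by metis
  have plane: "x $ k = \<tau>" if "x \<in> ?A" for x
  proof -
    have "A = {x \<in> A. x \<bullet> u = \<tau>}" using assms(3) by auto
    then have "x \<bullet> axis k 1 = \<tau>" using orthogonal_image_plane(2)[OF f(1), of A u \<tau>] that f(2) by auto
    then show ?thesis by (simp add: inner_axis)
  qed
  have "(+) (- \<tau> *\<^sub>R axis k 1) ` ?A \<subseteq> flat_cube k (R + 1)"
  proof
    fix x assume "x \<in> (+) (- \<tau> *\<^sub>R axis k 1) ` ?A"
    then obtain y where y: "y \<in> ?A" "x = y - \<tau> *\<^sub>R axis k 1" by auto
    have "x $ k = 0" using plane[OF y(1)] y by (simp add: axis_def)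
    moreover have "\<bar>x $ i\<bar> \<le> R + 1" for i
    proof (cases "i = k")
      case True
      then show ?thesis using \<open>x $ k = 0\<close> R by simp
    next
      case False
      then have "x $ i = y $ i" using y by (simp add: axis_def)
      then show ?thesis using component_le_norm_cart[of y i] R(2)[OF y(1)] by simp
    qed
    ultimately show "x \<in> flat_cube k (R + 1)" by (simp add: flat_cube_def)
  qed
  then have "area ((+) (- \<tau> *\<^sub>R axis k 1) ` ?A) \<le> area (flat_cube k (R + 1))" by (rule hausdorff_measure_mono)
  also have "\<dots> < \<infinity>" by (rule area_flat_cube_finite) (use R in simp)
  finally show ?thesis by (simp only: hausdorff_measure_translation orthogonal_image_plane(1)[OF f(1)])
qed

text \<open>Hausdorff measure of dimension n - 1 is not sigma-finite on the whole space. Restricted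
  to one hyperplane it is, and Fubini becomes available.\<close>

definition plane_area :: "real ^ 'n \<Rightarrow> (real ^ 'n) measure" where
  "plane_area u = density (hausdorff (CARD('n) - 1)) (indicator {x. x \<bullet> u = 0})"

lemma sets_plane_area [simp, measurable_cong]: "sets (plane_area u) = sets borel"
  by (simp add: plane_area_def)

lemma space_plane_area [simp]: "space (plane_area u) = UNIV"
  by (simp add: plane_area_def)

lemma plane_borel [measurable]: "{x. x \<bullet> u = \<tau>} \<in> sets (borel :: (real ^ 'n) measure)"
  by measurable

lemma emeasure_plane_area:
  assumes "A \<in> sets borel"
  shows "emeasure (plane_area u) A = area {x \<in> A. x \<bullet> u = 0}"
proof -
  have "emeasure (plane_area u) A = emeasure (hausdorff (CARD('a) - 1)) ({x. x \<bullet> u = 0} \<inter> A)"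
    unfolding plane_area_def using assms
    by (subst emeasure_density) (auto simp: indicator_inter_arith[symmetric] nn_integral_indicator)
  also have "{x. x \<bullet> u = 0} \<inter> A = {x \<in> A. x \<bullet> u = 0}" by auto
  finally show ?thesis using assms by (subst (asm) emeasure_hausdorff) auto
qed

lemma emeasure_plane_area_translate:
  assumes "A \<in> sets borel" "norm u = 1"
  shows "emeasure (plane_area u) {x. x + \<tau> *\<^sub>R u \<in> A} = area {x \<in> A. x \<bullet> u = \<tau>}"
proof -
  have uu: "u \<bullet> u = 1" using assms(2) by (simp add: dot_square_norm)
  have "{x. x + \<tau> *\<^sub>R u \<in> A} \<in> sets borel"
    using measurable_sets[of "\<lambda>x. x + \<tau> *\<^sub>R u" borel borel A] assms(1) by (simp add: vimage_def)
  then have "emeasure (plane_area u) {x. x + \<tau> *\<^sub>R u \<in> A} = area {x. x + \<tau> *\<^sub>R u \<in> A \<and> x \<bullet> u = 0}"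
    by (subst emeasure_plane_area) auto
  also have "\<dots> = area ((+) (\<tau> *\<^sub>R u) ` {x. x + \<tau> *\<^sub>R u \<in> A \<and> x \<bullet> u = 0})"
    by (simp only: hausdorff_measure_translation)
  also have "(+) (\<tau> *\<^sub>R u) ` {x. x + \<tau> *\<^sub>R u \<in> A \<and> x \<bullet> u = 0} = {x \<in> A. x \<bullet> u = \<tau>}"
  proof (intro equalityI subsetI)
    fix x assume "x \<in> {x \<in> A. x \<bullet> u = \<tau>}"
    then have "x - \<tau> *\<^sub>R u \<in> {x. x + \<tau> *\<^sub>R u \<in> A \<and> x \<bullet> u = 0}" by (simp add: inner_diff_left uu)
    then show "x \<in> (+) (\<tau> *\<^sub>R u) ` {x. x + \<tau> *\<^sub>R u \<in> A \<and> x \<bullet> u = 0}"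
      by (intro image_eqI[of _ _ "x - \<tau> *\<^sub>R u"]) auto
  qed (auto simp: inner_add_left uu add.commute)
  finally show ?thesis .
qed

lemma sigma_finite_plane_area:
  assumes "norm u = 1"
  shows "sigma_finite_measure (plane_area u)"
proof
  have "emeasure (plane_area u) (cball 0 (real n)) \<noteq> \<infinity>" for n
  proof -
    have "area {x \<in> cball 0 (real n). x \<bullet> u = 0} < \<infinity>"
      by (rule area_bounded_plane_finite[OF assms bounded_subset[OF bounded_cball[of 0 "real n"]]]) auto
    moreover have "emeasure (plane_area u) (cball 0 (real n)) = area {x \<in> cball 0 (real n). x \<bullet> u = 0}"
      by (rule emeasure_plane_area) simp
    ultimately show ?thesis by (metis less_irrefl)
  qed
  moreover have "(\<Union>n::nat. cball 0 (real n)) = (UNIV :: (real ^ 'a) set)"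
    using real_arch_simple by auto
  ultimately show "\<exists>A. countable A \<and> A \<subseteq> sets (plane_area u) \<and> \<Union>A = space (plane_area u) \<and> (\<forall>a\<in>A. emeasure (plane_area u) a \<noteq> \<infinity>)"
    by (intro exI[of _ "range (\<lambda>n::nat. cball 0 (real n))"]) auto
qed

lemma plane_area_translation:
  assumes "v \<bullet> u = 0"
  shows "distr (plane_area u) borel ((+) v) = plane_area u"
proof (rule measure_eqI)
  fix A assume "A \<in> sets (distr (plane_area u) borel ((+) v))"
  then have A: "A \<in> sets borel" by simp
  have "emeasure (distr (plane_area u) borel ((+) v)) A = emeasure (plane_area u) {x. v + x \<in> A}"
    using A by (subst emeasure_distr) (auto simp: vimage_def)
  also have "\<dots> = area {x. v + x \<in> A \<and> x \<bullet> u = 0}"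
    using measurable_sets[of "\<lambda>x. v + x" borel borel A] A
    by (subst emeasure_plane_area) (auto simp: vimage_def)
  also have "\<dots> = area ((+) v ` {x. v + x \<in> A \<and> x \<bullet> u = 0})"
    by (simp only: hausdorff_measure_translation)
  also have "(+) v ` {x. v + x \<in> A \<and> x \<bullet> u = 0} = {x \<in> A. x \<bullet> u = 0}"
  proof (intro equalityI subsetI)
    fix x assume "x \<in> {x \<in> A. x \<bullet> u = 0}"
    then show "x \<in> (+) v ` {x. v + x \<in> A \<and> x \<bullet> u = 0}"
      by (intro image_eqI[of _ _ "x - v"]) (auto simp: inner_diff_left assms)
  qed (auto simp: inner_add_left assms)
  also have "area {x \<in> A. x \<bullet> u = 0} = emeasure (plane_area u) A"
    by (rule emeasure_plane_area[OF A, symmetric])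
  finally show "emeasure (distr (plane_area u) borel ((+) v)) A = emeasure (plane_area u) A" .
qed simp

text \<open>Copies of the hyperplane measure piled up along \<open>u\<close>, so that a Borel set is
  measured by integrating the areas of its slices. Invariance under translations will identify it
  with a multiple of Lebesgue measure.\<close>

definition stacked :: "real ^ 'n \<Rightarrow> (real ^ 'n) measure" where
  "stacked u = distr (plane_area u \<Otimes>\<^sub>M lborel) borel (\<lambda>z. fst z + snd z *\<^sub>R u)"

lemma sets_stacked [simp, measurable_cong]: "sets (stacked u) = sets borel"
  by (simp add: stacked_def)

lemma space_stacked [simp]: "space (stacked u) = UNIV"
  by (simp add: stacked_def)

lemma nn_integral_stacked:
  assumes "norm u = 1" and [measurable]: "f \<in> borel_measurable borel"
  shows "(\<integral>\<^sup>+x. f x \<partial>stacked u) = (\<integral>\<^sup>+\<tau>. \<integral>\<^sup>+x. f (x + \<tau> *\<^sub>R u) \<partial>plane_area u \<partial>lborel)"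
proof -
  interpret sigma_finite_measure "plane_area u" by (rule sigma_finite_plane_area[OF assms(1)])
  interpret P: pair_sigma_finite "plane_area u" lborel ..
  have "(\<integral>\<^sup>+x. f x \<partial>stacked u) = (\<integral>\<^sup>+z. f (fst z + snd z *\<^sub>R u) \<partial>(plane_area u \<Otimes>\<^sub>M lborel))"
    unfolding stacked_def by (rule nn_integral_distr) measurable
  also have "\<dots> = (\<integral>\<^sup>+\<tau>. \<integral>\<^sup>+x. f (x + \<tau> *\<^sub>R u) \<partial>plane_area u \<partial>lborel)"
    by (subst P.nn_integral_snd[symmetric]) simp_all
  finally show ?thesis .
qed

lemma emeasure_stacked:
  assumes "norm u = 1" "A \<in> sets borel"
  shows "emeasure (stacked u) A = (\<integral>\<^sup>+\<tau>. area {x \<in> A. x \<bullet> u = \<tau>} \<partial>lborel)"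
proof -
  have "emeasure (stacked u) A = (\<integral>\<^sup>+\<tau>. \<integral>\<^sup>+x. indicator A (x + \<tau> *\<^sub>R u) \<partial>plane_area u \<partial>lborel)"
    using assms by (subst nn_integral_stacked[symmetric]) auto
  moreover have "(\<integral>\<^sup>+x. indicator A (x + \<tau> *\<^sub>R u) \<partial>plane_area u) = area {x \<in> A. x \<bullet> u = \<tau>}" for \<tau>
  proof -
    have "{x. x + \<tau> *\<^sub>R u \<in> A} \<in> sets (plane_area u)"
      using measurable_sets[of "\<lambda>x. x + \<tau> *\<^sub>R u" borel borel A] assms by (simp add: vimage_def)
    have "(\<integral>\<^sup>+x. indicator A (x + \<tau> *\<^sub>R u) \<partial>plane_area u)
        = (\<integral>\<^sup>+x. indicator {x. x + \<tau> *\<^sub>R u \<in> A} x \<partial>plane_area u)"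
      by (intro nn_integral_cong) (simp add: indicator_def)
    also have "\<dots> = emeasure (plane_area u) {x. x + \<tau> *\<^sub>R u \<in> A}"
      by (rule nn_integral_indicator) fact
    also have "\<dots> = area {x \<in> A. x \<bullet> u = \<tau>}"
      using assms by (intro emeasure_plane_area_translate)
    finally show ?thesis .
  qed
  ultimately show ?thesis by simp
qed

text \<open>The part of \<open>w\<close> orthogonal to \<open>u\<close> acts inside the hyperplanes,
  where area is invariant; the part along \<open>u\<close> shifts the height, where Lebesgue measure
  is invariant.\<close>

lemma stacked_translation:
  assumes u: "norm u = 1" and f [measurable]: "f \<in> borel_measurable borel"
  shows "(\<integral>\<^sup>+x. f (x + w) \<partial>stacked u) = (\<integral>\<^sup>+x. f x \<partial>stacked u)"
proof -
  interpret sigma_finite_measure "plane_area u" by (rule sigma_finite_plane_area[OF u])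
  define s where "s = w \<bullet> u"
  define v where "v = w - s *\<^sub>R u"
  have v: "v \<bullet> u = 0" using u by (simp add: v_def s_def inner_diff_left dot_square_norm)
  have inner: "(\<integral>\<^sup>+x. g (v + x) \<partial>plane_area u) = (\<integral>\<^sup>+x. g x \<partial>plane_area u)"
    if [measurable]: "g \<in> borel_measurable borel" for g
    by (subst (2) plane_area_translation[OF v, symmetric]) (simp add: nn_integral_distr)
  have "(\<integral>\<^sup>+x. f (x + w) \<partial>stacked u) = (\<integral>\<^sup>+\<tau>. \<integral>\<^sup>+x. f (v + x + (s + \<tau>) *\<^sub>R u) \<partial>plane_area u \<partial>lborel)"
    by (subst nn_integral_stacked[OF u]) (auto simp: v_def algebra_simps)
  also have "\<dots> = (\<integral>\<^sup>+\<tau>. \<integral>\<^sup>+x. f (x + (s + \<tau>) *\<^sub>R u) \<partial>plane_area u \<partial>lborel)"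
    by (intro nn_integral_cong inner) measurable
  also have "\<dots> = (\<integral>\<^sup>+\<tau>. \<integral>\<^sup>+x. f (x + \<tau> *\<^sub>R u) \<partial>plane_area u \<partial>distr lborel borel ((+) s))"
    by (subst nn_integral_distr) auto
  also have "\<dots> = (\<integral>\<^sup>+x. f x \<partial>stacked u)"
    by (simp add: lborel_distr_plus nn_integral_stacked[OF u])
  finally show ?thesis .
qed

text \<open>By Pythagoras, the slice of a ball at height \<open>\<tau>\<close> translates into the
  central slice, and it is empty for heights beyond \<open>R\<close>.\<close>

lemma sigma_finite_stacked:
  assumes u: "norm u = 1"
  shows "sigma_finite_measure (stacked u)" and "emeasure (stacked u) (cball 0 R) < \<infinity>"
proof -
  have fin: "emeasure (stacked u) (cball 0 R) < \<infinity>" for R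
  proof -
    have "emeasure (stacked u) (cball 0 R) = (\<integral>\<^sup>+\<tau>. area {x \<in> cball 0 R. x \<bullet> u = \<tau>} \<partial>lborel)"
      by (rule emeasure_stacked[OF u]) simp
    also have "\<dots> \<le> (\<integral>\<^sup>+\<tau>. area {x \<in> cball 0 R. x \<bullet> u = 0} * indicator {-R..R} \<tau> \<partial>lborel)"
    proof (rule nn_integral_mono)
      fix \<tau> :: real
      have uu: "u \<bullet> u = 1" using u by (simp add: dot_square_norm)
      have sub: "x - \<tau> *\<^sub>R u \<in> {x \<in> cball 0 R. x \<bullet> u = 0} \<and> \<bar>\<tau>\<bar> \<le> R" if "x \<in> cball 0 R" "x \<bullet> u = \<tau>" for x
      proof -
        have "(norm x)\<^sup>2 = (norm (x - \<tau> *\<^sub>R u))\<^sup>2 + \<tau>\<^sup>2"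
          unfolding power2_norm_eq_inner using that(2) uu
          by (simp add: inner_diff_left inner_diff_right inner_commute power2_eq_square algebra_simps)
        then have "(norm (x - \<tau> *\<^sub>R u))\<^sup>2 \<le> (norm x)\<^sup>2" "\<bar>\<tau>\<bar>\<^sup>2 \<le> (norm x)\<^sup>2" by auto
        then have "norm (x - \<tau> *\<^sub>R u) \<le> norm x" "\<bar>\<tau>\<bar> \<le> norm x" by (auto intro: power2_le_imp_le)
        then show ?thesis using that uu by (auto simp: inner_diff_left)
      qed
      show "area {x \<in> cball 0 R. x \<bullet> u = \<tau>} \<le> area {x \<in> cball 0 R. x \<bullet> u = 0} * indicator {-R..R} \<tau>"
      proof (cases "\<bar>\<tau>\<bar> \<le> R")
        case True
        have "area {x \<in> cball 0 R. x \<bullet> u = \<tau>} = area ((+) (- \<tau> *\<^sub>R u) ` {x \<in> cball 0 R. x \<bullet> u = \<tau>})"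
          by (simp only: hausdorff_measure_translation)
        also have "\<dots> \<le> area {x \<in> cball 0 R. x \<bullet> u = 0}"
          by (rule hausdorff_measure_mono) (use sub in auto)
        finally show ?thesis using True by (simp add: indicator_def abs_le_iff minus_le_iff)
      next
        case False
        then have "{x \<in> cball 0 R. x \<bullet> u = \<tau>} = {}" using sub by blast
        then show ?thesis by (simp only: hausdorff_measure_empty zero_le)
      qed
    qed
    also have "\<dots> = area {x \<in> cball 0 R. x \<bullet> u = 0} * emeasure lborel {-R..R}"
      by (simp add: nn_integral_cmult)
    also have "\<dots> < \<infinity>"
    proof -
      have "area {x \<in> cball 0 R. x \<bullet> u = 0} < \<infinity>"
        by (rule area_bounded_plane_finite[OF u bounded_subset[OF bounded_cball[of 0 R]]]) auto
      moreover have "emeasure lborel {-R..R} < \<infinity>" by (cases "0 \<le> R") auto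
      ultimately show ?thesis by (simp add: ennreal_mult_less_top)
    qed
    finally show ?thesis .
  qed
  then show "emeasure (stacked u) (cball 0 R) < \<infinity>" .
  have "(\<Union>n::nat. cball 0 (real n)) = (UNIV :: (real ^ 'a) set)"
    using real_arch_simple by auto
  then show "sigma_finite_measure (stacked u)"
    using fin by (intro sigma_finite_measure.intro exI[of _ "range (\<lambda>n::nat. cball 0 (real n))"]) (auto simp: less_top)
qed

text \<open>Uniqueness of translation invariant measures, by Fubini and the substitution \<open>y \<mapsto> y - x\<close>.\<close>

lemma stacked_proportional:
  fixes u :: "real ^ 'n"
  assumes u: "norm u = 1" and [measurable]: "A \<in> sets borel" "B \<in> sets borel" and sym: "\<And>x. - x \<in> B \<longleftrightarrow> x \<in> B"
  shows "emeasure (stacked u) A * emeasure lborel B = emeasure lborel A * emeasure (stacked u) B"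
proof -
  interpret S: sigma_finite_measure "stacked u" by (rule sigma_finite_stacked[OF u])
  interpret P: pair_sigma_finite "stacked u" "lborel :: (real ^ 'n) measure" ..
  have [simp]: "sets (stacked u \<Otimes>\<^sub>M (lborel :: (real ^ 'n) measure)) = sets (borel \<Otimes>\<^sub>M borel)"
    by (rule sets_pair_measure_cong) auto
  have shift: "(\<integral>\<^sup>+y. f (y + x) \<partial>lborel) = (\<integral>\<^sup>+y. f y \<partial>lborel)" if [measurable]: "f \<in> borel_measurable borel"
    for f and x :: "real ^ 'n"
    by (subst (2) lborel_distr_plus[of x, symmetric], subst nn_integral_distr) (auto simp: add.commute)
  have "emeasure (stacked u) A * emeasure lborel B
      = (\<integral>\<^sup>+x. indicator A x * emeasure lborel B \<partial>stacked u)"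
    by (simp add: nn_integral_multc)
  also have "\<dots> = (\<integral>\<^sup>+x. \<integral>\<^sup>+y. indicator A x * indicator B y \<partial>lborel \<partial>stacked u)"
    by (simp add: nn_integral_cmult)
  also have "\<dots> = (\<integral>\<^sup>+x. \<integral>\<^sup>+y. indicator A x * indicator B (y + (- x)) \<partial>lborel \<partial>stacked u)"
    by (intro nn_integral_cong shift[symmetric]) measurable
  also have "\<dots> = (\<integral>\<^sup>+y. \<integral>\<^sup>+x. indicator A x * indicator B (y + (- x)) \<partial>stacked u \<partial>lborel)"
    by (rule P.Fubini'[symmetric]) measurable
  also have "\<dots> = (\<integral>\<^sup>+y. \<integral>\<^sup>+x. indicator A (x + y) * indicator B (y + (- (x + y))) \<partial>stacked u \<partial>lborel)"
    by (intro nn_integral_cong stacked_translation[OF u, symmetric]) measurable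
  \<comment> \<open>The argument of the second indicator has become \<open>- x\<close>, and symmetry
    of \<open>B\<close> removes the sign.\<close>
  also have "\<dots> = (\<integral>\<^sup>+y. \<integral>\<^sup>+x. indicator A (y + x) * indicator B x \<partial>stacked u \<partial>lborel)"
    by (intro nn_integral_cong) (simp add: indicator_def sym add.commute)
  also have "\<dots> = (\<integral>\<^sup>+x. \<integral>\<^sup>+y. indicator A (y + x) * indicator B x \<partial>lborel \<partial>stacked u)"
    by (rule P.Fubini') measurable
  also have "\<dots> = (\<integral>\<^sup>+x. emeasure lborel A * indicator B x \<partial>stacked u)"
  proof (rule nn_integral_cong)
    fix x
    have "(\<integral>\<^sup>+y. indicator A (y + x) * indicator B x \<partial>lborel) = (\<integral>\<^sup>+y. indicator A (y + x) \<partial>lborel) * indicator B x"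
      by (rule nn_integral_multc) measurable
    also have "(\<integral>\<^sup>+y. indicator A (y + x) \<partial>lborel) = emeasure lborel A"
      by (subst shift) auto
    finally show "(\<integral>\<^sup>+y. indicator A (y + x) * indicator B x \<partial>lborel) = emeasure lborel A * indicator B x" .
  qed
  also have "\<dots> = emeasure lborel A * emeasure (stacked u) B"
    by (simp add: nn_integral_cmult)
  finally show ?thesis .
qed

text \<open>The value of the constant, one for the normalization of Hausdorff measure in use, is irrelevant.\<close>

theorem area_slices:
  "\<exists>c>0. \<forall>u :: real ^ 'n. norm u = 1 \<longrightarrow> (\<forall>A\<in>sets borel.
     (\<integral>\<^sup>+\<tau>. area {x \<in> A. x \<bullet> u = \<tau>} \<partial>lborel) = ennreal c * emeasure lborel A)"
proof -
  fix k :: 'n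
  let ?B = "cball (0 :: real ^ 'n) 1" and ?e = "axis k 1 :: real ^ 'n"
  have e: "norm ?e = 1" by simp
  define c where "c = enn2real (emeasure (stacked ?e) ?B) / measure lborel ?B"
  have B_pos: "measure lborel ?B > 0"
    using content_cball_pos[of 1 "0 :: real ^ 'n"] by simp
  have B_eq: "emeasure lborel ?B = ennreal (measure lborel ?B)"
    by (rule emeasure_eq_ennreal_measure) (use emeasure_lborel_cball_finite[of "0 :: real ^ 'n" 1] in auto)
  \<comment> \<open>The constant does not depend on \<open>u\<close>: a rotation taking
    \<open>u\<close> to \<open>?e\<close> preserves the ball and the areas of its slices.\<close>
  have SB: "emeasure (stacked u) ?B = emeasure (stacked ?e) ?B" if u: "norm u = 1" for u
  proof -
    have "norm u = norm ?e" using u by simp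
    then obtain f :: "real ^ 'n \<Rightarrow> real ^ 'n" where f: "orthogonal_transformation f" "f u = ?e"
      using orthogonal_transformation_exists by metis
    have "f ` ?B = ?B" using image_orthogonal_transformation_cball[OF f(1), of 0 1] linear_0[OF orthogonal_transformation_linear[OF f(1)]] by simp
    then have "area {x \<in> ?B. x \<bullet> u = \<tau>} = area {x \<in> ?B. x \<bullet> ?e = \<tau>}" for \<tau>
      using orthogonal_image_plane[OF f(1), of "{x \<in> ?B. x \<bullet> u = \<tau>}"] orthogonal_image_plane(2)[OF f(1), of ?B u \<tau>] f(2)
      by simp
    then show ?thesis using emeasure_stacked[OF u, of ?B] emeasure_stacked[OF e, of ?B] by simp
  qed
  have scale: "emeasure (stacked u) A = ennreal c * emeasure lborel A" if u: "norm u = 1" and A: "A \<in> sets borel" for u :: "real ^ 'n" and A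
  proof -
    have "emeasure (stacked u) A * ennreal (measure lborel ?B) = emeasure lborel A * emeasure (stacked ?e) ?B"
      using stacked_proportional[OF u A, of ?B] SB[OF u] B_eq by simp
    also have "emeasure (stacked ?e) ?B = ennreal (c * measure lborel ?B)"
      using sigma_finite_stacked(2)[OF e, of 1] B_pos by (simp add: c_def ennreal_enn2real less_top)
    also have "\<dots> = ennreal c * ennreal (measure lborel ?B)"
      using B_pos by (intro ennreal_mult) (auto simp: c_def)
    finally have "emeasure (stacked u) A * ennreal (measure lborel ?B) = (ennreal c * emeasure lborel A) * ennreal (measure lborel ?B)"
      by (simp add: ac_simps)
    then show ?thesis
      using B_pos mult_divide_eq_ennreal[of "ennreal (measure lborel ?B)"] by (metis ennreal_eq_0_iff ennreal_neq_top not_le)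
  qed
  have "c \<noteq> 0"
  proof
    assume "c = 0"
    \<comment> \<open>The solid cube, whose slices at heights between -1 and 1 contain a translate
      of the flat cube of positive area. With \<open>c = 0\<close> almost all slices would have area
      0.\<close>
    let ?S = "{x :: real ^ 'n. \<forall>i. \<bar>x $ i\<bar> \<le> 1}"
    have S: "?S \<in> sets borel" by measurable
    have le: "area (flat_cube k 1) * indicator {-1..1} \<tau> \<le> area {x \<in> ?S. x \<bullet> ?e = \<tau>}" for \<tau>
    proof (cases "\<bar>\<tau>\<bar> \<le> 1")
      case True
      have "(+) (\<tau> *\<^sub>R ?e) ` flat_cube k 1 \<subseteq> {x \<in> ?S. x \<bullet> ?e = \<tau>}"
        using True by (auto simp: flat_cube_def inner_axis) (auto simp: axis_def)
      then have "area ((+) (\<tau> *\<^sub>R ?e) ` flat_cube k 1) \<le> area {x \<in> ?S. x \<bullet> ?e = \<tau>}"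
        by (rule hausdorff_measure_mono)
      then show ?thesis by (simp add: hausdorff_measure_translation indicator_def)
    next
      case False
      then show ?thesis by (auto simp: indicator_def)
    qed
    have "area (flat_cube k 1) * emeasure lborel {-1..1::real} = (\<integral>\<^sup>+\<tau>. area (flat_cube k 1) * indicator {-1..1::real} \<tau> \<partial>lborel)"
      by (rule nn_integral_cmult_indicator[symmetric]) simp
    also have "\<dots> \<le> (\<integral>\<^sup>+\<tau>. area {x \<in> ?S. x \<bullet> ?e = \<tau>} \<partial>lborel)"
      by (intro nn_integral_mono le)
    also have "\<dots> = 0" using scale[OF e S] emeasure_stacked[OF e S] \<open>c = 0\<close> by simp
    finally show False using area_flat_cube_pos[of k] by simp
  qed
  then have "c > 0" unfolding c_def using B_pos by (simp add: less_le enn2real_nonneg)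
  moreover have "(\<integral>\<^sup>+\<tau>. area {x \<in> A. x \<bullet> u = \<tau>} \<partial>lborel) = ennreal c * emeasure lborel A"
    if "norm u = 1" "A \<in> sets borel" for u :: "real ^ 'n" and A
    by (rule trans[OF emeasure_stacked[OF that, symmetric] scale[OF that]])
  ultimately show ?thesis by blast
qed

text \<open>Let \<open>w\<close> be the part of \<open>v\<close> orthogonal to \<open>u\<close>. A
  hyperplane normal to \<open>w\<close> is a Lebesgue null set, so its slices by \<open>u\<close>
  have integral 0. All these slices are translates of the given intersection, hence of equal
  area.\<close>

lemma area_codimension_2:
  fixes u v :: "real ^ 'n"
  assumes u: "norm u = 1" and v: "norm v = 1" and "v \<noteq> u" "v \<noteq> - u"
  shows "area {x. x \<bullet> u = a \<and> x \<bullet> v = b} = 0"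
proof -
  let ?L = "{x. x \<bullet> u = a \<and> x \<bullet> v = b}"
  define w where "w = v - (u \<bullet> v) *\<^sub>R u"
  have uu: "u \<bullet> u = 1" "v \<bullet> v = 1" using u v by (simp_all add: dot_square_norm)
  have wu: "w \<bullet> u = 0" by (simp add: w_def inner_diff_left uu inner_commute[of v u])
  then have uw: "u \<bullet> w = 0" by (simp add: inner_commute)
  have w_eq: "z \<bullet> w = z \<bullet> v - (u \<bullet> v) * (z \<bullet> u)" for z by (simp add: w_def inner_diff_right)
  have "w \<noteq> 0"
  proof
    assume "w = 0"
    then have v_eq: "v = (u \<bullet> v) *\<^sub>R u" by (simp add: w_def)
    then have "v \<bullet> v = (u \<bullet> v)\<^sup>2" using uu by (metis inner_commute inner_scaleR_left power2_eq_square)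
    then have "u \<bullet> v = 1 \<or> u \<bullet> v = - 1" using uu by (simp add: power2_eq_1_iff)
    with v_eq assms show False by (metis scaleR_minus1_left scaleR_one)
  qed
  define A where "A = {x. x \<bullet> w = b - (u \<bullet> v) * a}"
  have A: "A \<in> sets borel" unfolding A_def by measurable
  have "negligible A" unfolding A_def using negligible_hyperplane[of w] \<open>w \<noteq> 0\<close> by (simp add: inner_commute)
  then have "emeasure lborel A = 0"
    using A by (simp add: negligible_iff_emeasure0 emeasure_completion)
  moreover obtain c where "\<forall>A\<in>sets borel. (\<integral>\<^sup>+\<tau>. area {x \<in> A. x \<bullet> u = \<tau>} \<partial>lborel) = ennreal c * emeasure lborel A"
    using area_slices u by blast
  ultimately have "(\<integral>\<^sup>+\<tau>. area {x \<in> A. x \<bullet> u = \<tau>} \<partial>lborel) = 0" using A by simp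
  moreover have "area {x \<in> A. x \<bullet> u = \<tau>} = area ?L" for \<tau>
  proof -
    have "(+) ((\<tau> - a) *\<^sub>R u) ` ?L = {x \<in> A. x \<bullet> u = \<tau>}"
    proof (intro equalityI subsetI)
      fix x assume x: "x \<in> {x \<in> A. x \<bullet> u = \<tau>}"
      let ?y = "x - (\<tau> - a) *\<^sub>R u"
      have yu: "?y \<bullet> u = a" using x uu by (simp add: inner_diff_left)
      have "?y \<bullet> w = b - (u \<bullet> v) * a" using x uw by (simp add: A_def inner_diff_left)
      then have "?y \<bullet> v = b" unfolding w_eq yu by simp
      then show "x \<in> (+) ((\<tau> - a) *\<^sub>R u) ` ?L" using yu by (intro image_eqI[of _ _ ?y]) auto
    next
      fix x assume "x \<in> (+) ((\<tau> - a) *\<^sub>R u) ` ?L"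
      then obtain y where y: "y \<bullet> u = a" "y \<bullet> v = b" "x = (\<tau> - a) *\<^sub>R u + y" by auto
      have "y \<bullet> w = b - (u \<bullet> v) * a" using y by (simp add: w_def inner_diff_right)
      then show "x \<in> {x \<in> A. x \<bullet> u = \<tau>}" using y uw uu by (simp add: A_def inner_add_left)
    qed
    from this[symmetric] show ?thesis by (simp only: hausdorff_measure_translation)
  qed
  ultimately have "(\<integral>\<^sup>+(\<tau>::real). area ?L \<partial>lborel) = 0" by simp
  then show ?thesis by (simp add: ennreal_mult_eq_top_iff)
qed

section \<open>Polytopes with prescribed normals\<close>

declare One_nat_def [simp del]

section \<open>Positive hulls and separation\<close>

lemma pos_hull_mono:
  assumes "finite W" "V \<subseteq> W"
  shows "pos_hull V \<subseteq> pos_hull W"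
proof
  fix x assume "x \<in> pos_hull V"
  then obtain c where c: "\<forall>v\<in>V. 0 \<le> c v" "x = (\<Sum>v\<in>V. c v *\<^sub>R v)" by (auto simp: pos_hull_def)
  have "x = (\<Sum>v\<in>W. (if v \<in> V then c v else 0) *\<^sub>R v)"
    unfolding c(2) using assms by (intro sum.mono_neutral_cong_left) auto
  then show "x \<in> pos_hull W"
    unfolding pos_hull_def using c(1) by (intro CollectI exI[of _ "\<lambda>v. if v \<in> V then c v else 0"]) auto
qed

lemma convex_pos_hull: "convex (pos_hull V)"
proof (rule convexI)
  fix x y and a b :: real assume "x \<in> pos_hull V" "y \<in> pos_hull V" "0 \<le> a" "0 \<le> b"
  then obtain c d where c: "\<forall>v\<in>V. 0 \<le> c v" "x = (\<Sum>v\<in>V. c v *\<^sub>R v)"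
    and d: "\<forall>v\<in>V. 0 \<le> d v" "y = (\<Sum>v\<in>V. d v *\<^sub>R v)" by (auto simp: pos_hull_def)
  have "a *\<^sub>R x + b *\<^sub>R y = (\<Sum>v\<in>V. (a * c v + b * d v) *\<^sub>R v)"
    unfolding c d by (simp add: scaleR_sum_right sum.distrib scaleR_add_left)
  then show "a *\<^sub>R x + b *\<^sub>R y \<in> pos_hull V"
    unfolding pos_hull_def using c(1) d(1) \<open>0 \<le> a\<close> \<open>0 \<le> b\<close>
    by (intro CollectI exI[of _ "\<lambda>v. a * c v + b * d v"]) auto
qed

lemma ray_in_pos_hull:
  assumes "finite V" "v \<in> V" "0 \<le> r"
  shows "r *\<^sub>R v \<in> pos_hull V"
  unfolding pos_hull_def using assms
  by (intro CollectI exI[of _ "\<lambda>w. if w = v then r else 0"]) (auto simp: if_distrib[of "\<lambda>c. c *\<^sub>R _"] cong: if_cong)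

lemma pos_hull_separation:
  fixes V :: "'a::euclidean_space set"
  assumes "finite V" "pos_hull V \<noteq> UNIV"
  obtains w where "w \<noteq> 0" "\<And>v. v \<in> V \<Longrightarrow> v \<bullet> w \<le> 0"
proof -
  obtain p where p: "p \<notin> pos_hull V" using assms(2) by blast
  have "convex ((\<lambda>x. x - p) ` pos_hull V)" "0 \<notin> (\<lambda>x. x - p) ` pos_hull V"
    using p by (auto intro: convex_translation_subtract convex_pos_hull)
  from separating_hyperplane_set_0[OF this]
  obtain a where a: "a \<noteq> 0" "\<And>x. x \<in> pos_hull V \<Longrightarrow> 0 \<le> a \<bullet> (x - p)" by auto
  have "0 \<le> v \<bullet> a" if "v \<in> V" for v
  proof (rule ccontr)
    assume "\<not> ?thesis"
    then have neg: "a \<bullet> v < 0" by (simp add: inner_commute)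
    have le: "a \<bullet> p \<le> r * (a \<bullet> v)" if "0 \<le> r" for r
      using a(2)[OF ray_in_pos_hull[OF assms(1) \<open>v \<in> V\<close> that]] by (simp add: inner_diff_right)
    \<comment> \<open>The hull contains the whole ray through \<open>v\<close>; at this parameter
      the linear functional drops to \<open>- (1 + \<bar>a \<bullet> p\<bar>)\<close>, below its
      value at \<open>p\<close>.\<close>
    have "(1 + \<bar>a \<bullet> p\<bar>) / - (a \<bullet> v) * (a \<bullet> v) = - (1 + \<bar>a \<bullet> p\<bar>)"
      using neg by (simp add: field_simps)
    then show False using le[of "(1 + \<bar>a \<bullet> p\<bar>) / - (a \<bullet> v)"] neg by (simp add: divide_nonneg_neg)
  qed
  then show thesis using a(1) by (intro that[of "- a"]) auto
qed

lemma measure_tendsto_dominated: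
  fixes S :: "nat \<Rightarrow> 'a set"
  assumes [measurable]: "\<And>n. S n \<in> sets M" "T \<in> sets M" "B \<in> sets M" and fin: "emeasure M B < \<infinity>"
    and sub: "\<forall>\<^sub>F n in sequentially. S n \<subseteq> B"
    and lim: "AE x in M. \<forall>\<^sub>F n in sequentially. x \<in> S n \<longleftrightarrow> x \<in> T"
  shows "(\<lambda>n. measure M (S n)) \<longlonglongrightarrow> measure M T"
proof -
  obtain m where m: "\<And>n. n \<ge> m \<Longrightarrow> S n \<subseteq> B" using sub by (auto simp: eventually_sequentially)
  have "(\<lambda>n. integral\<^sup>L M (indicator (S (n + m)) :: 'a \<Rightarrow> real)) \<longlonglongrightarrow> integral\<^sup>L M (indicator T)"
  proof (rule integral_dominated_convergence[where w = "indicator B"])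
    show "integrable M (indicator B :: 'a \<Rightarrow> real)" using fin by simp
    show "AE x in M. (\<lambda>n. indicator (S (n + m)) x :: real) \<longlonglongrightarrow> indicator T x"
      using lim
    proof eventually_elim
      fix x assume "\<forall>\<^sub>F n in sequentially. x \<in> S n \<longleftrightarrow> x \<in> T"
      then have "\<forall>\<^sub>F n in sequentially. x \<in> S (n + m) \<longleftrightarrow> x \<in> T"
        by (rule eventually_sequentially_seg[THEN iffD2])
      then show "(\<lambda>n. indicator (S (n + m)) x :: real) \<longlonglongrightarrow> indicator T x"
        by (intro tendsto_eventually) (auto elim!: eventually_mono simp: indicator_def)
    qed
    show "AE x in M. norm (indicator (S (n + m)) x :: real) \<le> indicator B x" for n
      using m[of "n + m"] by (auto simp: indicator_def)
  qed measurable
  then have "(\<lambda>n. measure M (S (n + m))) \<longlonglongrightarrow> measure M T" by simp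
  then show ?thesis by (rule LIMSEQ_offset)
qed

section \<open>Bodies cut out by halfspaces with given normals\<close>

locale normal_vectors =
  fixes u :: "nat \<Rightarrow> real ^ 'n" and N :: nat
  assumes inj: "inj_on u {1..N}" and unit: "\<And>i. i \<in> {1..N} \<Longrightarrow> norm (u i) = 1"
    and spans: "pos_hull (u ` {1..N}) = UNIV"
begin

abbreviation "I \<equiv> {1..N}"
abbreviation "D \<equiv> pos_deletion_complex N u"

sublocale deletion_family I D
proof
  fix J K assume "J \<in> D" "K \<subseteq> J"
  moreover have "pos_hull (u ` (I - J)) \<subseteq> pos_hull (u ` (I - K))"
    using \<open>K \<subseteq> J\<close> by (intro pos_hull_mono) auto
  ultimately show "K \<in> D" by (auto simp: pos_deletion_complex_def)
qed (use spans in \<open>auto simp: pos_deletion_complex_def\<close>)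

text \<open>
  The polytope with support numbers \<open>1 / t i\<close>; the value \<open>t i = 0\<close> stands for an absent inequality.
\<close>

definition body :: "(nat \<Rightarrow> real) \<Rightarrow> (real ^ 'n) set" where
  "body t = {x. \<forall>i\<in>I. t i * (x \<bullet> u i) \<le> 1}"

text \<open>The parameters for which \<open>body t\<close> is bounded: the normals of the
  inequalities that are present still span positively.\<close>

definition adm :: "(nat \<Rightarrow> real) set" where
  "adm = {t. (\<forall>i\<in>I. 0 \<le> t i) \<and> zero_set t \<in> D}"

text \<open>For \<open>t i = 0\<close> the equation reads \<open>0 = 1\<close>, so an absent
  inequality has an empty face and facet area 0.\<close>

definition face :: "nat \<Rightarrow> (nat \<Rightarrow> real) \<Rightarrow> (real ^ 'n) set" where
  "face i t = {x \<in> body t. t i * (x \<bullet> u i) = 1}"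

lemma closed_body: "closed (body t)"
proof -
  have "body t = (\<Inter>i\<in>I. {x. t i * (x \<bullet> u i) \<le> 1})" by (auto simp: body_def)
  then show ?thesis by (auto intro!: closed_Collect_le continuous_intros)
qed

lemma body_borel [measurable]: "body t \<in> sets borel"
  using closed_body by (rule borel_closed)

lemma face_borel [measurable]: "face i t \<in> sets borel"
proof -
  have "face i t = body t \<inter> {x. t i * (x \<bullet> u i) = 1}" by (auto simp: face_def)
  then show ?thesis by simp
qed

text \<open>Every vector \<open>z\<close> is a nonnegative combination of the normals that are
  present, so \<open>x \<bullet> z\<close> is bounded above on the body; the vectors of the axes and
  their negatives then bound \<open>x\<close>. Allowing \<open>t i / 2\<close> makes the bound
  uniform for all nearby parameters.\<close>

lemma body_bounded:
  assumes "t \<in> adm"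
  shows "\<exists>R>0. \<forall>s. (\<forall>i\<in>I. t i / 2 \<le> s i) \<longrightarrow> body s \<subseteq> cball 0 R"
proof -
  let ?J = "zero_set t"
  define \<beta> where "\<beta> = (\<Sum>i\<in>I - ?J. 2 / t i)"
  have tpos: "0 < t i" if "i \<in> I - ?J" for i using assms that by (force simp: adm_def zero_set_def)
  have \<beta>: "2 / t i \<le> \<beta>" if "i \<in> I - ?J" for i
    unfolding \<beta>_def by (rule member_le_sum) (use that tpos in \<open>auto intro: less_imp_le\<close>)
  have "\<exists>b. \<forall>s x. (\<forall>i\<in>I. t i / 2 \<le> s i) \<longrightarrow> x \<in> body s \<longrightarrow> x \<bullet> z \<le> b" for z
  proof -
    have "z \<in> pos_hull (u ` (I - ?J))" using assms by (auto simp: adm_def pos_deletion_complex_def)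
    then obtain c where c: "\<forall>v\<in>u ` (I - ?J). 0 \<le> c v" "z = (\<Sum>v\<in>u ` (I - ?J). c v *\<^sub>R v)"
      by (auto simp: pos_hull_def)
    have "x \<bullet> z \<le> (\<Sum>v\<in>u ` (I - ?J). c v * \<beta>)" if s: "\<forall>i\<in>I. t i / 2 \<le> s i" and x: "x \<in> body s" for s x
      unfolding c(2) inner_sum_right inner_scaleR_right
    proof (intro sum_mono mult_left_mono)
      fix v assume "v \<in> u ` (I - ?J)"
      then obtain i where i: "i \<in> I - ?J" "v = u i" by blast
      have si: "t i / 2 \<le> s i" "0 < t i" using i s tpos by auto
      then have "s i > 0" by linarith
      have "s i * (x \<bullet> u i) \<le> 1" using x i by (auto simp: body_def)
      then have "x \<bullet> u i \<le> 1 / s i" using \<open>s i > 0\<close> by (simp add: field_simps)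
      also have "\<dots> \<le> 1 / (t i / 2)" using si by (intro divide_left_mono) auto
      also have "\<dots> \<le> \<beta>" using \<beta>[OF i(1)] by simp
      finally show "x \<bullet> v \<le> \<beta>" using i by simp
    qed (use c in auto)
    then show ?thesis by blast
  qed
  then obtain b where b: "\<And>z s x. (\<forall>i\<in>I. t i / 2 \<le> s i) \<Longrightarrow> x \<in> body s \<Longrightarrow> x \<bullet> z \<le> b z" by metis
  define R where "R = (\<Sum>j\<in>UNIV. \<bar>b (axis j 1)\<bar> + \<bar>b (- axis j 1)\<bar>) + 1"
  have "norm x \<le> R" if s: "\<forall>i\<in>I. t i / 2 \<le> s i" and x: "x \<in> body s" for s x
  proof -
    have "\<bar>x $ j\<bar> \<le> \<bar>b (axis j 1)\<bar> + \<bar>b (- axis j 1)\<bar>" for j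
      using b[OF s x, of "axis j 1"] b[OF s x, of "- axis j 1"] by (simp add: inner_axis)
    then have "(\<Sum>j\<in>UNIV. \<bar>x $ j\<bar>) \<le> (\<Sum>j\<in>UNIV. \<bar>b (axis j 1)\<bar> + \<bar>b (- axis j 1)\<bar>)" by (intro sum_mono)
    then show ?thesis using norm_le_l1_cart[of x] by (simp add: R_def)
  qed
  moreover have "R > 0" unfolding R_def by (intro add_nonneg_pos sum_nonneg) auto
  ultimately show ?thesis by (intro exI[of _ R]) auto
qed

lemma body_bounded_sequence:
  assumes "t \<in> adm" and lim: "\<And>i. i \<in> I \<Longrightarrow> (\<lambda>n. ts n i) \<longlonglongrightarrow> t i" and nonneg: "\<And>n i. i \<in> I \<Longrightarrow> 0 \<le> ts n i"
  obtains R where "R > 0" "body t \<subseteq> cball 0 R" "\<forall>\<^sub>F n in sequentially. body (ts n) \<subseteq> cball 0 R"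
proof -
  obtain R where R: "R > 0" "\<And>s. (\<forall>i\<in>I. t i / 2 \<le> s i) \<Longrightarrow> body s \<subseteq> cball 0 R"
    using body_bounded[OF assms(1)] by blast
  have t0: "0 \<le> t i" if "i \<in> I" for i using assms(1) that by (auto simp: adm_def)
  have "\<forall>\<^sub>F n in sequentially. t i / 2 \<le> ts n i" if "i \<in> I" for i
  proof (cases "t i = 0")
    case True
    then show ?thesis using nonneg[OF that] by simp
  next
    case False
    then have "t i / 2 < t i" using t0[OF that] by simp
    from order_tendstoD(1)[OF lim[OF that] this] show ?thesis by (auto elim: eventually_mono)
  qed
  then have "\<forall>\<^sub>F n in sequentially. \<forall>i\<in>I. t i / 2 \<le> ts n i" by (simp add: eventually_ball_finite)
  then have "\<forall>\<^sub>F n in sequentially. body (ts n) \<subseteq> cball 0 R" by (rule eventually_mono) (use R in blast)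
  moreover have "body t \<subseteq> cball 0 R" using t0 by (intro R) auto
  ultimately show thesis using that R(1) by blast
qed

lemma body_compact:
  assumes "t \<in> adm"
  shows "compact (body t)"
proof -
  have "\<forall>i\<in>I. t i / 2 \<le> t i" using assms by (auto simp: adm_def)
  then obtain R where "body t \<subseteq> cball 0 R" using body_bounded[OF assms] by blast
  then have "bounded (body t)" by (rule bounded_subset[OF bounded_cball])
  then show ?thesis using closed_body by (simp add: compact_eq_bounded_closed)
qed

lemma eventually_le_iff:
  fixes r :: real
  assumes "r \<noteq> c" "f \<longlonglongrightarrow> r"
  shows "\<forall>\<^sub>F n in sequentially. f n \<le> c \<longleftrightarrow> r \<le> c"
proof (cases "r < c")
  case True
  then show ?thesis using order_tendstoD(2)[OF assms(2), of c] by (auto elim: eventually_mono)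
next
  case False
  then have "c < r" using assms by simp
  then show ?thesis using order_tendstoD(1)[OF assms(2), of c] by (auto elim!: eventually_mono)
qed

definition vol :: "(nat \<Rightarrow> real) \<Rightarrow> real" where
  "vol t = measure lborel (body t)"

text \<open>Dominated convergence: membership in the bodies is eventually constant at every point
  off the hyperplanes \<open>t i * (x \<bullet> u i) = 1\<close>, which are null sets.\<close>

lemma vol_tendsto:
  assumes "t \<in> adm" and lim: "\<And>i. i \<in> I \<Longrightarrow> (\<lambda>n. ts n i) \<longlonglongrightarrow> t i" and nonneg: "\<And>n i. i \<in> I \<Longrightarrow> 0 \<le> ts n i"
  shows "(\<lambda>n. vol (ts n)) \<longlonglongrightarrow> vol t"
proof -
  obtain R where R: "R > 0" "body t \<subseteq> cball 0 R" "\<forall>\<^sub>F n in sequentially. body (ts n) \<subseteq> cball 0 R"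
    by (rule body_bounded_sequence[OF assms(1) lim nonneg])
  have null: "AE x in lborel. t i * (x \<bullet> u i) \<noteq> 1" if "i \<in> I" for i
  proof -
    have "{x. (t i *\<^sub>R u i) \<bullet> x = 1} = {x. t i * (x \<bullet> u i) = 1}" by (auto simp: inner_commute)
    moreover have "negligible {x. (t i *\<^sub>R u i) \<bullet> x = 1}" by (rule negligible_hyperplane) simp
    ultimately have "negligible {x. t i * (x \<bullet> u i) = 1}" by simp
    then have "{x. t i * (x \<bullet> u i) = 1} \<in> null_sets lborel"
      by (intro null_setsI) (auto simp: negligible_iff_emeasure0 emeasure_completion)
    then show ?thesis by (auto dest: AE_not_in)
  qed
  have "AE x in lborel. \<forall>\<^sub>F n in sequentially. x \<in> body (ts n) \<longleftrightarrow> x \<in> body t"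
  proof -
    have "AE x in lborel. \<forall>i\<in>I. t i * (x \<bullet> u i) \<noteq> 1"
      using null by (simp add: AE_ball_countable)
    then show ?thesis
    proof eventually_elim
      fix x assume x: "\<forall>i\<in>I. t i * (x \<bullet> u i) \<noteq> 1"
      have "\<forall>\<^sub>F n in sequentially. \<forall>i\<in>I. ts n i * (x \<bullet> u i) \<le> 1 \<longleftrightarrow> t i * (x \<bullet> u i) \<le> 1"
        using x lim by (intro eventually_ball_finite ballI eventually_le_iff tendsto_intros) auto
      then show "\<forall>\<^sub>F n in sequentially. x \<in> body (ts n) \<longleftrightarrow> x \<in> body t"
        by (rule eventually_mono) (auto simp: body_def)
    qed
  qed
  then show ?thesis
    unfolding vol_def using R(3) emeasure_lborel_cball_finite[of "0 :: real ^ 'n" R]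
    by (intro measure_tendsto_dominated[where B = "cball 0 R"]) auto
qed

section \<open>Facet areas and their continuity\<close>

definition facet_area :: "nat \<Rightarrow> (nat \<Rightarrow> real) \<Rightarrow> real" where
  "facet_area i t = enn2real (area (face i t))"

lemma area_face_finite:
  assumes "t \<in> adm" "i \<in> I"
  shows "area (face i t) < \<infinity>"
proof (cases "t i = 0")
  case True
  then show ?thesis by (simp add: face_def)
next
  case False
  show ?thesis
  proof (rule area_bounded_plane_finite[OF unit[OF assms(2)]])
    show "bounded (face i t)"
      using compact_imp_bounded[OF body_compact[OF assms(1)]] by (rule bounded_subset) (auto simp: face_def)
    show "face i t \<subseteq> {x. x \<bullet> u i = 1 / t i}" using False by (auto simp: face_def eq_divide_eq mult.commute)
  qed
qed

text \<open>Opposite normals are the only parallel case, as \<open>u\<close> is injective. Then the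
  two equations demand opposite signs of \<open>x \<bullet> u i\<close>; otherwise the set has
  codimension 2.\<close>

lemma area_face_intersection:
  assumes "i \<in> I" "j \<in> I" "i \<noteq> j" "0 < t i" "0 \<le> t j"
  shows "area {x. t i * (x \<bullet> u i) = 1 \<and> t j * (x \<bullet> u j) = 1} = 0"
proof (cases "t j = 0 \<or> u j = - u i")
  case True
  have "{x. t i * (x \<bullet> u i) = 1 \<and> t j * (x \<bullet> u j) = 1} = {}"
  proof (rule ccontr)
    assume "\<not> ?thesis"
    then obtain x where x: "t i * (x \<bullet> u i) = 1" "t j * (x \<bullet> u j) = 1" by blast
    then have "u j = - u i" using True by auto
    then have "t j * (x \<bullet> u i) = - 1" using x by simp
    moreover have "x \<bullet> u i > 0" using x(1) assms(4) by (metis zero_less_mult_pos zero_less_one)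
    ultimately show False using assms(5) by (metis mult_nonneg_nonneg less_imp_le neg_0_le_iff_le not_one_le_zero)
  qed
  then show ?thesis by (simp only: hausdorff_measure_empty)
next
  case False
  have "u j \<noteq> u i" using inj_on_eq_iff[OF inj assms(2,1)] assms(3) by simp
  then have "area {x. x \<bullet> u i = 1 / t i \<and> x \<bullet> u j = 1 / t j} = 0"
    using False assms by (intro area_codimension_2 unit) auto
  moreover have "a = 1 / r \<longleftrightarrow> r * a = 1" if "r \<noteq> 0" for a r :: real
    using that by (simp add: eq_divide_eq mult.commute)
  then have "{x. x \<bullet> u i = 1 / t i \<and> x \<bullet> u j = 1 / t j} = {x. t i * (x \<bullet> u i) = 1 \<and> t j * (x \<bullet> u j) = 1}"
    using False assms by (intro Collect_cong) auto
  ultimately show ?thesis by simp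
qed

text \<open>The facets lie in moving hyperplanes. Translating them along \<open>u i\<close> into the
  fixed hyperplane through the origin makes dominated convergence applicable, the exceptional points
  lying on two bounding hyperplanes at once.\<close>

lemma facet_area_tendsto:
  assumes t: "t \<in> adm" and lim: "\<And>i. i \<in> I \<Longrightarrow> (\<lambda>n. ts n i) \<longlonglongrightarrow> t i" and nonneg: "\<And>n i. i \<in> I \<Longrightarrow> 0 \<le> ts n i"
    and i: "i \<in> I" and "0 < t i"
  shows "(\<lambda>n. facet_area i (ts n)) \<longlonglongrightarrow> facet_area i t"
proof -
  obtain R where R: "R > 0" "body t \<subseteq> cball 0 R" "\<forall>\<^sub>F n in sequentially. body (ts n) \<subseteq> cball 0 R"
    by (rule body_bounded_sequence[OF assms(1) lim nonneg])
  have uu: "u i \<bullet> u i = 1" using unit[OF i] by (simp add: dot_square_norm)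
  define S where "S s = {x. x + (1 / s i) *\<^sub>R u i \<in> face i s} \<inter> {x. x \<bullet> u i = 0}" for s
  have pre: "{x. x + (1 / s i) *\<^sub>R u i \<in> face i s} \<in> sets borel" for s
    using measurable_sets[of "\<lambda>x. x + (1 / s i) *\<^sub>R u i" borel borel "face i s"] by (simp add: vimage_def)
  have S_borel: "S s \<in> sets borel" for s unfolding S_def using pre by (intro sets.Int) auto
  have S_area: "facet_area i s = measure (plane_area (u i)) (S s)" if "0 < s i" for s
  proof -
    have face_eq: "{x \<in> face i s. x \<bullet> u i = 1 / s i} = face i s"
      using that by (auto simp: face_def eq_divide_eq mult.commute)
    have "emeasure (plane_area (u i)) {x. x + (1 / s i) *\<^sub>R u i \<in> face i s} = area (face i s)"
      using emeasure_plane_area_translate[OF face_borel[of i s] unit[OF i], of "1 / s i"] unfolding face_eq .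
    moreover have "emeasure (plane_area (u i)) (S s) = emeasure (plane_area (u i)) {x. x + (1 / s i) *\<^sub>R u i \<in> face i s}"
      unfolding emeasure_plane_area[OF pre] emeasure_plane_area[OF S_borel] by (simp add: S_def)
    ultimately show ?thesis by (simp add: facet_area_def measure_def)
  qed
  have S_iff: "x \<in> S s \<longleftrightarrow> x \<bullet> u i = 0 \<and> (\<forall>j\<in>I - {i}. s j * ((x + (1 / s i) *\<^sub>R u i) \<bullet> u j) \<le> 1)" if "0 < s i" for s x
  proof -
    have "s i * ((x + (1 / s i) *\<^sub>R u i) \<bullet> u i) = 1" if "x \<bullet> u i = 0"
      using that \<open>0 < s i\<close> uu by (simp add: inner_add_left)
    then show ?thesis using i by (auto simp: S_def face_def body_def)
  qed
  have ev_pos: "\<forall>\<^sub>F n in sequentially. 0 < ts n i"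
    using order_tendstoD(1)[OF lim[OF i] \<open>0 < t i\<close>] .
  have lim_inv: "(\<lambda>n. 1 / ts n i) \<longlonglongrightarrow> 1 / t i"
    using \<open>0 < t i\<close> by (intro tendsto_intros lim i) auto
  have "(\<lambda>n. measure (plane_area (u i)) (S (ts n))) \<longlonglongrightarrow> measure (plane_area (u i)) (S t)"
  \<comment> \<open>The translation has length \<open>1 / ts n i\<close>, eventually less than
    \<open>1 / t i + 1\<close>, and the bodies lie in a ball of radius \<open>R\<close>.\<close>
  proof (rule measure_tendsto_dominated[where B = "cball 0 (R + (1 / t i + 1))"])
    have "{x \<in> cball 0 (R + (1 / t i + 1)). x \<bullet> u i = 0} \<subseteq> cball 0 (R + (1 / t i + 1))" by auto
    then have "area {x \<in> cball 0 (R + (1 / t i + 1)). x \<bullet> u i = 0} < \<infinity>"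
      by (intro area_bounded_plane_finite[OF unit[OF i], of _ 0] bounded_subset[OF bounded_cball]) auto
    then show "emeasure (plane_area (u i)) (cball 0 (R + (1 / t i + 1))) < \<infinity>"
      by (subst emeasure_plane_area) auto
    have "\<forall>\<^sub>F n in sequentially. 1 / ts n i < 1 / t i + 1"
      using order_tendstoD(2)[OF lim_inv] by simp
    with ev_pos R(3) show "\<forall>\<^sub>F n in sequentially. S (ts n) \<subseteq> cball 0 (R + (1 / t i + 1))"
    proof eventually_elim
      case (elim n)
      show ?case
      proof
        fix x assume "x \<in> S (ts n)"
        then have "norm (x + (1 / ts n i) *\<^sub>R u i) \<le> R" using elim(2) by (auto simp: S_def face_def)
        then have "norm x \<le> R + 1 / ts n i"
          using norm_triangle_ineq4[of "x + (1 / ts n i) *\<^sub>R u i" "(1 / ts n i) *\<^sub>R u i"] elim(1) unit[OF i] by simp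
        then show "x \<in> cball 0 (R + (1 / t i + 1))" using elim(3) by simp
      qed
    qed
    have null: "AE x in plane_area (u i). \<not> (x \<bullet> u i = 0 \<and> t j * ((x + (1 / t i) *\<^sub>R u i) \<bullet> u j) = 1)" if j: "j \<in> I - {i}" for j
    proof -
      let ?A = "{x. t i * (x \<bullet> u i) = 1 \<and> t j * (x \<bullet> u j) = 1}"
      have A: "?A \<in> sets borel" by measurable
      have pre: "{x. x + (1 / t i) *\<^sub>R u i \<in> ?A} \<in> sets borel"
        using measurable_sets[of "\<lambda>x. x + (1 / t i) *\<^sub>R u i" borel borel ?A] A by (simp add: vimage_def)
      have "area ?A = 0" using t i j \<open>0 < t i\<close> by (intro area_face_intersection) (auto simp: adm_def)
      then have "area {x \<in> ?A. x \<bullet> u i = 1 / t i} = 0"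
        using hausdorff_measure_mono[of "{x \<in> ?A. x \<bullet> u i = 1 / t i}" ?A "CARD('n) - 1"] by auto
      then have "emeasure (plane_area (u i)) {x. x + (1 / t i) *\<^sub>R u i \<in> ?A} = 0"
        using emeasure_plane_area_translate[OF A unit[OF i], of "1 / t i"] by simp
      then have "AE x in plane_area (u i). x \<notin> {x. x + (1 / t i) *\<^sub>R u i \<in> ?A}"
        using pre by (intro AE_not_in null_setsI) auto
      then show ?thesis
        by (rule AE_mp) (use \<open>0 < t i\<close> uu in \<open>auto simp: inner_add_left\<close>)
    qed
    have "AE x in plane_area (u i). \<forall>j\<in>I - {i}. \<not> (x \<bullet> u i = 0 \<and> t j * ((x + (1 / t i) *\<^sub>R u i) \<bullet> u j) = 1)"
      by (rule AE_ball_countable[THEN iffD2]) (use null in auto)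
    then show "AE x in plane_area (u i). \<forall>\<^sub>F n in sequentially. x \<in> S (ts n) \<longleftrightarrow> x \<in> S t"
    proof eventually_elim
      fix x assume x: "\<forall>j\<in>I - {i}. \<not> (x \<bullet> u i = 0 \<and> t j * ((x + (1 / t i) *\<^sub>R u i) \<bullet> u j) = 1)"
      show "\<forall>\<^sub>F n in sequentially. x \<in> S (ts n) \<longleftrightarrow> x \<in> S t"
      proof (cases "x \<bullet> u i = 0")
        case True
        have "\<forall>\<^sub>F n in sequentially. \<forall>j\<in>I - {i}. ts n j * ((x + (1 / ts n i) *\<^sub>R u i) \<bullet> u j) \<le> 1
            \<longleftrightarrow> t j * ((x + (1 / t i) *\<^sub>R u i) \<bullet> u j) \<le> 1"
        proof (intro eventually_ball_finite ballI eventually_le_iff)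
          fix j assume j: "j \<in> I - {i}"
          show "t j * ((x + (1 / t i) *\<^sub>R u i) \<bullet> u j) \<noteq> 1" using x True j by blast
          show "(\<lambda>n. ts n j * ((x + (1 / ts n i) *\<^sub>R u i) \<bullet> u j)) \<longlonglongrightarrow> t j * ((x + (1 / t i) *\<^sub>R u i) \<bullet> u j)"
            using j by (intro tendsto_mult lim tendsto_inner tendsto_add tendsto_scaleR tendsto_const lim_inv) auto
        qed simp
        with ev_pos show ?thesis
          by eventually_elim (use S_iff \<open>0 < t i\<close> in auto)
      next
        case False
        then show ?thesis by (simp add: S_def)
      qed
    qed
  qed (use S_borel in auto)
  moreover have "\<forall>\<^sub>F n in sequentially. measure (plane_area (u i)) (S (ts n)) = facet_area i (ts n)"
    using ev_pos by eventually_elim (simp add: S_area)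
  ultimately have "(\<lambda>n. facet_area i (ts n)) \<longlonglongrightarrow> measure (plane_area (u i)) (S t)"
    by (rule Lim_transform_eventually)
  then show ?thesis using S_area[of t] \<open>0 < t i\<close> by simp
qed

text \<open>The hyperplane of the i-th inequality moves to infinity, while the bodies eventually
  stay in a ball of radius \<open>R\<close>; it misses them once
  \<open>ts n i < 1 / R\<close>.\<close>

lemma face_empty_tendsto:
  assumes t: "t \<in> adm" and lim: "\<And>i. i \<in> I \<Longrightarrow> (\<lambda>n. ts n i) \<longlonglongrightarrow> t i" and nonneg: "\<And>n i. i \<in> I \<Longrightarrow> 0 \<le> ts n i"
    and i: "i \<in> I" and "t i = 0"
  shows "\<forall>\<^sub>F n in sequentially. face i (ts n) = {}"
proof -
  obtain R where R: "R > 0" "body t \<subseteq> cball 0 R" "\<forall>\<^sub>F n in sequentially. body (ts n) \<subseteq> cball 0 R"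
    by (rule body_bounded_sequence[OF assms(1) lim nonneg])
  have "\<forall>\<^sub>F n in sequentially. ts n i < 1 / R"
    using order_tendstoD(2)[OF lim[OF i], of "1 / R"] R(1) \<open>t i = 0\<close> by simp
  with R(3) show ?thesis
  proof eventually_elim
    case (elim n)
    show ?case
    proof (rule ccontr)
      assume "face i (ts n) \<noteq> {}"
      then obtain x where x: "x \<in> body (ts n)" "ts n i * (x \<bullet> u i) = 1" by (auto simp: face_def)
      have "x \<bullet> u i \<le> R" using x(1) elim(1) norm_cauchy_schwarz[of x "u i"] unit[OF i] by auto
      then have "ts n i * (x \<bullet> u i) \<le> ts n i * R" using nonneg[OF i] by (intro mult_left_mono)
      also have "\<dots> < 1" using elim(2) R(1) by (simp add: field_simps)
      finally show False using x(2) by simp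
    qed
  qed
qed

end

section \<open>The energy of a discrete measure\<close>

text \<open>Here \<open>q\<close> stands for \<open>- p\<close>, and \<open>c\<close> is the
  constant relating slice areas to Lebesgue measure: the derivative of \<open>c\<close> times the
  volume is exactly a facet area.\<close>

locale minkowski_problem = normal_vectors u N for u :: "nat \<Rightarrow> real ^ 'n" and N +
  fixes q c :: real and \<alpha> :: "nat \<Rightarrow> real"
  assumes q: "0 < q" and c: "0 < c"
    and slices: "\<And>(v :: real ^ 'n) A. norm v = 1 \<Longrightarrow> A \<in> sets borel \<Longrightarrow>
       (\<integral>\<^sup>+\<tau>. area {x \<in> A. x \<bullet> v = \<tau>} \<partial>lborel) = ennreal c * emeasure lborel A"
    and \<alpha>: "\<And>i. i \<in> {1..N} \<Longrightarrow> 0 < \<alpha> i"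
begin

section \<open>The derivative of the volume in one support number\<close>

lemma area_face: "t \<in> adm \<Longrightarrow> i \<in> I \<Longrightarrow> area (face i t) = ennreal (facet_area i t)"
  using area_face_finite[of t i] by (simp add: facet_area_def ennreal_enn2real less_top)

lemma facet_area_nonneg: "0 \<le> facet_area i t"
  by (simp add: facet_area_def)

lemma adm_upd:
  assumes "t \<in> adm" "0 < s"
  shows "t(k := s) \<in> adm"
proof -
  have "zero_set (t(k := s)) \<subseteq> zero_set t" using assms(2) by (auto simp: zero_set_def split: if_splits)
  then have "zero_set (t(k := s)) \<in> D" using assms(1) D_down by (auto simp: adm_def)
  then show ?thesis using assms by (auto simp: adm_def)
qed

lemma body_upd:
  assumes "k \<in> I" "0 < \<tau>"
  shows "x \<in> body (t(k := 1 / \<tau>)) \<longleftrightarrow> (\<forall>j\<in>I - {k}. t j * (x \<bullet> u j) \<le> 1) \<and> x \<bullet> u k \<le> \<tau>"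
proof -
  have "(1 / \<tau>) * (x \<bullet> u k) \<le> 1 \<longleftrightarrow> x \<bullet> u k \<le> \<tau>" using assms(2) by (simp add: divide_le_eq)
  then show ?thesis using assms(1) by (auto simp: body_def)
qed

lemma face_upd:
  assumes "k \<in> I" "0 < \<tau>"
  shows "x \<in> face k (t(k := 1 / \<tau>)) \<longleftrightarrow> (\<forall>j\<in>I - {k}. t j * (x \<bullet> u j) \<le> 1) \<and> x \<bullet> u k = \<tau>"
proof -
  have "(1 / \<tau>) * (x \<bullet> u k) = 1 \<longleftrightarrow> x \<bullet> u k = \<tau>" using assms(2) by (simp add: divide_eq_eq)
  then show ?thesis using assms by (auto simp: face_def body_upd)
qed

text \<open>Moving the k-th support number from \<open>\<tau>1\<close> to \<open>\<tau>2\<close>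
  adds a slab whose slices orthogonal to \<open>u k\<close> are the facets of the intermediate
  bodies. So \<open>c\<close> times the added volume is the integral of the facet areas.\<close>

lemma vol_slab:
  assumes t: "t \<in> adm" and k: "k \<in> I" and \<tau>: "0 < \<tau>1" "\<tau>1 \<le> \<tau>2" and "0 \<le> m"
    and bounds: "\<And>\<tau>. \<tau>1 < \<tau> \<Longrightarrow> \<tau> \<le> \<tau>2 \<Longrightarrow> m \<le> facet_area k (t(k := 1 / \<tau>)) \<and> facet_area k (t(k := 1 / \<tau>)) \<le> M"
    and "0 \<le> M"
  shows "m * (\<tau>2 - \<tau>1) \<le> c * (vol (t(k := 1 / \<tau>2)) - vol (t(k := 1 / \<tau>1)))"
    and "c * (vol (t(k := 1 / \<tau>2)) - vol (t(k := 1 / \<tau>1))) \<le> M * (\<tau>2 - \<tau>1)"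
proof -
  let ?B1 = "body (t(k := 1 / \<tau>1))" and ?B2 = "body (t(k := 1 / \<tau>2))"
  have adm: "t(k := 1 / \<tau>) \<in> adm" if "0 < \<tau>" for \<tau> using adm_upd[OF t] that by simp
  have fin: "emeasure lborel (body (t(k := 1 / \<tau>))) < \<infinity>" if "0 < \<tau>" for \<tau>
    using body_compact[OF adm[OF that]] by (rule emeasure_compact_finite)
  have sub: "?B1 \<subseteq> ?B2" using body_upd[OF k] \<tau> by fastforce
  have vol: "emeasure lborel (?B2 - ?B1) = ennreal (vol (t(k := 1 / \<tau>2)) - vol (t(k := 1 / \<tau>1)))"
  proof -
    have "emeasure lborel (?B2 - ?B1) = ennreal (measure lborel (?B2 - ?B1))"
      by (rule emeasure_eq_ennreal_measure) (use fin[of \<tau>2] \<tau> emeasure_mono[of "?B2 - ?B1" ?B2 lborel] in \<open>auto simp: top_unique\<close>)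
    also have "measure lborel (?B2 - ?B1) = measure lborel ?B2 - measure lborel ?B1"
      by (rule measure_Diff) (use fin[of \<tau>2] \<tau> sub in auto)
    finally show ?thesis by (simp only: vol_def)
  qed
  have vol_le: "vol (t(k := 1 / \<tau>1)) \<le> vol (t(k := 1 / \<tau>2))"
    unfolding vol_def using fin[of \<tau>2] \<tau> sub by (intro measure_mono_fmeasurable) (auto intro!: fmeasurableI)
  \<comment> \<open>The interval is open on the left because the smaller body contains its own facet
    at height \<open>\<tau>1\<close>.\<close>
  have slice: "area {x \<in> ?B2 - ?B1. x \<bullet> u k = \<tau>} = ennreal (facet_area k (t(k := 1 / \<tau>))) * indicator {\<tau>1<..\<tau>2} \<tau>" for \<tau>
  proof (cases "\<tau>1 < \<tau> \<and> \<tau> \<le> \<tau>2")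
    case True
    then have "0 < \<tau>" using \<tau> by simp
    have "{x \<in> ?B2 - ?B1. x \<bullet> u k = \<tau>} = face k (t(k := 1 / \<tau>))"
      using True \<tau> body_upd[OF k] face_upd[OF k \<open>0 < \<tau>\<close>] by fastforce
    then show ?thesis using True area_face[OF adm[OF \<open>0 < \<tau>\<close>] k] by simp
  next
    case False
    then have "{x \<in> ?B2 - ?B1. x \<bullet> u k = \<tau>} = {}"
      using \<tau> body_upd[OF k] by fastforce
    then have "area {x \<in> ?B2 - ?B1. x \<bullet> u k = \<tau>} = 0" by (simp only: hausdorff_measure_empty)
    then show ?thesis using False by (simp add: indicator_def)
  qed
  have int: "ennreal (c * (vol (t(k := 1 / \<tau>2)) - vol (t(k := 1 / \<tau>1))))
      = (\<integral>\<^sup>+\<tau>. ennreal (facet_area k (t(k := 1 / \<tau>))) * indicator {\<tau>1<..\<tau>2} \<tau> \<partial>lborel)"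
    using slices[OF unit[OF k], of "?B2 - ?B1"] c vol_le unfolding slice vol by (simp add: ennreal_mult)
  have const: "(\<integral>\<^sup>+\<tau>. ennreal r * indicator {\<tau>1<..\<tau>2} \<tau> \<partial>lborel) = ennreal (r * (\<tau>2 - \<tau>1))" if "0 \<le> r" for r
    using that \<tau> by (simp add: nn_integral_cmult_indicator ennreal_mult)
  have "ennreal (m * (\<tau>2 - \<tau>1)) \<le> ennreal (c * (vol (t(k := 1 / \<tau>2)) - vol (t(k := 1 / \<tau>1))))"
    unfolding int const[OF \<open>0 \<le> m\<close>, symmetric] using bounds
    by (intro nn_integral_mono) (auto simp: indicator_def intro!: ennreal_leI)
  then show "m * (\<tau>2 - \<tau>1) \<le> c * (vol (t(k := 1 / \<tau>2)) - vol (t(k := 1 / \<tau>1)))"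
    using c vol_le by (simp add: ennreal_le_iff)
  have "ennreal (c * (vol (t(k := 1 / \<tau>2)) - vol (t(k := 1 / \<tau>1)))) \<le> ennreal (M * (\<tau>2 - \<tau>1))"
    unfolding int const[OF \<open>0 \<le> M\<close>, symmetric] using bounds
    by (intro nn_integral_mono) (auto simp: indicator_def intro!: ennreal_leI)
  then show "c * (vol (t(k := 1 / \<tau>2)) - vol (t(k := 1 / \<tau>1))) \<le> M * (\<tau>2 - \<tau>1)"
    using \<open>0 \<le> M\<close> \<tau> by (simp add: ennreal_le_iff)
qed

lemma facet_area_continuous:
  assumes t: "t \<in> adm" and k: "k \<in> I" and "0 < \<tau>0" "0 < \<epsilon>"
  obtains \<delta> where "0 < \<delta>" "\<delta> < \<tau>0" "\<And>\<tau>. \<bar>\<tau> - \<tau>0\<bar> < \<delta> \<Longrightarrow> \<bar>facet_area k (t(k := 1 / \<tau>)) - facet_area k (t(k := 1 / \<tau>0))\<bar> < \<epsilon>"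
proof -
  \<comment> \<open>Cutting off at half of \<open>\<tau>0\<close> keeps the support number positive
    along any sequence, and changes nothing near \<open>\<tau>0\<close>.\<close>
  define \<phi> where "\<phi> \<tau> = facet_area k (t(k := 1 / max \<tau> (\<tau>0 / 2)))" for \<tau>
  have "isCont \<phi> \<tau>0"
    unfolding continuous_at_sequentially o_def
  proof (intro allI impI)
    fix x assume x: "x \<longlonglongrightarrow> \<tau>0"
    have mx: "max \<tau>0 (\<tau>0 / 2) = \<tau>0" using \<open>0 < \<tau>0\<close> by simp
    have "(\<lambda>n. facet_area k (t(k := 1 / max (x n) (\<tau>0 / 2)))) \<longlonglongrightarrow> facet_area k (t(k := 1 / \<tau>0))"
    proof (rule facet_area_tendsto)
      show "t(k := 1 / \<tau>0) \<in> adm" using adm_upd[OF t] \<open>0 < \<tau>0\<close> by simp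
      show "(\<lambda>n. (t(k := 1 / max (x n) (\<tau>0 / 2))) i) \<longlonglongrightarrow> (t(k := 1 / \<tau>0)) i" if "i \<in> I" for i
        using tendsto_divide[OF tendsto_const[of 1] tendsto_max[OF x tendsto_const[of "\<tau>0 / 2"]]] mx \<open>0 < \<tau>0\<close> by auto
      show "0 \<le> (t(k := 1 / max (x n) (\<tau>0 / 2))) i" if "i \<in> I" for n i
        using t that \<open>0 < \<tau>0\<close> by (auto simp: adm_def le_max_iff_disj)
    qed (use k \<open>0 < \<tau>0\<close> in auto)
    then show "(\<lambda>n. \<phi> (x n)) \<longlonglongrightarrow> \<phi> \<tau>0" by (simp add: \<phi>_def mx)
  qed
  then obtain \<delta> where \<delta>: "\<delta> > 0" "\<And>\<tau>. \<bar>\<tau> - \<tau>0\<bar> < \<delta> \<Longrightarrow> \<bar>\<phi> \<tau> - \<phi> \<tau>0\<bar> < \<epsilon>"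
    using \<open>0 < \<epsilon>\<close> unfolding continuous_at_eps_delta dist_real_def by blast
  have \<phi>: "\<phi> \<tau> = facet_area k (t(k := 1 / \<tau>))" if "\<bar>\<tau> - \<tau>0\<bar> < \<tau>0 / 2" for \<tau>
  proof -
    have "\<tau>0 / 2 \<le> \<tau>" using that by linarith
    then have "max \<tau> (\<tau>0 / 2) = \<tau>" by (rule max_absorb1)
    then show ?thesis by (simp add: \<phi>_def)
  qed
  show thesis
  proof (rule that[of "min \<delta> (\<tau>0 / 2)"])
    fix \<tau> assume "\<bar>\<tau> - \<tau>0\<bar> < min \<delta> (\<tau>0 / 2)"
    then show "\<bar>facet_area k (t(k := 1 / \<tau>)) - facet_area k (t(k := 1 / \<tau>0))\<bar> < \<epsilon>"
      using \<delta>(2)[of \<tau>] \<phi>[of \<tau>] \<phi>[of \<tau>0] \<open>0 < \<tau>0\<close> by simp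
  qed (use \<delta> \<open>0 < \<tau>0\<close> in auto)
qed

text \<open>Continuity of the facet area puts it within \<open>r / 2\<close> of its value at
  \<open>\<tau>0\<close> on a short interval, and the slab estimate transfers these bounds to the
  difference quotients on both sides.\<close>

lemma vol_derivative:
  assumes t: "t \<in> adm" and k: "k \<in> I" and "0 < \<tau>0"
  shows "((\<lambda>\<tau>. c * vol (t(k := 1 / \<tau>))) has_real_derivative facet_area k (t(k := 1 / \<tau>0))) (at \<tau>0)"
proof -
  define g where "g \<tau> = c * vol (t(k := 1 / \<tau>))" for \<tau>
  define a where "a \<tau> = facet_area k (t(k := 1 / \<tau>))" for \<tau>
  have "(\<lambda>z. (g z - g \<tau>0) / (z - \<tau>0)) \<midarrow>\<tau>0\<rightarrow> a \<tau>0"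
  proof (rule LIM_I)
    fix r :: real assume "0 < r"
    obtain \<delta> where \<delta>: "0 < \<delta>" "\<delta> < \<tau>0" "\<And>\<tau>. \<bar>\<tau> - \<tau>0\<bar> < \<delta> \<Longrightarrow> \<bar>a \<tau> - a \<tau>0\<bar> < r / 2"
      unfolding a_def using facet_area_continuous[OF t k \<open>0 < \<tau>0\<close>, of "r / 2"] \<open>0 < r\<close> by auto
    have slope: "(a \<tau>0 - r / 2) * (\<tau>2 - \<tau>1) \<le> g \<tau>2 - g \<tau>1 \<and> g \<tau>2 - g \<tau>1 \<le> (a \<tau>0 + r / 2) * (\<tau>2 - \<tau>1)"
      if "\<tau>1 \<le> \<tau>2" "\<bar>\<tau>1 - \<tau>0\<bar> < \<delta>" "\<bar>\<tau>2 - \<tau>0\<bar> < \<delta>" for \<tau>1 \<tau>2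
    proof -
      have "0 < \<tau>1" using that \<delta> by linarith
      \<comment> \<open>The slab estimate takes a nonnegative lower bound, hence the maximum with
        0.\<close>
      have near: "max 0 (a \<tau>0 - r / 2) \<le> a \<tau> \<and> a \<tau> \<le> a \<tau>0 + r / 2" if "\<tau>1 < \<tau>" "\<tau> \<le> \<tau>2" for \<tau>
      proof -
        have "\<bar>\<tau> - \<tau>0\<bar> < \<delta>" using that \<open>\<bar>\<tau>1 - \<tau>0\<bar> < \<delta>\<close> \<open>\<bar>\<tau>2 - \<tau>0\<bar> < \<delta>\<close> by linarith
        then have "\<bar>a \<tau> - a \<tau>0\<bar> < r / 2" by (rule \<delta>(3))
        moreover have "0 \<le> a \<tau>" by (simp add: a_def facet_area_nonneg)
        ultimately show ?thesis by linarith
      qed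
      have "0 \<le> a \<tau>0 + r / 2" using facet_area_nonneg \<open>0 < r\<close> by (simp add: a_def)
      note slab = vol_slab[OF t k \<open>0 < \<tau>1\<close> that(1), of "max 0 (a \<tau>0 - r / 2)" "a \<tau>0 + r / 2", folded a_def, OF _ near this]
      have "(a \<tau>0 - r / 2) * (\<tau>2 - \<tau>1) \<le> max 0 (a \<tau>0 - r / 2) * (\<tau>2 - \<tau>1)"
        using that(1) by (intro mult_right_mono) auto
      then show ?thesis using slab by (simp add: g_def algebra_simps)
    qed
    have "\<bar>(g z - g \<tau>0) / (z - \<tau>0) - a \<tau>0\<bar> < r" if "z \<noteq> \<tau>0" "\<bar>z - \<tau>0\<bar> < \<delta>" for z
    proof -
      have "a \<tau>0 - r / 2 \<le> (g z - g \<tau>0) / (z - \<tau>0) \<and> (g z - g \<tau>0) / (z - \<tau>0) \<le> a \<tau>0 + r / 2"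
      proof (cases "\<tau>0 < z")
        case True
        then show ?thesis using slope[of \<tau>0 z] that \<delta>(1) by (simp add: le_divide_eq divide_le_eq)
      next
        case False
        then have "z < \<tau>0" using that by simp
        moreover have "(g z - g \<tau>0) / (z - \<tau>0) = (g \<tau>0 - g z) / (\<tau>0 - z)"
          using minus_divide_divide[of "g z - g \<tau>0" "z - \<tau>0"] by simp
        ultimately show ?thesis using slope[of z \<tau>0] that \<delta>(1) by (simp add: le_divide_eq divide_le_eq)
      qed
      then show ?thesis using \<open>0 < r\<close> by linarith
    qed
    then show "\<exists>s>0. \<forall>x. x \<noteq> \<tau>0 \<and> norm (x - \<tau>0) < s \<longrightarrow> norm ((g x - g \<tau>0) / (x - \<tau>0) - a \<tau>0) < r"
      using \<delta>(1) by (intro exI[of _ \<delta>]) auto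
  qed
  then show ?thesis by (simp add: has_field_derivative_iff g_def a_def)
qed

text \<open>
  The coordinates \<open>y i = t i powr q = h i powr p\<close>, where \<open>h i\<close> is the support number and \<open>p = - q\<close>,
  make the part of the energy that carries the prescribed measure linear.
\<close>

definition recip_support :: "(nat \<Rightarrow> real) \<Rightarrow> nat \<Rightarrow> real" where
  "recip_support y i = y i powr (1 / q)"

definition energy :: "(nat \<Rightarrow> real) \<Rightarrow> real" where
  "energy y = q * c * vol (recip_support y) + (\<Sum>i\<in>I. \<alpha> i * y i)"

text \<open>The partial derivative of the energy, in which the chain rule factor
  \<open>- (1 / q)\<close> has cancelled \<open>q\<close>. At \<open>y i = 0\<close> both the facet
  area and \<open>0 powr (- (1 + q))\<close> are 0, which leaves \<open>\<alpha> i\<close>.\<close>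

definition slope :: "nat \<Rightarrow> (nat \<Rightarrow> real) \<Rightarrow> real" where
  "slope i y = \<alpha> i - facet_area i (recip_support y) * recip_support y i powr (- (1 + q))"

lemma recip_support_adm: "y \<in> adm \<Longrightarrow> recip_support y \<in> adm"
  by (auto simp: adm_def recip_support_def zero_set_def)

lemma recip_support_tendsto:
  assumes "\<And>n. ys n \<in> adm" "i \<in> I" "(\<lambda>n. ys n i) \<longlonglongrightarrow> y i"
  shows "(\<lambda>n. recip_support (ys n) i) \<longlonglongrightarrow> recip_support y i"
  unfolding recip_support_def using assms q by (intro tendsto_powr' tendsto_const) (auto simp: adm_def)

lemma energy_tendsto:
  assumes "\<And>n. ys n \<in> adm" "y \<in> adm" "\<And>i. i \<in> I \<Longrightarrow> (\<lambda>n. ys n i) \<longlonglongrightarrow> y i"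
  shows "(\<lambda>n. energy (ys n)) \<longlonglongrightarrow> energy y"
  unfolding energy_def using assms
  by (intro tendsto_intros vol_tendsto recip_support_adm recip_support_tendsto) (auto simp: recip_support_def)

lemma slope_zero: "y i = 0 \<Longrightarrow> slope i y = \<alpha> i"
  by (simp add: slope_def recip_support_def)

text \<open>The delicate case is \<open>y j = 0\<close>, where the power of the support number blows
  up. There the j-th facet is already empty nearby, so the slope is eventually constant.\<close>

lemma slope_tendsto:
  assumes "\<And>n. ys n \<in> adm" "y \<in> adm" "\<And>i. i \<in> I \<Longrightarrow> (\<lambda>n. ys n i) \<longlonglongrightarrow> y i" "j \<in> I"
  shows "(\<lambda>n. slope j (ys n)) \<longlonglongrightarrow> slope j y"
proof (cases "y j = 0")
  case True
  have "\<forall>\<^sub>F n in sequentially. face j (recip_support (ys n)) = {}"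
  proof (rule face_empty_tendsto[OF recip_support_adm[OF assms(2)] _ _ assms(4)])
    show "(\<lambda>n. recip_support (ys n) i) \<longlonglongrightarrow> recip_support y i" if "i \<in> I" for i
      using assms(1) that assms(3)[OF that] by (rule recip_support_tendsto)
  qed (use True in \<open>auto simp: recip_support_def\<close>)
  then have "\<forall>\<^sub>F n in sequentially. slope j (ys n) = slope j y"
    by (rule eventually_mono) (subst slope_zero[of y j, OF True], simp add: slope_def facet_area_def)
  then show ?thesis by (rule tendsto_eventually)
next
  case False
  then have pos: "0 < recip_support y j" by (simp add: recip_support_def)
  then show ?thesis
    unfolding slope_def using assms
    by (intro tendsto_intros facet_area_tendsto[OF recip_support_adm] recip_support_tendsto) (auto simp: recip_support_def)
qed

lemma energy_derivative:
  assumes y: "y \<in> adm" and k: "k \<in> I" and "0 < s"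
  shows "((\<lambda>s. energy (y(k := s))) has_real_derivative slope k (y(k := s))) (at s)"
proof -
  have recip_support_upd: "recip_support (y(k := s)) = (recip_support y)(k := 1 / (s powr (- (1 / q))))" for s
    by (auto simp: recip_support_def powr_minus_divide)
  have sum_upd: "(\<Sum>i\<in>I. \<alpha> i * (y(k := s)) i) = (\<Sum>i\<in>I - {k}. \<alpha> i * y i) + \<alpha> k * s" for s
    using k by (subst sum.remove[of I k]) (auto simp: add.commute)
  let ?\<tau> = "s powr (- (1 / q))"
  have "((\<lambda>s. s powr (- (1 / q))) has_real_derivative - (1 / q) * s powr (- (1 / q) - 1)) (at s)"
    using \<open>0 < s\<close> by (rule has_real_derivative_powr)
  moreover have "((\<lambda>\<tau>. c * vol ((recip_support y)(k := 1 / \<tau>))) has_real_derivative facet_area k ((recip_support y)(k := 1 / ?\<tau>))) (at ?\<tau>)"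
    using \<open>0 < s\<close> by (intro vol_derivative recip_support_adm y k) simp
  ultimately have D: "((\<lambda>s. c * vol ((recip_support y)(k := 1 / (s powr (- (1 / q)))))) has_real_derivative
      facet_area k ((recip_support y)(k := 1 / ?\<tau>)) * (- (1 / q) * s powr (- (1 / q) - 1))) (at s)"
    by (rule DERIV_chain2[rotated])
  have "((\<lambda>s. q * (c * vol ((recip_support y)(k := 1 / (s powr (- (1 / q)))))) + ((\<Sum>i\<in>I - {k}. \<alpha> i * y i) + \<alpha> k * s)) has_real_derivative
      q * (facet_area k ((recip_support y)(k := 1 / ?\<tau>)) * (- (1 / q) * s powr (- (1 / q) - 1))) + (0 + \<alpha> k * 1)) (at s)"
    by (intro DERIV_add DERIV_cmult D DERIV_const DERIV_ident)
  moreover have "energy (y(k := s)) = q * (c * vol ((recip_support y)(k := 1 / (s powr (- (1 / q)))))) + ((\<Sum>i\<in>I - {k}. \<alpha> i * y i) + \<alpha> k * s)" for s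
    unfolding energy_def recip_support_upd sum_upd by simp
  moreover have "q * (facet_area k ((recip_support y)(k := 1 / ?\<tau>)) * (- (1 / q) * s powr (- (1 / q) - 1))) + (0 + \<alpha> k * 1) = slope k (y(k := s))"
  proof -
    have "(s powr (1 / q)) powr (- (1 + q)) = s powr (- (1 / q) - 1)"
      unfolding powr_powr using q by (intro arg_cong[where f = "\<lambda>e. s powr e"]) (simp add: field_simps)
    then show ?thesis
      unfolding slope_def recip_support_upd using q by (simp add: powr_minus_divide)
  qed
  ultimately show ?thesis by simp
qed

text \<open>The interval may begin at 0, where no derivative of the energy has been computed. The
  mean value theorem uses only continuity at the end points, and inside the interval the coordinate
  is positive.\<close>

lemma energy_mvt:
  assumes y: "y \<in> adm" and k: "k \<in> I" and s: "y(k := s) \<in> adm"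
  shows "\<exists>\<xi>. min (y k) s \<le> \<xi> \<and> \<xi> \<le> max (y k) s \<and> energy (y(k := s)) - energy y = slope k (y(k := \<xi>)) * (s - y k)"
proof -
  have main: "\<exists>\<xi>\<ge>a. \<xi> \<le> b \<and> energy (y(k := b)) - energy (y(k := a)) = slope k (y(k := \<xi>)) * (b - a)"
    if "a < b" "y(k := a) \<in> adm" "y(k := b) \<in> adm" for a b
  proof -
    have "0 \<le> (y(k := a)) k" using that(2) k unfolding adm_def by blast
    then have "0 \<le> a" by simp
    have between: "y(k := x) \<in> adm" if "x \<in> {a..b}" for x
      using that \<open>0 \<le> a\<close> \<open>y(k := a) \<in> adm\<close> adm_upd[OF \<open>y(k := a) \<in> adm\<close>, of x k] by (cases "x = a") auto
    have "continuous_on {a..b} (\<lambda>x. energy (y(k := x)))"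
    proof (rule continuous_on_sequentiallyI)
      fix x z assume "\<forall>n. x n \<in> {a..b}" "z \<in> {a..b}" "x \<longlonglongrightarrow> z"
      then show "(\<lambda>n. energy (y(k := x n))) \<longlonglongrightarrow> energy (y(k := z))"
        using between by (intro energy_tendsto) auto
    qed
    moreover have "(\<lambda>x. energy (y(k := x))) differentiable (at x)" if "a < x" "x < b" for x
      using energy_derivative[OF y k, of x] that \<open>0 \<le> a\<close> by (auto simp: real_differentiable_def)
    ultimately obtain l z where z: "a < z" "z < b" "DERIV (\<lambda>x. energy (y(k := x))) z :> l"
      "energy (y(k := b)) - energy (y(k := a)) = (b - a) * l"
      using MVT[OF \<open>a < b\<close>, of "\<lambda>x. energy (y(k := x))"] by blast
    have "l = slope k (y(k := z))"
      using DERIV_unique[OF z(3) energy_derivative[OF y k, of z]] z(1) \<open>0 \<le> a\<close> by simp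
    then show ?thesis using z by (intro exI[of _ z]) auto
  qed
  consider "y k = s" | "y k < s" | "s < y k" by linarith
  then show ?thesis
  proof cases
    case 1
    then have "y(k := s) = y" by auto
    then show ?thesis using 1 by (intro exI[of _ s]) auto
  next
    case 2
    then show ?thesis using main[of "y k" s] y s by auto
  next
    case 3
    then obtain \<xi> where "s \<le> \<xi>" "\<xi> \<le> y k" "energy y - energy (y(k := s)) = slope k (y(k := \<xi>)) * (y k - s)"
      using main[of s "y k"] y s by auto
    then show ?thesis using 3 by (intro exI[of _ \<xi>]) (auto simp: algebra_simps)
  qed
qed

section \<open>Properness of the energy\<close>

lemma vol_nonneg: "0 \<le> vol t"
  by (simp add: vol_def)

lemma energy_nonneg: "y \<in> adm \<Longrightarrow> 0 \<le> energy y"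
  unfolding energy_def using q c \<alpha> vol_nonneg
  by (intro add_nonneg_nonneg mult_nonneg_nonneg sum_nonneg) (auto simp: adm_def less_imp_le)

text \<open>
  Outside the admissible region the body contains a cylinder around a ray, so its volume is infinite.
\<close>

lemma open_body_infinite:
  assumes nonneg: "\<And>i. i \<in> I \<Longrightarrow> 0 \<le> t i" and "zero_set t \<notin> D"
  shows "emeasure lborel {x. \<forall>i\<in>I. t i * (x \<bullet> u i) < 1} = \<infinity>"
proof (rule ccontr)
  let ?O = "{x. \<forall>i\<in>I. t i * (x \<bullet> u i) < 1}"
  assume "emeasure lborel ?O \<noteq> \<infinity>"
  then obtain v where v: "emeasure lborel ?O = ennreal v" "0 \<le> v" by (cases "emeasure lborel ?O") auto
  have "pos_hull (u ` (I - zero_set t)) \<noteq> UNIV"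
    using assms(2) by (auto simp: pos_deletion_complex_def zero_set_def)
  then obtain w where w: "w \<noteq> 0" "\<And>x. x \<in> u ` (I - zero_set t) \<Longrightarrow> x \<bullet> w \<le> 0"
    using pos_hull_separation[of "u ` (I - zero_set t)"] by blast
  \<comment> \<open>Small enough for all inequalities at once: \<open>t i * r < 1\<close>, so a ball
    of radius \<open>r\<close> about any point of the ray along \<open>w\<close> satisfies every
    inequality strictly.\<close>
  define r where "r = 1 / (1 + (\<Sum>i\<in>I. t i))"
  have S: "0 \<le> (\<Sum>i\<in>I. t i)" using nonneg by (rule sum_nonneg)
  then have r: "0 < r" by (simp add: r_def)
  have tr: "t i * r < 1" if "i \<in> I" for i
  proof -
    have "t i \<le> (\<Sum>i\<in>I. t i)" using that nonneg by (intro member_le_sum) auto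
    then show ?thesis using S by (simp add: r_def divide_less_eq)
  qed
  \<comment> \<open>Centres at distance \<open>2 * r\<close> along the ray give infinitely many
    disjoint balls of equal volume.\<close>
  define B where "B k = ball ((real k * (2 * r / norm w)) *\<^sub>R w) r" for k
  have B_sub: "B k \<subseteq> ?O" for k
  proof
    fix x assume x: "x \<in> B k"
    let ?s = "real k * (2 * r / norm w)"
    have "norm (x - ?s *\<^sub>R w) < r" using x by (simp add: B_def dist_norm norm_minus_commute)
    have "t i * (x \<bullet> u i) < 1" if i: "i \<in> I" for i
    proof (cases "t i = 0")
      case False
      then have "u i \<bullet> w \<le> 0" using i by (intro w) (auto simp: zero_set_def)
      have "(x - ?s *\<^sub>R w) \<bullet> u i \<le> norm (x - ?s *\<^sub>R w) * norm (u i)" by (rule norm_cauchy_schwarz)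
      then have "(x - ?s *\<^sub>R w) \<bullet> u i \<le> r" using \<open>norm _ < r\<close> unit[OF i] by simp
      moreover have "?s * (w \<bullet> u i) \<le> 0"
        using \<open>u i \<bullet> w \<le> 0\<close> r by (intro mult_nonneg_nonpos) (auto simp: inner_commute)
      ultimately have "x \<bullet> u i \<le> r" by (simp add: inner_diff_left)
      then have "t i * (x \<bullet> u i) \<le> t i * r" using nonneg[OF i] by (rule mult_left_mono)
      then show ?thesis using tr[OF i] by simp
    qed simp
    then show "x \<in> ?O" by blast
  qed
  have disj: "disjoint_family_on B {..<m}" for m
    unfolding disjoint_family_on_def
  proof (intro ballI impI)
    fix k l :: nat assume "k \<noteq> l"
    have "dist ((real k * (2 * r / norm w)) *\<^sub>R w) ((real l * (2 * r / norm w)) *\<^sub>R w)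
        = norm (((real k - real l) * (2 * r / norm w)) *\<^sub>R w)"
      by (simp only: dist_norm scaleR_diff_left[symmetric] left_diff_distrib)
    also have "\<dots> = \<bar>real k - real l\<bar> * (2 * r)"
      using w(1) r by (simp add: abs_mult)
    finally have "dist ((real k * (2 * r / norm w)) *\<^sub>R w) ((real l * (2 * r / norm w)) *\<^sub>R w) = \<bar>real k - real l\<bar> * (2 * r)" .
    moreover have "1 \<le> \<bar>real k - real l\<bar>" using \<open>k \<noteq> l\<close> by linarith
    then have "1 * (2 * r) \<le> \<bar>real k - real l\<bar> * (2 * r)" using r by (intro mult_right_mono) auto
    ultimately show "B k \<inter> B l = {}"
      unfolding B_def by (intro disjoint_ballI) simp
  qed
  define b where "b = unit_ball_vol (real DIM(real ^ 'n)) * r ^ DIM(real ^ 'n)"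
  have b: "0 < b" using r by (simp add: b_def)
  have B_vol: "emeasure lborel (B k) = ennreal b" for k
    using r by (simp add: B_def b_def emeasure_ball)
  have "real m * b \<le> v" for m
  proof -
    have "ennreal (real m * b) = (\<Sum>k<m. emeasure lborel (B k))"
      using b by (simp add: B_vol ennreal_mult ennreal_of_nat_eq_real_of_nat)
    also have "\<dots> = emeasure lborel (\<Union>k<m. B k)"
    proof (rule sum_emeasure)
      show "B ` {..<m} \<subseteq> sets lborel" by (auto simp: B_def)
    qed (use disj in auto)
    also have "\<dots> \<le> emeasure lborel ?O"
      by (rule emeasure_mono) (use B_sub in \<open>auto simp: lborel_def\<close>)
    finally show ?thesis using v by (simp add: ennreal_le_iff)
  qed
  moreover obtain m where "v < real m * b" using reals_Archimedean3[OF b] by blast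
  ultimately show False by (meson not_le)
qed

text \<open>Fatou's lemma. The limit body is taken with strict inequalities, because these persist
  for all late terms of the sequence.\<close>

lemma vol_liminf:
  assumes lim: "\<And>i. i \<in> I \<Longrightarrow> (\<lambda>n. ts n i) \<longlonglongrightarrow> t i" and adm: "\<And>n. ts n \<in> adm" and "\<And>n. vol (ts n) \<le> C"
  shows "emeasure lborel {x. \<forall>i\<in>I. t i * (x \<bullet> u i) < 1} \<le> ennreal C"
proof -
  let ?O = "{x. \<forall>i\<in>I. t i * (x \<bullet> u i) < 1}"
  have O: "?O \<in> sets lborel" by simp
  have "emeasure lborel ?O = (\<integral>\<^sup>+x. indicator ?O x \<partial>lborel)" using O by simp
  also have "\<dots> \<le> (\<integral>\<^sup>+x. liminf (\<lambda>n. indicator (body (ts n)) x) \<partial>lborel)"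
  proof (rule nn_integral_mono)
    fix x
    show "indicator ?O x \<le> liminf (\<lambda>n. indicator (body (ts n)) x :: ennreal)"
    proof (cases "x \<in> ?O")
      case True
      have "\<forall>\<^sub>F n in sequentially. \<forall>i\<in>I. ts n i * (x \<bullet> u i) < 1"
      proof (rule eventually_ball_finite)
        show "\<forall>i\<in>I. \<forall>\<^sub>F n in sequentially. ts n i * (x \<bullet> u i) < 1"
          using order_tendstoD(2)[OF tendsto_mult[OF lim tendsto_const]] True by auto
      qed simp
      then have "\<forall>\<^sub>F n in sequentially. (1 :: ennreal) \<le> indicator (body (ts n)) x"
        by (rule eventually_mono) (auto simp: body_def indicator_def intro: less_imp_le)
      then have "(1 :: ennreal) \<le> liminf (\<lambda>n. indicator (body (ts n)) x)"
        by (rule Liminf_bounded)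
      then show ?thesis using True by simp
    qed simp
  qed
  also have "\<dots> \<le> liminf (\<lambda>n. (\<integral>\<^sup>+x. indicator (body (ts n)) x \<partial>lborel))"
    by (rule nn_integral_liminf) simp
  also have "\<dots> = liminf (\<lambda>n. emeasure lborel (body (ts n)))" by simp
  also have "\<dots> \<le> ennreal C"
  proof (rule Liminf_le)
    have "emeasure lborel (body (ts n)) = ennreal (vol (ts n))" for n
      unfolding vol_def using emeasure_compact_finite[OF body_compact[OF adm[of n]]]
      by (intro emeasure_eq_ennreal_measure) (auto simp: less_top)
    then show "\<forall>\<^sub>F n in sequentially. emeasure lborel (body (ts n)) \<le> ennreal C"
      using assms(3) by (simp add: ennreal_leI)
  qed simp
  finally show ?thesis .
qed

text \<open>The linear part of the energy bounds every coordinate by \<open>C / \<alpha> i\<close>,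
  which gives a limit point. If its zero set were outside \<open>D\<close>, the limit body would
  have infinite volume, contrary to the bound that Fatou's lemma passes to it.\<close>

lemma energy_proper:
  assumes ys: "\<And>n. ys n \<in> adm" and le: "\<And>n. energy (ys n) \<le> C"
  shows "\<exists>r y. strict_mono (r :: nat \<Rightarrow> nat) \<and> y \<in> adm \<and> (\<forall>i\<in>I. (\<lambda>n. ys (r n) i) \<longlonglongrightarrow> y i)"
proof -
  have y0: "0 \<le> ys n i" if "i \<in> I" for n i using ys[of n] that by (auto simp: adm_def)
  have sum0: "0 \<le> (\<Sum>i\<in>I. \<alpha> i * ys n i)" for n
    using y0 \<alpha> by (intro sum_nonneg mult_nonneg_nonneg) (auto simp: less_imp_le)
  have qc: "0 \<le> q * c * vol t" for t using q c vol_nonneg[of t] by simp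
  have "\<bar>ys n i\<bar> \<le> C / \<alpha> i" if "i \<in> I" for n i
  proof -
    have "\<alpha> i * ys n i \<le> (\<Sum>i\<in>I. \<alpha> i * ys n i)"
      using that y0 \<alpha> by (intro member_le_sum) (auto simp: less_imp_le)
    also have "\<dots> \<le> C" using le[of n] qc[of "recip_support (ys n)"] by (simp add: energy_def)
    finally show ?thesis using \<alpha>[OF that] y0[OF that] by (simp add: field_simps)
  qed
  then have "\<exists>r y. strict_mono (r :: nat \<Rightarrow> nat) \<and> (\<forall>i\<in>I. (\<lambda>n. ys (r n) i) \<longlonglongrightarrow> y i)"
    by (intro finite_bounded_convergent_subsequence[where B = "\<lambda>i. C / \<alpha> i"]) auto
  then obtain r y where r: "strict_mono (r :: nat \<Rightarrow> nat)" "\<And>i. i \<in> I \<Longrightarrow> (\<lambda>n. ys (r n) i) \<longlonglongrightarrow> y i"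
    by blast
  have y_nonneg: "0 \<le> y i" if "i \<in> I" for i
    using r(2)[OF that] by (rule LIMSEQ_le_const) (use y0 that in auto)
  have "zero_set y \<in> D"
  proof (rule ccontr)
    assume "zero_set y \<notin> D"
    moreover have "zero_set (recip_support y) = zero_set y" by (simp add: zero_set_def recip_support_def)
    ultimately have "emeasure lborel {x. \<forall>i\<in>I. recip_support y i * (x \<bullet> u i) < 1} = \<infinity>"
      by (intro open_body_infinite) (simp add: recip_support_def, simp)
    moreover have "emeasure lborel {x. \<forall>i\<in>I. recip_support y i * (x \<bullet> u i) < 1} \<le> ennreal (C / (q * c))"
    proof (rule vol_liminf[of "\<lambda>n. recip_support (ys (r n))"])
      show "(\<lambda>n. recip_support (ys (r n)) i) \<longlonglongrightarrow> recip_support y i" if "i \<in> I" for i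
        using ys r(2)[OF that] that by (intro recip_support_tendsto)
      show "recip_support (ys (r n)) \<in> adm" for n by (intro recip_support_adm ys)
      show "vol (recip_support (ys (r n))) \<le> C / (q * c)" for n
        using le[of "r n"] sum0[of "r n"] q c by (simp add: energy_def field_simps)
    qed
    ultimately show False by (simp add: top_unique)
  qed
  then show ?thesis using r y_nonneg by (intro exI[of _ r] exI[of _ y]) (auto simp: adm_def)
qed

sublocale energy_landscape I D energy slope \<alpha> adm
proof (unfold_locales, goal_cases)
  case 1
  show ?case by (rule adm_def)
next
  case (2 ys y j)
  then show ?case by (rule slope_tendsto)
next
  case (3 ys y)
  then show ?case by (rule energy_tendsto)
next
  case (4 y k s)
  then show ?case by (rule energy_mvt)
next
  case (5 y)
  then show ?case by (rule energy_nonneg)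
next
  case (6 ys C)
  then show ?case by (rule energy_proper)
next
  case (7 i)
  then show ?case by (rule \<alpha>)
next
  case (8 y i)
  then show ?case by (intro slope_zero)
qed

end

section \<open>Surface area measures of polytopes\<close>

context normal_vectors
begin

definition face_interior :: "nat \<Rightarrow> (nat \<Rightarrow> real) \<Rightarrow> (real ^ 'n) set" where
  "face_interior i t = {x \<in> face i t. \<forall>j\<in>I - {i}. t j * (x \<bullet> u j) < 1}"

lemma face_interior_borel [measurable]: "face_interior i t \<in> sets borel"
proof -
  have "face_interior i t = face i t \<inter> (\<Inter>j\<in>I - {i}. {x. t j * (x \<bullet> u j) < 1})"
    by (auto simp: face_interior_def)
  also have "open (\<Inter>j\<in>I - {i}. {x. t j * (x \<bullet> u j) < 1})"
    by (intro open_INT ballI open_Collect_less continuous_intros) auto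
  then have "face i t \<inter> (\<Inter>j\<in>I - {i}. {x. t j * (x \<bullet> u j) < 1}) \<in> sets borel"
    by (intro sets.Int face_borel borel_open)
  finally show ?thesis .
qed

lemma interior_bodyI:
  assumes "\<And>i. i \<in> I \<Longrightarrow> t i * (x \<bullet> u i) < 1"
  shows "x \<in> interior (body t)"
proof (rule interiorI)
  show "open (\<Inter>i\<in>I. {x. t i * (x \<bullet> u i) < 1})"
    by (intro open_INT ballI open_Collect_less continuous_intros) auto
qed (use assms in \<open>auto simp: body_def less_imp_le\<close>)

lemma tight_is_normal:
  assumes "i \<in> I" "0 < t i" "t i * (x \<bullet> u i) = 1"
  shows "u i \<in> outer_unit_normals (body t) x"
proof -
  have "(y - x) \<bullet> u i \<le> 0" if "y \<in> body t" for y
  proof -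
    have "t i * (y \<bullet> u i) \<le> t i * (x \<bullet> u i)" using that assms by (auto simp: body_def)
    then show ?thesis using assms(2) by (simp add: inner_diff_left)
  qed
  then show ?thesis using unit[OF assms(1)] by (simp add: outer_unit_normals_def)
qed

text \<open>Only the i-th inequality is tight, so a short step in any direction \<open>d\<close>
  with \<open>d \<bullet> u i \<le> 0\<close> stays in the body and every normal \<open>v\<close>
  satisfies \<open>d \<bullet> v \<le> 0\<close>. Suitable directions force
  \<open>v = u i\<close>.\<close>

lemma normals_of_face_interior:
  assumes i: "i \<in> I" "0 < t i" and x: "x \<in> face_interior i t"
  shows "outer_unit_normals (body t) x = {u i}"
proof -
  have tight: "t i * (x \<bullet> u i) = 1" using x by (simp add: face_interior_def face_def)
  have "v = u i" if "v \<in> outer_unit_normals (body t) x" for v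
  proof -
    have v: "norm v = 1" "\<And>y. y \<in> body t \<Longrightarrow> (y - x) \<bullet> v \<le> 0" using that by (auto simp: outer_unit_normals_def)
    let ?U = "\<Inter>j\<in>I - {i}. {x. t j * (x \<bullet> u j) < 1}"
    have "open ?U" by (intro open_INT ballI open_Collect_less continuous_intros) auto
    moreover have "x \<in> ?U" using x by (auto simp: face_interior_def)
    ultimately obtain e where e: "e > 0" "ball x e \<subseteq> ?U" using open_contains_ball by blast
    have dir: "d \<bullet> v \<le> 0" if d: "d \<bullet> u i \<le> 0" for d
    proof -
      define r where "r = e / (2 * (norm d + 1))"
      have nd: "0 < 2 * (norm d + 1)" by (intro mult_pos_pos add_nonneg_pos) auto
      have r: "0 < r" using e(1) nd by (simp add: r_def)
      have "r * norm d < e"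
        using e(1) nd by (simp add: r_def divide_less_eq)
      then have "x + r *\<^sub>R d \<in> ?U" using r e(2) by (auto simp: dist_norm subset_iff)
      then have "t j * ((x + r *\<^sub>R d) \<bullet> u j) < 1" if "j \<in> I - {i}" for j using that by blast
      moreover have "t i * ((x + r *\<^sub>R d) \<bullet> u i) \<le> 1"
      proof -
        have "t i * (r * (d \<bullet> u i)) \<le> 0" using d r i by (intro mult_nonneg_nonpos) auto
        then show ?thesis using tight by (simp add: inner_add_left distrib_left)
      qed
      ultimately have "t j * ((x + r *\<^sub>R d) \<bullet> u j) \<le> 1" if "j \<in> I" for j
        using that by (cases "j = i") (auto intro: less_imp_le)
      then have "x + r *\<^sub>R d \<in> body t" by (simp add: body_def)
      from v(2)[OF this] r show ?thesis by (simp add: mult_le_0_iff)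
    qed
    have uu: "u i \<bullet> u i = 1" "v \<bullet> v = 1" using unit[OF i(1)] v(1) by (simp_all add: dot_square_norm)
    let ?a = "v \<bullet> u i"
    have "(- u i) \<bullet> v \<le> 0" by (rule dir) (simp add: uu)
    then have a0: "0 \<le> ?a" by (simp add: inner_commute)
    \<comment> \<open>The direction \<open>- u i\<close> has shown \<open>?a\<close> to be
      nonnegative. The part of \<open>v\<close> orthogonal to \<open>u i\<close> now gives
      \<open>?a * ?a \<ge> 1\<close>, and unit vectors with inner product at least 1
      coincide.\<close>
    have "(v - ?a *\<^sub>R u i) \<bullet> v \<le> 0" by (rule dir) (simp add: inner_diff_left uu)
    then have sq: "1 \<le> ?a * ?a" by (simp add: inner_diff_left uu inner_commute[of "u i" v])
    have "1 \<le> ?a"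
    proof (rule ccontr)
      assume "\<not> 1 \<le> ?a"
      then have "?a * ?a \<le> 1 * ?a" using a0 by (intro mult_right_mono) auto
      with sq \<open>\<not> 1 \<le> ?a\<close> show False by linarith
    qed
    then have "(v - u i) \<bullet> (v - u i) \<le> 0"
      by (simp add: inner_diff_left inner_diff_right uu inner_commute[of "u i" v])
    then have "(v - u i) \<bullet> (v - u i) = 0" by (rule antisym[OF _ inner_ge_zero])
    then show ?thesis by (simp only: inner_eq_zero_iff right_minus_eq)
  qed
  then show ?thesis using tight_is_normal[of i t x, OF i tight] by blast
qed

text \<open>A point with two tight inequalities has two outer unit normals, distinct because
  \<open>u\<close> is injective. So uniqueness of the normal singles out the relative interiors of
  the facets.\<close>

lemma regular_boundary_body:
  assumes pos: "\<And>i. i \<in> I \<Longrightarrow> 0 < t i"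
  shows "{x \<in> regular_boundary (body t). gauss_map (body t) x \<in> \<omega>} = (\<Union>i\<in>{i \<in> I. u i \<in> \<omega>}. face_interior i t)"
proof (intro equalityI subsetI)
  fix x assume x: "x \<in> {x \<in> regular_boundary (body t). gauss_map (body t) x \<in> \<omega>}"
  then have "x \<in> body t" "x \<notin> interior (body t)"
    using closed_body[of t] by (auto simp: regular_boundary_def frontier_def)
  then obtain i where i: "i \<in> I" "\<not> t i * (x \<bullet> u i) < 1" using interior_bodyI by blast
  have tight: "t i * (x \<bullet> u i) = 1" using \<open>x \<in> body t\<close> i by (force simp: body_def)
  have uniq: "v = u i" if "v \<in> outer_unit_normals (body t) x" for v
    using x that tight_is_normal[of i t x, OF i(1) pos[OF i(1)] tight] by (auto simp: regular_boundary_def)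
  have "gauss_map (body t) x = u i"
    unfolding gauss_map_def using uniq tight_is_normal[of i t x, OF i(1) pos[OF i(1)] tight] by (intro the_equality)
  moreover have "t j * (x \<bullet> u j) < 1" if j: "j \<in> I - {i}" for j
  proof (rule ccontr)
    assume "\<not> ?thesis"
    then have "t j * (x \<bullet> u j) = 1" using \<open>x \<in> body t\<close> j by (force simp: body_def)
    then have "u j = u i" using j pos by (intro uniq tight_is_normal) auto
    then show False using inj_on_eq_iff[OF inj, of j i] i j by blast
  qed
  ultimately have "x \<in> face_interior i t" "u i \<in> \<omega>"
    using x i tight \<open>x \<in> body t\<close> by (simp_all add: face_interior_def face_def)
  then show "x \<in> (\<Union>i\<in>{i \<in> I. u i \<in> \<omega>}. face_interior i t)"
    using i by blast
next
  fix x assume "x \<in> (\<Union>i\<in>{i \<in> I. u i \<in> \<omega>}. face_interior i t)"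
  then obtain i where i: "i \<in> I" "u i \<in> \<omega>" "x \<in> face_interior i t" by blast
  note normals = normals_of_face_interior[OF i(1) pos[OF i(1)] i(3)]
  have xb: "x \<in> body t" "t i * (x \<bullet> u i) = 1" using i(3) by (auto simp: face_interior_def face_def)
  have "x \<notin> interior (body t)"
  proof
    assume "x \<in> interior (body t)"
    then obtain e where e: "e > 0" "ball x e \<subseteq> body t" using mem_interior by blast
    have "x + (e / 2) *\<^sub>R u i \<in> ball x e" using e(1) unit[OF i(1)] by (simp add: dist_norm)
    then have "t i * ((x + (e / 2) *\<^sub>R u i) \<bullet> u i) \<le> 1" using e(2) i(1) by (auto simp: body_def)
    moreover have "u i \<bullet> u i = 1" using unit[OF i(1)] by (simp add: dot_square_norm)
    ultimately have "t i * (e / 2) \<le> 0" using xb(2) by (simp add: inner_add_left distrib_left)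
    then show False using pos[OF i(1)] e(1) by (simp add: mult_le_0_iff)
  qed
  then have "x \<in> frontier (body t)" using xb closed_body[of t] by (simp add: frontier_def)
  then have "x \<in> regular_boundary (body t)" by (simp add: regular_boundary_def normals)
  moreover have "gauss_map (body t) x = u i" by (simp add: gauss_map_def normals)
  ultimately show "x \<in> {x \<in> regular_boundary (body t). gauss_map (body t) x \<in> \<omega>}" using i by simp
qed

text \<open>What is removed lies in finitely many intersections of two bounding hyperplanes, each of
  area 0.\<close>

lemma area_face_interior:
  assumes i: "i \<in> I" and pos: "\<And>j. j \<in> I \<Longrightarrow> 0 < t j"
  shows "area (face_interior i t) = area (face i t)"
proof (rule antisym)
  show "area (face_interior i t) \<le> area (face i t)"
    by (rule hausdorff_measure_mono) (auto simp: face_interior_def)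
  let ?X = "\<lambda>j. {x. t i * (x \<bullet> u i) = 1 \<and> t j * (x \<bullet> u j) = 1}"
  have X: "?X j \<in> null_sets (hausdorff (CARD('n) - 1))" if "j \<in> I - {i}" for j
  proof (rule null_setsI)
    have "?X j \<in> sets borel" by measurable
    then show "?X j \<in> sets (hausdorff (CARD('n) - 1))" by simp
    show "emeasure (hausdorff (CARD('n) - 1)) (?X j) = 0"
      unfolding emeasure_hausdorff[OF \<open>?X j \<in> sets borel\<close>] using that i pos
      by (intro area_face_intersection) (auto intro: less_imp_le)
  qed
  then have null: "(\<Union>j\<in>I - {i}. ?X j) \<in> null_sets (hausdorff (CARD('n) - 1))"
    by (intro null_sets_UN') auto
  have "face i t \<subseteq> face_interior i t \<union> (\<Union>j\<in>I - {i}. ?X j)"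
    by (force simp: face_interior_def face_def body_def)
  then have "area (face i t) \<le> area (face_interior i t \<union> (\<Union>j\<in>I - {i}. ?X j))"
    by (rule hausdorff_measure_mono)
  also have "\<dots> \<le> area (face_interior i t) + area (\<Union>j\<in>I - {i}. ?X j)"
    by (rule hausdorff_measure_Un)
  also have "area (\<Union>j\<in>I - {i}. ?X j) = 0"
    using null emeasure_hausdorff[of "\<Union>j\<in>I - {i}. ?X j" "CARD('n) - 1"] by auto
  finally show "area (face i t) \<le> area (face_interior i t)" by simp
qed

lemma area_UN_face_interior:
  assumes "K \<subseteq> I" and pos: "\<And>j. j \<in> I \<Longrightarrow> 0 < t j"
  shows "area (\<Union>i\<in>K. face_interior i t) = (\<Sum>i\<in>K. area (face i t))"
proof -
  have "finite K" using assms(1) finite_subset by blast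
  have disj: "disjoint_family_on (\<lambda>i. face_interior i t) K"
    unfolding disjoint_family_on_def
  proof (intro ballI impI equals0I)
    fix i j x assume "i \<in> K" "j \<in> K" "i \<noteq> j" and x: "x \<in> face_interior i t \<inter> face_interior j t"
    then have "t j * (x \<bullet> u j) < 1" using assms(1) by (auto simp: face_interior_def)
    moreover have "t j * (x \<bullet> u j) = 1" using x by (auto simp: face_interior_def face_def)
    ultimately show False by simp
  qed
  have "area (\<Union>i\<in>K. face_interior i t) = emeasure (hausdorff (CARD('n) - 1)) (\<Union>i\<in>K. face_interior i t)"
    by (rule emeasure_hausdorff[symmetric]) (use \<open>finite K\<close> in auto)
  also have "\<dots> = (\<Sum>i\<in>K. emeasure (hausdorff (CARD('n) - 1)) (face_interior i t))"
    by (rule sum_emeasure[symmetric]) (use disj \<open>finite K\<close> in auto)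
  also have "\<dots> = (\<Sum>i\<in>K. area (face i t))"
    using assms by (intro sum.cong refl) (auto simp: emeasure_hausdorff intro!: area_face_interior)
  finally show ?thesis .
qed

end

section \<open>Measures with finitely many atoms on the sphere\<close>

lemma space_sphere_borel [simp]: "space sphere_borel = sphere 0 1"
  by (simp add: sphere_borel_def space_restrict_space)

lemma measure_of_sphere_cong:
  fixes \<mu> \<mu>' :: "'a::euclidean_space set \<Rightarrow> ennreal"
  assumes "\<And>\<omega>. \<omega> \<in> sets sphere_borel \<Longrightarrow> \<mu> \<omega> = \<mu>' \<omega>"
  shows "measure_of (sphere 0 1) (sets sphere_borel) \<mu> = measure_of (sphere 0 1) (sets sphere_borel) \<mu>'"
proof (rule measure_of_eq)
  show "sets sphere_borel \<subseteq> Pow (sphere 0 1 :: 'a set)" using sets.space_closed[of "sphere_borel :: 'a measure"] by simp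
  show "\<mu> \<omega> = \<mu>' \<omega>" if "\<omega> \<in> sigma_sets (sphere 0 1) (sets sphere_borel)" for \<omega>
    using that sets.sigma_sets_eq[of "sphere_borel :: 'a measure"] assms by simp
qed

text \<open>As the image of a weighted counting measure the combination is visibly countably
  additive, and densities can be pulled back to the finite index set.\<close>

lemma dirac_combination_eq_distr:
  assumes "finite I" "\<And>i. i \<in> I \<Longrightarrow> norm (u i) = 1"
  shows "dirac_combination I \<alpha> u = distr (point_measure I (\<lambda>i. ennreal (\<alpha> i))) sphere_borel u"
proof -
  let ?M = "distr (point_measure I (\<lambda>i. ennreal (\<alpha> i))) sphere_borel u"
  have u: "u \<in> measurable (point_measure I (\<lambda>i. ennreal (\<alpha> i))) sphere_borel"
    using assms(2) by (simp add: measurable_point_measure_eq1)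
  have "?M = measure_of (space ?M) (sets ?M) (emeasure ?M)" by (rule measure_of_of_measure[symmetric])
  also have "\<dots> = measure_of (sphere 0 1) (sets sphere_borel) (emeasure ?M)" by simp
  also have "\<dots> = dirac_combination I \<alpha> u"
    unfolding dirac_combination_def
  proof (rule measure_of_sphere_cong)
    fix \<omega> :: "'b set" assume \<omega>: "\<omega> \<in> sets sphere_borel"
    have "emeasure ?M \<omega> = emeasure (point_measure I (\<lambda>i. ennreal (\<alpha> i))) (u -` \<omega> \<inter> I)"
      using u \<omega> by (simp add: emeasure_distr space_point_measure)
    also have "\<dots> = (\<Sum>i\<in>u -` \<omega> \<inter> I. ennreal (\<alpha> i))"
      using assms(1) by (intro emeasure_point_measure_finite) auto
    also have "\<dots> = (\<Sum>i\<in>I. if u i \<in> \<omega> then ennreal (\<alpha> i) else 0)"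
      using assms(1) by (subst sum.inter_filter[symmetric]) (auto intro!: sum.cong)
    also have "\<dots> = (\<Sum>i\<in>I. ennreal (\<alpha> i) * emeasure (return sphere_borel (u i)) \<omega>)"
      using \<omega> by (intro sum.cong) (auto simp: indicator_def)
    finally show "emeasure ?M \<omega> = (\<Sum>i\<in>I. ennreal (\<alpha> i) * emeasure (return sphere_borel (u i)) \<omega>)" .
  qed
  finally show ?thesis ..
qed

lemma density_dirac_combination:
  assumes "finite I" "\<And>i. i \<in> I \<Longrightarrow> norm (u i) = 1" and [measurable]: "f \<in> borel_measurable sphere_borel"
    and "\<And>i. i \<in> I \<Longrightarrow> ennreal (\<alpha> i) * f (u i) = ennreal (\<beta> i)"
  shows "density (dirac_combination I \<alpha> u) f = dirac_combination I \<beta> u"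
proof -
  have u: "u \<in> measurable (point_measure I (\<lambda>i. ennreal (\<alpha> i))) sphere_borel"
    using assms(2) by (simp add: measurable_point_measure_eq1)
  have "density (dirac_combination I \<alpha> u) f = density (distr (point_measure I (\<lambda>i. ennreal (\<alpha> i))) sphere_borel u) f"
    using dirac_combination_eq_distr[of I u \<alpha>] assms(1,2) by simp
  also have "\<dots> = distr (density (point_measure I (\<lambda>i. ennreal (\<alpha> i))) (\<lambda>i. f (u i))) sphere_borel u"
    by (rule density_distr[OF assms(3) u])
  also have "density (point_measure I (\<lambda>i. ennreal (\<alpha> i))) (\<lambda>i. f (u i)) = point_measure I (\<lambda>i. ennreal (\<beta> i))"
    unfolding point_measure_def using assms(4)
    by (subst density_density_eq) (auto intro!: density_cong simp: AE_count_space)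
  finally show ?thesis using dirac_combination_eq_distr[of I u \<beta>] assms(1,2) by simp
qed

text \<open>A bound \<open>R\<close> for the norms on \<open>K\<close> is a Lipschitz constant.
  Continuity serves to make the density of the measure measurable.\<close>

lemma continuous_support_function:
  fixes K :: "'a::euclidean_space set"
  assumes "bounded K" "K \<noteq> {}"
  shows "continuous_on UNIV (support_function K)"
proof -
  obtain R where R: "R > 0" "\<And>x. x \<in> K \<Longrightarrow> norm x \<le> R" using assms(1) bounded_pos by metis
  have bdd: "bdd_above ((\<lambda>x. x \<bullet> v) ` K)" for v
  proof (rule bdd_aboveI2)
    show "x \<bullet> v \<le> R * norm v" if "x \<in> K" for x
      using norm_cauchy_schwarz[of x v] mult_right_mono[OF R(2)[OF that], of "norm v"] by simp
  qed
  have le: "support_function K v \<le> support_function K w + R * dist v w" for v w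
    unfolding support_function_def
  proof (rule cSUP_least[OF assms(2)])
    fix x assume x: "x \<in> K"
    have "x \<bullet> v = x \<bullet> w + x \<bullet> (v - w)" by (simp add: inner_diff_right)
    also have "x \<bullet> w \<le> (SUP x\<in>K. x \<bullet> w)" using x by (intro cSUP_upper bdd)
    also have "x \<bullet> (v - w) \<le> norm x * norm (v - w)" by (rule norm_cauchy_schwarz)
    also have "\<dots> \<le> R * dist v w" using R(2)[OF x] by (simp add: dist_norm mult_right_mono)
    finally show "x \<bullet> v \<le> (SUP x\<in>K. x \<bullet> w) + R * dist v w" by simp
  qed
  show ?thesis
    unfolding continuous_on_iff
  proof (intro ballI allI impI)
    fix v :: 'a and e :: real assume "0 < e"
    show "\<exists>d>0. \<forall>w\<in>UNIV. dist w v < d \<longrightarrow> dist (support_function K w) (support_function K v) < e"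
    proof (intro exI[of _ "e / R"] conjI ballI impI)
      show "0 < e / R" using \<open>0 < e\<close> R(1) by simp
      fix w assume "dist w v < e / R"
      then have "R * dist w v < e" using R(1) by (simp add: field_simps)
      then show "dist (support_function K w) (support_function K v) < e"
        using le[of w v] le[of v w] by (simp add: dist_real_def dist_commute abs_less_iff)
    qed
  qed
qed

section \<open>From critical points to solutions\<close>

context minkowski_problem
begin

lemma surface_area_measure_body:
  assumes t: "t \<in> adm" and pos: "\<And>i. i \<in> I \<Longrightarrow> 0 < t i"
  shows "surface_area_measure (body t) = dirac_combination I (\<lambda>i. facet_area i t) u"
  unfolding surface_area_measure_def dirac_combination_def
proof (rule measure_of_sphere_cong)
  fix \<omega> :: "(real ^ 'n) set" assume \<omega>: "\<omega> \<in> sets sphere_borel"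
  have "{x \<in> regular_boundary (body t). gauss_map (body t) x \<in> \<omega>} = (\<Union>i\<in>{i \<in> I. u i \<in> \<omega>}. face_interior i t)"
    by (rule regular_boundary_body) (rule pos)
  moreover have "DIM(real ^ 'n) - 1 = CARD('n) - 1" by simp
  ultimately have "hausdorff_measure (DIM(real ^ 'n) - 1) {x \<in> regular_boundary (body t). gauss_map (body t) x \<in> \<omega>}
      = area (\<Union>i\<in>{i \<in> I. u i \<in> \<omega>}. face_interior i t)"
    by (simp only:)
  also have "\<dots> = (\<Sum>i\<in>{i \<in> I. u i \<in> \<omega>}. area (face i t))"
    using pos by (intro area_UN_face_interior) auto
  also have "\<dots> = (\<Sum>i\<in>I. if u i \<in> \<omega> then area (face i t) else 0)"
    by (rule sum.inter_filter) simp
  also have "\<dots> = (\<Sum>i\<in>I. ennreal (facet_area i t) * emeasure (return sphere_borel (u i)) \<omega>)"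
    using \<omega> t by (intro sum.cong) (auto simp: area_face indicator_def)
  finally show "hausdorff_measure (DIM(real ^ 'n) - 1) {x \<in> regular_boundary (body t). gauss_map (body t) x \<in> \<omega>}
      = (\<Sum>i\<in>I. ennreal (facet_area i t) * emeasure (return sphere_borel (u i)) \<omega>)" .
qed

lemma polytope_body:
  assumes "t \<in> adm"
  shows "polytope (body t)"
proof -
  have "polyhedron (\<Inter>i\<in>I. {x. (t i *\<^sub>R u i) \<bullet> x \<le> 1})"
  proof (rule polyhedron_Inter)
    show "polyhedron S" if "S \<in> (\<lambda>i. {x. (t i *\<^sub>R u i) \<bullet> x \<le> 1}) ` I" for S
      using that polyhedron_halfspace_le by blast
  qed simp
  moreover have "body t = (\<Inter>i\<in>I. {x. (t i *\<^sub>R u i) \<bullet> x \<le> 1})"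
    by (auto simp: body_def inner_commute)
  ultimately show ?thesis
    using compact_imp_bounded[OF body_compact[OF assms]] by (simp add: polytope_eq_bounded_polyhedron)
qed

text \<open>The inequality bounds the support function by \<open>1 / t i\<close>; a point of the
  nonempty face attains this value.\<close>

lemma support_function_body:
  assumes "i \<in> I" "0 < t i" "face i t \<noteq> {}"
  shows "support_function (body t) (u i) = 1 / t i"
  unfolding support_function_def
proof (rule cSup_eq_maximum)
  obtain x where x: "x \<in> body t" "t i * (x \<bullet> u i) = 1" using assms(3) by (auto simp: face_def)
  then have "x \<bullet> u i = 1 / t i" using assms(2) by (simp add: eq_divide_eq mult.commute)
  with x(1) show "1 / t i \<in> (\<lambda>x. x \<bullet> u i) ` body t" by force
  show "r \<le> 1 / t i" if "r \<in> (\<lambda>x. x \<bullet> u i) ` body t" for r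
    using that assms(1,2) by (auto simp: body_def le_divide_eq mult.commute)
qed

theorem critical_point_solves:
  assumes y: "y \<in> adm" and crit: "\<And>i. i \<in> I \<Longrightarrow> slope i y = 0"
  shows "\<exists>P. polytope P \<and> 0 \<in> interior P \<and> Lp_surface_area_measure (- q) P = dirac_combination I \<alpha> u"
proof (intro exI conjI)
  let ?t = "recip_support y"
  have t: "?t \<in> adm" by (rule recip_support_adm[OF y])
  have eq: "facet_area i ?t * ?t i powr (- (1 + q)) = \<alpha> i" if "i \<in> I" for i
    using crit[OF that] by (simp add: slope_def)
  \<comment> \<open>A vanishing factor would make \<open>\<alpha> i\<close> zero. So no inequality
    is absent, and in the same way each facet has positive area, which makes the support numbers
    those of the body.\<close>
  have pos: "0 < ?t i" if "i \<in> I" for i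
    using eq[OF that] \<alpha>[OF that] by (auto simp: recip_support_def less_le)
  have face_ne: "face i ?t \<noteq> {}" if "i \<in> I" for i
    using eq[OF that] \<alpha>[OF that] by (auto simp: facet_area_def)
  show "polytope (body ?t)" by (rule polytope_body[OF t])
  show "0 \<in> interior (body ?t)" by (rule interior_bodyI) simp
  then have "body ?t \<noteq> {}" using interior_subset by blast
  then have cont: "continuous_on UNIV (support_function (body ?t))"
    using compact_imp_bounded[OF body_compact[OF t]] by (intro continuous_support_function)
  have meas: "support_function (body ?t) \<in> borel_measurable sphere_borel"
    unfolding sphere_borel_def by (intro measurable_restrict_space1 borel_measurable_continuous_onI cont)
  have S: "surface_area_measure (body ?t) = dirac_combination I (\<lambda>i. facet_area i ?t) u"
    by (rule surface_area_measure_body[OF t]) (rule pos)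
  show "Lp_surface_area_measure (- q) (body ?t) = dirac_combination I \<alpha> u"
    unfolding Lp_surface_area_measure_def S
  proof (rule density_dirac_combination)
    show "(\<lambda>v. ennreal (support_function (body ?t) v powr (1 - - q))) \<in> borel_measurable sphere_borel"
      using meas by measurable
    fix i assume i: "i \<in> I"
    have "support_function (body ?t) (u i) powr (1 - - q) = ?t i powr (- (1 + q))"
      using pos[OF i] powr_minus_divide[of "?t i" "1 + q"]
      by (simp add: support_function_body[OF i pos[OF i] face_ne[OF i]] powr_divide)
    then show "ennreal (facet_area i ?t) * ennreal (support_function (body ?t) (u i) powr (1 - - q)) = ennreal (\<alpha> i)"
      using eq[OF i] facet_area_nonneg[of i ?t] by (simp add: ennreal_mult[symmetric])
  qed (use unit in auto)
qed

end

theorem theorem1p1: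
  fixes u :: "nat \<Rightarrow> real ^ 'n" and N :: nat and p :: real
  assumes "CARD('n) \<ge> 2"
    and "p < 0"
    and "inj_on u {1..N}"
    and "u ` {1..N} \<subseteq> sphere 0 1"
    and "pos_hull (u ` {1..N}) = UNIV"
    and "\<exists>k::int. k \<ge> -1 \<and> \<not> trivial_group (reduced_homology_Z2 (pos_deletion_complex N u) k)"
  shows "\<forall>\<alpha> :: nat \<Rightarrow> real. (\<forall>i\<in>{1..N}. \<alpha> i > 0) \<longrightarrow>
           (\<exists>P :: (real ^ 'n) set. polytope P \<and> 0 \<in> interior P \<and>
              Lp_surface_area_measure p P = dirac_combination {1..N} \<alpha> u)"
proof (intro allI impI)
  fix \<alpha> :: "nat \<Rightarrow> real" assume \<alpha>: "\<forall>i\<in>{1..N}. \<alpha> i > 0"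
  obtain c where c: "c > 0" "\<forall>v :: real ^ 'n. norm v = 1 \<longrightarrow> (\<forall>A\<in>sets borel.
     (\<integral>\<^sup>+\<tau>. area {x \<in> A. x \<bullet> v = \<tau>} \<partial>lborel) = ennreal c * emeasure lborel A)"
    using area_slices by blast
  interpret minkowski_problem u N "- p" c \<alpha>
  proof
    show "norm (u i) = 1" if "i \<in> {1..N}" for i
    proof -
      have "u i \<in> sphere 0 1" using assms(4) that by blast
      then show ?thesis by simp
    qed
  qed (use assms c \<alpha> in auto)
  obtain k :: int where "k \<ge> -1" "\<not> trivial_group (reduced_homology_Z2 (pos_deletion_complex N u) k)"
    using assms(6) by blast
  from critical_point_if_nontrivial_homology[OF this]
  obtain y where "y \<in> adm" "\<forall>i\<in>{1..N}. slope i y = 0" by blast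
  then show "\<exists>P. polytope P \<and> 0 \<in> interior P \<and> Lp_surface_area_measure p P = dirac_combination {1..N} \<alpha> u"
    using critical_point_solves[of y] by simp
qed

end
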